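(* Let $K$ be a knot (presented as a closed braid with one component), with HOMFLYPT homology $\mathcal{H}_0(K)=\bigoplus_{(i,j,k)\in\mathbb{Z}^3}\mathcal{H}_0^{i,j,k}(K)$. Then there are non-negative integers $D_{i,j}$, $(i,j)\in\mathbb{Z}\times\mathbb{Z}$, such that (1) $D_{i,j}=0$ for all but finitely many pairs of integers $i$ and $j$; (2) $\dim_{\mathbb{Q}}\mathcal{H}_0^{i,j,2T-j}(K)=D_{i,j}$ for all large integers $T$; (3) $\sum_{(i,j)\in\mathbb{Z}\times\mathbb{Z}}D_{i,j}$ is an odd number.
   Context: **Matrix factorizations.** Let $R=\mathbb{Q}[a,x_1,\dots,x_n]$ be $\mathbb{Z}^2$-graded by $\deg a=(2,0)$, $\deg x_i=(0,2)$; the two components are the $a$-grading $\deg_a$ and the $x$-grading $\deg_x$. For a $\mathbb{Z}^2$-graded $R$-module $M$, $M\{j,k\}$ is $M$ with degrees shifted up: $\deg_{M\{j,k\}}m=\deg_M m+(j,k)$. For $w\in R$ homogeneous of degree $(2,2)$, a $\mathbb{Z}_2\times\mathbb{Z}^2$-graded matrix factorization of $w$ is $M_0\xrightarrow{d_0}M_1\xrightarrow{d_1}M_0$ with $M_0,M_1$ $\mathbb{Z}^2$-graded free $R$-modules, $d_0,d_1$ homogeneous of degree $(1,1)$, $d_1d_0=w\cdot\mathrm{id}$, $d_0d_1=w\cdot\mathrm{id}$. $M\langle1\rangle$ denotes $M_1\xrightarrow{d_1}M_0\xrightarrow{d_0}M_1$. Tensor products over $R$ use the signed Leibniz rule. Morphisms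 are homogeneous $R$-maps preserving the $\mathbb{Z}_2$-grading and commuting with $d$; two morphisms $f,g:M\to M'$ of degree $(j,k)$ are homotopic ($\simeq$) if $f-g=d_{M'}h+hd_M$ for some $h:M\to M'\langle1\rangle$ of degree $(j-1,k-1)$ preserving the $\mathbb{Z}_2$-grading. For $a_0,a_1\in R$ homogeneous with $\deg a_0+\deg a_1=(2,2)$, $(a_0,a_1)_R$ is $R\xrightarrow{a_0}R\{1-\deg_a a_0,1-\deg_x a_0\}\xrightarrow{a_1}R$ (if an entry is $0$, its degree is prescribed by $\deg a_0+\deg a_1=(2,2)$); a Koszul matrix factorization given by several rows is the tensor product of those of its rows. **Local pieces.** All strands are oriented upwards. For an arc $A$ from a point marked $x_i$ to a point marked $x_s$: $\mathcal{C}_0(A)=(a,x_s-x_i)$ over $\mathbb{Q}[a,x_i,x_s]$. Consider four endpoints: bottom left $x_i$, bottom right $x_j$ (incoming), top left $x_s$, top right $x_t$ (outgoing). $\Gamma_0$ is the pair of disjoint arcs $x_i\to x_s$, $x_j\to x_t$, with $\mathcal{C}_0(\Gamma_0)=(a,x_s-x_i)\otimes(a,x_t-x_j)$; $\Gamma_1$ is the graph with one 4-valent vertex joined to the four endpoints, with $\mathcal{C}_0(\Gamma_1)=\big((a,\,x_s+x_t-x_i-x_j)\otimes(0,\,x_sx_t-x_ix_j)\big)\{0,-1\}$ (here the entry $0$ has degree $(2,-2)$), all over $\mathbb{Q}[a,x_i,x_j,x_s,x_t]$. There exist homotopically non-trivial homogeneous morphisms $\chi^0:\mathcal{C}_0(\Gamma_0)\to\mathcal{C}_0(\Gamma_1)$,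 $\chi^1:\mathcal{C}_0(\Gamma_1)\to\mathcal{C}_0(\Gamma_0)$ of degree $(0,1)$ (unique up to homotopy and nonzero scalars) with $\chi^1\chi^0\simeq(x_j-x_s)\mathrm{id}$ and $\chi^0\chi^1\simeq(x_j-x_s)\mathrm{id}$; fix such. Let $C_+$ be the positive crossing (the strand from $x_i$ to $x_t$ passes over the strand from $x_j$ to $x_s$) and $C_-$ the negative crossing (the strand from $x_j$ to $x_s$ passes over). To these are associated the complexes (homological degrees as indicated) $$\mathcal{C}_0(C_+)=\big[\underbrace{\mathcal{C}_0(\Gamma_1)\langle1\rangle\{1,0\}}_{-1}\xrightarrow{\chi^1}\underbrace{\mathcal{C}_0(\Gamma_0)\langle1\rangle\{1,-1\}}_{0}\big],\qquad \mathcal{C}_0(C_-)=\big[\underbrace{\mathcal{C}_0(\Gamma_0)\langle1\rangle\{-1,1\}}_{0}\xrightarrow{\chi^0}\underbrace{\mathcal{C}_0(\Gamma_1)\langle1\rangle\{-1,0\}}_{1}\big],$$ and $\mathcal{C}_0(A)$ is placed in homological degree $0$. **HOMFLYPT homology.** Given a closed braid $B$, put finitely many marked points with distinct variables $x_1,\dots,x_n$ in the interiors of its arcs (at least one on every arc between crossings, and on every crossingless circle), so that cutting at the marked points yields pieces $T_1,\dots,T_m$, each of type $A$, $C_+$ or $C_-$. With $R=\mathbb{Q}[a,x_1,\dots,x_n]$ and $R_q$ the ring of $T_q$, set $\mathcal{C}_0(B)=\bigotimes_{q=1}^m(\mathcal{C}_0(T_q)\otimes_{R_q}R)$ (tensor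 over $R$). It has two commuting differentials: $d_{mf}$ from the matrix factorization structure (the potential is $0$) and $d_\chi$ from the local complexes. Define $\mathcal{H}_0(B)=H(H(\mathcal{C}_0(B),d_{mf}),d_\chi)$. It is independent of the marking up to graded isomorphism. $\mathcal{H}_0^{i,j,k}(B)$ denotes the component of homological grading $i$, $a$-grading $j$, $x$-grading $k$; it is zero unless $j+k$ is even. *)

theory Defs
  imports
    "HOL-Library.Poly_Mapping"
    "HOL-Algebra.AbelCoset"
    "Jordan_Normal_Form.VS_Connect"
begin

section \<open>The polynomial rings\<close>

text \<open>Polynomials in the variables \<open>a\<close> (\<open>VarA\<close>) and \<open>x\<^sub>0, x\<^sub>1, \<dots>\<close> (\<open>VarX\<close>) over the rationals: finitely
  supported functions from monomials (exponent vectors) to coefficients.\<close>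

datatype var = VarA | VarX nat

type_synonym qpoly = "(var \<Rightarrow>\<^sub>0 nat) \<Rightarrow>\<^sub>0 rat"

definition Const :: "rat \<Rightarrow> qpoly"
  where "Const q = Poly_Mapping.single 0 q"

definition Var :: "var \<Rightarrow> qpoly"
  where "Var v = Poly_Mapping.single (Poly_Mapping.single v 1) 1"

abbreviation pA :: qpoly where "pA \<equiv> Var VarA"
abbreviation pX :: "nat \<Rightarrow> qpoly" where "pX k \<equiv> Var (VarX k)"

definition poly_ring :: "nat set \<Rightarrow> qpoly set"
  \<comment> \<open>the subring \<open>\<rat>[a, x\<^sub>k | k \<in> L]\<close>\<close>
  where "poly_ring L = {p. \<forall>m\<in>Poly_Mapping.keys p. Poly_Mapping.keys m \<subseteq> insert VarA (VarX ` L)}"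

definition deg_a :: "(var \<Rightarrow>\<^sub>0 nat) \<Rightarrow> int"
  where "deg_a m = 2 * int (Poly_Mapping.lookup m VarA)"

definition deg_x :: "(var \<Rightarrow>\<^sub>0 nat) \<Rightarrow> int"
  where "deg_x m = 2 * (\<Sum>v\<in>Poly_Mapping.keys m - {VarA}. int (Poly_Mapping.lookup m v))"

definition homog :: "int \<times> int \<Rightarrow> qpoly \<Rightarrow> bool"
  \<comment> \<open>homogeneous of the given degree; 0 is homogeneous of every degree\<close>
  where "homog d p \<longleftrightarrow> (\<forall>m\<in>Poly_Mapping.keys p. (deg_a m, deg_x m) = d)"

definition relabel :: "(var \<Rightarrow> var) \<Rightarrow> qpoly \<Rightarrow> qpoly"
  \<comment> \<open>the \<open>\<rat>\<close>-algebra homomorphism sending each variable \<open>v\<close> to \<open>f v\<close>; \<open>f\<close> need not be injective\<close>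
  where "relabel f p = (\<Sum>m\<in>Poly_Mapping.keys p. Const (Poly_Mapping.lookup p m) *
           (\<Prod>v\<in>Poly_Mapping.keys m. Var (f v) ^ Poly_Mapping.lookup m v))"

section \<open>Matrix factorizations and complexes of matrix factorizations\<close>

text \<open>A graded free module of finite rank is given by a set of homogeneous generators (a basis),
  and a linear map by its matrix: \<open>f c b\<close> is the coefficient of the generator \<open>c\<close> in the image of
  the generator \<open>b\<close>. The type \<open>gen\<close> has constructors for the generators of a one-row Koszul
  factorization (\<open>Row False\<close> in \<open>\<int>\<^sub>2\<close>-degree 0 and \<open>Row True\<close> in \<open>\<int>\<^sub>2\<close>-degree 1), of a tensor product,
  and of the source and the target of a two-term complex.\<close>

datatype gen = One | Row bool | Tens gen gen | Src gen | Tgt gen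

text \<open>A finite-rank free module with a \<open>\<int>\<^sub>2\<close>-grading (\<open>zodd\<close>: is the generator in degree 1?), an
  \<open>a\<close>- and an \<open>x\<close>-grading, a homological grading, and the differentials \<open>d\<^sub>m\<^sub>f\<close> and \<open>d\<^sub>\<chi>\<close>. A single
  matrix factorization is such an object with \<open>hdeg = 0\<close> and \<open>dchi = 0\<close>.\<close>

record cmf =
  gens :: "gen set"
  zodd :: "gen \<Rightarrow> bool"
  adeg :: "gen \<Rightarrow> int"
  xdeg :: "gen \<Rightarrow> int"
  hdeg :: "gen \<Rightarrow> int"
  dmf  :: "gen \<Rightarrow> gen \<Rightarrow> qpoly"
  dchi :: "gen \<Rightarrow> gen \<Rightarrow> qpoly"

definition koszul_row :: "qpoly \<Rightarrow> qpoly \<Rightarrow> int \<times> int \<Rightarrow> cmf"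
  \<comment> \<open>\<open>(a\<^sub>0, a\<^sub>1)\<^sub>R\<close>; the third argument is the degree of \<open>a\<^sub>0\<close>, which has to be prescribed when \<open>a\<^sub>0 = 0\<close>\<close>
  where "koszul_row a0 a1 d =
    \<lparr> gens = {Row False, Row True},
      zodd = (\<lambda>g. g = Row True),
      adeg = (\<lambda>g. if g = Row True then 1 - fst d else 0),
      xdeg = (\<lambda>g. if g = Row True then 1 - snd d else 0),
      hdeg = (\<lambda>_. 0),
      dmf = (\<lambda>c b. if c = Row True \<and> b = Row False then a0
                   else if c = Row False \<and> b = Row True then a1 else 0),
      dchi = (\<lambda>_ _. 0) \<rparr>"

definition unit_cmf :: cmf
  \<comment> \<open>the base ring, the unit of the tensor product\<close>
  where "unit_cmf =
    \<lparr> gens = {One}, zodd = (\<lambda>_. False), adeg = (\<lambda>_. 0), xdeg = (\<lambda>_. 0), hdeg = (\<lambda>_. 0),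
      dmf = (\<lambda>_ _. 0), dchi = (\<lambda>_ _. 0) \<rparr>"

text \<open>Signed Leibniz rules: the sign in \<open>d\<^sub>m\<^sub>f\<close> is governed by the \<open>\<int>\<^sub>2\<close>-degree of the left factor, the
  sign in \<open>d\<^sub>\<chi>\<close> by its homological degree, so that the two differentials commute.\<close>

definition tensor :: "cmf \<Rightarrow> cmf \<Rightarrow> cmf"
  where "tensor M N =
    \<lparr> gens = {Tens b b' | b b'. b \<in> gens M \<and> b' \<in> gens N},
      zodd = (\<lambda>g. case g of Tens b b' \<Rightarrow> zodd M b \<noteq> zodd N b' | _ \<Rightarrow> False),
      adeg = (\<lambda>g. case g of Tens b b' \<Rightarrow> adeg M b + adeg N b' | _ \<Rightarrow> 0),
      xdeg = (\<lambda>g. case g of Tens b b' \<Rightarrow> xdeg M b + xdeg N b' | _ \<Rightarrow> 0),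
      hdeg = (\<lambda>g. case g of Tens b b' \<Rightarrow> hdeg M b + hdeg N b' | _ \<Rightarrow> 0),
      dmf = (\<lambda>g h. case (g, h) of
          (Tens c c', Tens b b') \<Rightarrow>
             (if c' = b' then dmf M c b else 0)
             + (if c = b then (if zodd M b then - dmf N c' b' else dmf N c' b') else 0)
        | _ \<Rightarrow> 0),
      dchi = (\<lambda>g h. case (g, h) of
          (Tens c c', Tens b b') \<Rightarrow>
             (if c' = b' then dchi M c b else 0)
             + (if c = b then (if odd (hdeg M b) then - dchi N c' b' else dchi N c' b') else 0)
        | _ \<Rightarrow> 0) \<rparr>"

definition shift :: "int \<times> int \<Rightarrow> cmf \<Rightarrow> cmf"
  \<comment> \<open>\<open>M{j, k}\<close>\<close>
  where "shift d M = M\<lparr>adeg := \<lambda>b. adeg M b + fst d, xdeg := \<lambda>b. xdeg M b + snd d\<rparr>"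

definition flip :: "cmf \<Rightarrow> cmf"
  \<comment> \<open>\<open>M\<langle>1\<rangle>\<close>\<close>
  where "flip M = M\<lparr>zodd := \<lambda>b. \<not> zodd M b\<rparr>"

definition base_change :: "(var \<Rightarrow> var) \<Rightarrow> cmf \<Rightarrow> cmf"
  \<comment> \<open>extension of scalars along \<open>relabel f\<close>\<close>
  where "base_change f M =
    M\<lparr>dmf := \<lambda>c b. relabel f (dmf M c b), dchi := \<lambda>c b. relabel f (dchi M c b)\<rparr>"

definition two_term :: "int \<Rightarrow> cmf \<Rightarrow> (gen \<Rightarrow> gen \<Rightarrow> qpoly) \<Rightarrow> cmf \<Rightarrow> cmf"
  \<comment> \<open>the complex \<open>M \<rightarrow> N\<close> with differential \<open>f\<close>, where \<open>M\<close> is in homological degree \<open>r\<close> and \<open>N\<close> in \<open>r + 1\<close>\<close>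
  where "two_term r M f N =
    \<lparr> gens = Src ` gens M \<union> Tgt ` gens N,
      zodd = (\<lambda>g. case g of Src b \<Rightarrow> zodd M b | Tgt b \<Rightarrow> zodd N b | _ \<Rightarrow> False),
      adeg = (\<lambda>g. case g of Src b \<Rightarrow> adeg M b | Tgt b \<Rightarrow> adeg N b | _ \<Rightarrow> 0),
      xdeg = (\<lambda>g. case g of Src b \<Rightarrow> xdeg M b | Tgt b \<Rightarrow> xdeg N b | _ \<Rightarrow> 0),
      hdeg = (\<lambda>g. case g of Src b \<Rightarrow> r | Tgt b \<Rightarrow> r + 1 | _ \<Rightarrow> 0),
      dmf = (\<lambda>g h. case (g, h) of
          (Src c, Src b) \<Rightarrow> dmf M c b
        | (Tgt c, Tgt b) \<Rightarrow> dmf N c b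
        | _ \<Rightarrow> 0),
      dchi = (\<lambda>g h. case (g, h) of (Tgt c, Src b) \<Rightarrow> f c b | _ \<Rightarrow> 0) \<rparr>"

subsection \<open>Morphisms and homotopy\<close>

definition graded_map :: "nat set \<Rightarrow> cmf \<Rightarrow> cmf \<Rightarrow> int \<times> int \<Rightarrow> (gen \<Rightarrow> gen \<Rightarrow> qpoly) \<Rightarrow> bool"
  \<comment> \<open>linear over \<open>poly_ring L\<close>, preserving the \<open>\<int>\<^sub>2\<close>-grading, homogeneous of degree \<open>d\<close>\<close>
  where "graded_map L M N d f \<longleftrightarrow> (\<forall>b\<in>gens M. \<forall>c\<in>gens N.
     f c b \<in> poly_ring L \<and> (zodd M b \<noteq> zodd N c \<longrightarrow> f c b = 0) \<and>
     homog (adeg M b + fst d - adeg N c, xdeg M b + snd d - xdeg N c) (f c b))"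

definition mf_morphism :: "nat set \<Rightarrow> cmf \<Rightarrow> cmf \<Rightarrow> int \<times> int \<Rightarrow> (gen \<Rightarrow> gen \<Rightarrow> qpoly) \<Rightarrow> bool"
  where "mf_morphism L M N d f \<longleftrightarrow> graded_map L M N d f \<and>
    (\<forall>b\<in>gens M. \<forall>c\<in>gens N.
       (\<Sum>e\<in>gens N. dmf N c e * f e b) = (\<Sum>e\<in>gens M. f c e * dmf M e b))"

definition homotopic ::
    "nat set \<Rightarrow> cmf \<Rightarrow> cmf \<Rightarrow> int \<times> int \<Rightarrow> (gen \<Rightarrow> gen \<Rightarrow> qpoly) \<Rightarrow> (gen \<Rightarrow> gen \<Rightarrow> qpoly) \<Rightarrow> bool"
  where "homotopic L M N d f g \<longleftrightarrow>
    (\<exists>h. graded_map L M (flip N) (fst d - 1, snd d - 1) h \<and>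
       (\<forall>b\<in>gens M. \<forall>c\<in>gens N. f c b - g c b =
          (\<Sum>e\<in>gens N. dmf N c e * h e b) + (\<Sum>e\<in>gens M. h c e * dmf M e b)))"

definition compose_via :: "cmf \<Rightarrow> (gen \<Rightarrow> gen \<Rightarrow> qpoly) \<Rightarrow> (gen \<Rightarrow> gen \<Rightarrow> qpoly) \<Rightarrow> gen \<Rightarrow> gen \<Rightarrow> qpoly"
  \<comment> \<open>the matrix of \<open>g \<circ> f\<close> for \<open>f\<close> into and \<open>g\<close> out of \<open>N\<close>\<close>
  where "compose_via N g f = (\<lambda>c b. \<Sum>e\<in>gens N. g c e * f e b)"

definition scalar_map :: "qpoly \<Rightarrow> gen \<Rightarrow> gen \<Rightarrow> qpoly"
  where "scalar_map p = (\<lambda>c b. if c = b then p else 0)"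

section \<open>The local pieces\<close>

text \<open>Local marked points are numbered as follows. Arc: 0 is the start and 1 the end. Four-ended
  pieces: 0 is bottom left (\<open>x\<^sub>i\<close>), 1 bottom right (\<open>x\<^sub>j\<close>), 2 top left (\<open>x\<^sub>s\<close>), 3 top right (\<open>x\<^sub>t\<close>).\<close>

definition C0_arc :: cmf
  where "C0_arc = koszul_row pA (pX 1 - pX 0) (2, 0)"

definition C0_Gamma0 :: cmf
  where "C0_Gamma0 = tensor (koszul_row pA (pX 2 - pX 0) (2, 0)) (koszul_row pA (pX 3 - pX 1) (2, 0))"

definition C0_Gamma1 :: cmf
  where "C0_Gamma1 = shift (0, -1)
    (tensor (koszul_row pA (pX 2 + pX 3 - pX 0 - pX 1) (2, 0))
            (koszul_row 0 (pX 2 * pX 3 - pX 0 * pX 1) (2, -2)))"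

definition chi_maps :: "(gen \<Rightarrow> gen \<Rightarrow> qpoly) \<Rightarrow> (gen \<Rightarrow> gen \<Rightarrow> qpoly) \<Rightarrow> bool"
  \<comment> \<open>admissible choices of \<open>\<chi>\<^sup>0\<close> and \<open>\<chi>\<^sup>1\<close>\<close>
  where "chi_maps chi0 chi1 \<longleftrightarrow> (let L = {0, 1, 2, 3} in
     mf_morphism L C0_Gamma0 C0_Gamma1 (0, 1) chi0 \<and>
     mf_morphism L C0_Gamma1 C0_Gamma0 (0, 1) chi1 \<and>
     \<not> homotopic L C0_Gamma0 C0_Gamma1 (0, 1) chi0 (\<lambda>_ _. 0) \<and>
     \<not> homotopic L C0_Gamma1 C0_Gamma0 (0, 1) chi1 (\<lambda>_ _. 0) \<and>
     homotopic L C0_Gamma0 C0_Gamma0 (0, 2)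
       (compose_via C0_Gamma1 chi1 chi0) (scalar_map (pX 1 - pX 2)) \<and>
     homotopic L C0_Gamma1 C0_Gamma1 (0, 2)
       (compose_via C0_Gamma0 chi0 chi1) (scalar_map (pX 1 - pX 2)))"

definition C0_pos :: "(gen \<Rightarrow> gen \<Rightarrow> qpoly) \<Rightarrow> cmf"
  where "C0_pos chi1 =
    two_term (-1) (shift (1, 0) (flip C0_Gamma1)) chi1 (shift (1, -1) (flip C0_Gamma0))"

definition C0_neg :: "(gen \<Rightarrow> gen \<Rightarrow> qpoly) \<Rightarrow> cmf"
  where "C0_neg chi0 =
    two_term 0 (shift (-1, 1) (flip C0_Gamma0)) chi0 (shift (-1, 0) (flip C0_Gamma1))"

section \<open>Marked closed braids\<close>

text \<open>The pieces of a closed braid cut at its marked points, with the labels of the marked points at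
  their ends, in the order \<open>x\<^sub>i, x\<^sub>s\<close> for an arc and \<open>x\<^sub>i, x\<^sub>j, x\<^sub>s, x\<^sub>t\<close> for a crossing.\<close>

datatype piece = Arc nat nat | Pos nat nat nat nat | Neg nat nat nat nat

text \<open>The closed braid is cut open along a ray through marked points \<open>F\<close>, listed from left to right. It
  is then a stack of pieces, each given with the strand position of its left(most) end and attached
  on top of the current list of marked points. Every arc between two crossings meets the ray at most
  once, and every crossingless circle lies in one strand position, so, sliding marked points along
  arcs to the ray, every marking of a closed braid is obtained in this way.\<close>

fun stacks :: "nat list \<Rightarrow> (nat \<times> piece) list \<Rightarrow> nat list \<Rightarrow> bool" where
  "stacks F [] F' \<longleftrightarrow> F = F'"
| "stacks F ((p, Arc i s) # Ps) F' \<longleftrightarrow>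
     p < length F \<and> F ! p = i \<and> stacks (F[p := s]) Ps F'"
| "stacks F ((p, Pos i j s t) # Ps) F' \<longleftrightarrow>
     Suc p < length F \<and> F ! p = i \<and> F ! Suc p = j \<and> stacks (F[p := s, Suc p := t]) Ps F'"
| "stacks F ((p, Neg i j s t) # Ps) F' \<longleftrightarrow>
     Suc p < length F \<and> F ! p = i \<and> F ! Suc p = j \<and> stacks (F[p := s, Suc p := t]) Ps F'"

fun tops :: "piece \<Rightarrow> nat list" where
  "tops (Arc i s) = [s]"
| "tops (Pos i j s t) = [s, t]"
| "tops (Neg i j s t) = [s, t]"

fun positions :: "nat \<times> piece \<Rightarrow> nat set" where
  "positions (p, Arc i s) = {p}"
| "positions (p, Pos i j s t) = {p, Suc p}"
| "positions (p, Neg i j s t) = {p, Suc p}"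

text \<open>Every marked point is the upper end of exactly one piece, so the marked points \<open>x\<^sub>1, \<dots>, x\<^sub>n\<close> are
  distinct iff the list of all upper ends is. That every strand position is met by a piece rules out
  crossingless circles consisting of no piece at all.\<close>

definition marked_closed_braid :: "nat \<Rightarrow> nat list \<Rightarrow> (nat \<times> piece) list \<Rightarrow> bool"
  where "marked_closed_braid n F Ps \<longleftrightarrow>
    F \<noteq> [] \<and> stacks F Ps F \<and>
    (\<forall>p<length F. \<exists>P\<in>set Ps. p \<in> positions P) \<and>
    distinct (concat (map (tops \<circ> snd) Ps)) \<and>
    set (concat (map (tops \<circ> snd) Ps)) = {1..n}"

fun strands :: "piece \<Rightarrow> (nat \<times> nat) set" where
  "strands (Arc i s) = {(i, s)}"
| "strands (Pos i j s t) = {(i, t), (j, s)}"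
| "strands (Neg i j s t) = {(i, t), (j, s)}"

definition num_components :: "nat \<Rightarrow> (nat \<times> piece) list \<Rightarrow> nat"
  \<comment> \<open>going along the strands permutes the marked points, and the components are the orbits\<close>
  where "num_components n Ps = card ((\<lambda>u. (\<Union>P\<in>set Ps. strands (snd P))\<^sup>* `` {u}) ` {1..n})"

definition place :: "nat list \<Rightarrow> var \<Rightarrow> var"
  where "place ls v = (case v of VarA \<Rightarrow> VarA | VarX k \<Rightarrow> VarX (ls ! k))"

fun C0_piece :: "(gen \<Rightarrow> gen \<Rightarrow> qpoly) \<Rightarrow> (gen \<Rightarrow> gen \<Rightarrow> qpoly) \<Rightarrow> piece \<Rightarrow> cmf" where
  "C0_piece chi0 chi1 (Arc i s) = base_change (place [i, s]) C0_arc"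
| "C0_piece chi0 chi1 (Pos i j s t) = base_change (place [i, j, s, t]) (C0_pos chi1)"
| "C0_piece chi0 chi1 (Neg i j s t) = base_change (place [i, j, s, t]) (C0_neg chi0)"

definition C0 :: "(gen \<Rightarrow> gen \<Rightarrow> qpoly) \<Rightarrow> (gen \<Rightarrow> gen \<Rightarrow> qpoly) \<Rightarrow> (nat \<times> piece) list \<Rightarrow> cmf"
  where "C0 chi0 chi1 Ps = foldr tensor (map (C0_piece chi0 chi1 \<circ> snd) Ps) unit_cmf"

section \<open>Homology\<close>

text \<open>The multiplicative part of a \<open>module\<close> record plays no role and is left \<open>undefined\<close>.\<close>

definition total_space :: "nat set \<Rightarrow> cmf \<Rightarrow> (rat, gen \<Rightarrow> qpoly) module"
  \<comment> \<open>the free \<open>poly_ring L\<close>-module on the generators, as a vector space over \<open>\<rat>\<close>\<close>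
  where "total_space L M =
    \<lparr> carrier = {v. (\<forall>b\<in>gens M. v b \<in> poly_ring L) \<and> (\<forall>b. b \<notin> gens M \<longrightarrow> v b = 0)},
      mult = undefined, one = undefined,
      zero = (\<lambda>_. 0), add = (\<lambda>u v b. u b + v b),
      smult = (\<lambda>q v b. Const q * v b) \<rparr>"

definition apply_mat :: "cmf \<Rightarrow> (gen \<Rightarrow> gen \<Rightarrow> qpoly) \<Rightarrow> (gen \<Rightarrow> qpoly) \<Rightarrow> gen \<Rightarrow> qpoly"
  where "apply_mat M f v = (\<lambda>c. if c \<in> gens M then \<Sum>b\<in>gens M. f c b * v b else 0)"

definition component :: "nat set \<Rightarrow> cmf \<Rightarrow> int \<Rightarrow> int \<Rightarrow> int \<Rightarrow> (gen \<Rightarrow> qpoly) set"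
  \<comment> \<open>the elements of homological degree \<open>i\<close>, \<open>a\<close>-degree \<open>j\<close> and \<open>x\<close>-degree \<open>k\<close>\<close>
  where "component L M i j k = {v \<in> carrier (total_space L M). \<forall>b\<in>gens M.
     (hdeg M b \<noteq> i \<longrightarrow> v b = 0) \<and> homog (j - adeg M b, k - xdeg M b) (v b)}"

definition homology :: "('k, 'v) module \<Rightarrow> ('v \<Rightarrow> 'v) \<Rightarrow> ('k, 'v set) module"
  \<comment> \<open>\<open>H(V, d)\<close>; its elements are the cosets of the image of \<open>d\<close> in the kernel of \<open>d\<close>\<close>
  where "homology V d = (let B = d ` carrier V in
    \<lparr> carrier = {B +>\<^bsub>V\<^esub> z | z. z \<in> carrier V \<and> d z = \<zero>\<^bsub>V\<^esub>},
      mult = undefined, one = undefined,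
      zero = B, add = set_add V,
      smult = (\<lambda>q X. \<Union>x\<in>X. B +>\<^bsub>V\<^esub> (q \<odot>\<^bsub>V\<^esub> x)) \<rparr>)"

definition induced :: "('k, 'v) module \<Rightarrow> ('v \<Rightarrow> 'v) \<Rightarrow> ('v \<Rightarrow> 'v) \<Rightarrow> 'v set \<Rightarrow> 'v set"
  \<comment> \<open>the map induced on \<open>H(V, d)\<close> by a map \<open>f\<close> commuting with \<open>d\<close>\<close>
  where "induced V d f X = (\<Union>x\<in>X. (d ` carrier V) +>\<^bsub>V\<^esub> f x)"

definition homology_classes :: "('k, 'v) module \<Rightarrow> ('v \<Rightarrow> 'v) \<Rightarrow> 'v set \<Rightarrow> 'v set set"
  \<comment> \<open>the classes in \<open>H(V, d)\<close> represented by a cycle in \<open>S\<close>\<close>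
  where "homology_classes V d S = {X \<in> carrier (homology V d). X \<inter> S \<noteq> {}}"

text \<open>\<open>\<H>\<^sub>0\<close> and its graded components, for a closed braid with marked points \<open>x\<^sub>1, \<dots>, x\<^sub>n\<close>.\<close>

definition HH0_mf :: "nat \<Rightarrow> cmf \<Rightarrow> (rat, (gen \<Rightarrow> qpoly) set) module"
  where "HH0_mf n M = homology (total_space {1..n} M) (apply_mat M (dmf M))"

definition HH0_dchi :: "nat \<Rightarrow> cmf \<Rightarrow> (gen \<Rightarrow> qpoly) set \<Rightarrow> (gen \<Rightarrow> qpoly) set"
  where "HH0_dchi n M =
    induced (total_space {1..n} M) (apply_mat M (dmf M)) (apply_mat M (dchi M))"

definition HH0 :: "nat \<Rightarrow> cmf \<Rightarrow> (rat, (gen \<Rightarrow> qpoly) set set) module"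
  where "HH0 n M = homology (HH0_mf n M) (HH0_dchi n M)"

definition HH0_component :: "nat \<Rightarrow> cmf \<Rightarrow> int \<Rightarrow> int \<Rightarrow> int \<Rightarrow> (rat, (gen \<Rightarrow> qpoly) set set) module"
  where "HH0_component n M i j k = (HH0 n M)\<lparr>carrier :=
     homology_classes (HH0_mf n M) (HH0_dchi n M)
       (homology_classes (total_space {1..n} M) (apply_mat M (dmf M)) (component {1..n} M i j k))\<rparr>"

end

theory Submission
  imports Defs "HOL-Library.Function_Algebras" "HOL-Library.Product_Plus"
    "HOL-Library.Product_Lexorder"
begin

text \<open>
  Write \<open>C\<close> for the complex of the closed braid, \<open>E = H(C, d\<^sub>m\<^sub>f)\<close>, and \<open>H = H(E, d\<^sub>\<chi>)\<close>. The theorem says that the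
  dimensions of \<open>H\<close> become constant in the \<open>x\<close>-direction and that the limits have odd sum. The first part
  is a finiteness argument which uses that the braid closes up to a knot; the second is a computation of
  an Euler characteristic modulo 2.

  \<^emph>\<open>Stability.\<close> Every row \<open>(a, b)\<close> of a Koszul factorization makes multiplication by \<open>a\<close> and by \<open>b\<close>
  null-homotopic. So \<open>a\<close> acts as zero on \<open>E\<close>, and so do \<open>x\<^sub>s - x\<^sub>i\<close> for an arc and
  \<open>x\<^sub>s + x\<^sub>t - x\<^sub>i - x\<^sub>j\<close> for a crossing. At a crossing the map \<open>\<chi>\<close> that is not used as differential contracts
  \<open>x\<^sub>j - x\<^sub>s\<close> on the two-term complex, up to a homotopy for \<open>d\<^sub>m\<^sub>f\<close>; hence \<open>x\<^sub>j = x\<^sub>s\<close> and \<open>x\<^sub>i = x\<^sub>t\<close> on \<open>H\<close>.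
  Going once around a knot, all variables act on \<open>H\<close> in the same way, and \<open>a\<close> acts as zero
  (\<open>homotopy_action\<close>, \<open>variables_agree\<close>). On the other hand \<open>H = Z / B\<close> for graded submodules
  \<open>B \<subseteq> Z\<close> of a free module of finite rank, and \<open>Z\<close> is generated in bounded degree
  (\<open>generated_in_bounded_degree\<close>, the graded form of Hilbert's basis theorem). So in high degree
  multiplication by \<open>x\<^sub>1\<close> is onto from one graded piece of \<open>H\<close> to the next: the dimensions do
  not increase, and therefore stabilise.

  \<^emph>\<open>Parity.\<close> Fix \<open>c = k - j\<close> even; both differentials preserve \<open>c\<close>. Modulo 2 the total dimension
  of \<open>H\<close> for this \<open>c\<close> is that of \<open>E\<close>, say \<open>e(c)\<close>. As \<open>a\<close> is injective on \<open>C\<close> and zero on \<open>E\<close>, the long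
  exact sequence of \<open>0 \<rightarrow> C \<rightarrow> C \<rightarrow> C/aC \<rightarrow> 0\<close> gives \<open>e(c) + e(c + 2) = q(c)\<close> modulo 2, where \<open>q(c)\<close> is the
  dimension of the \<open>c\<close>-part of \<open>C/aC\<close> (\<open>echar_step\<close>). This is the number of monomials in \<open>x\<^sub>1, \<dots>, x\<^sub>n\<close> times
  generators, so its generating function is \<open>P(t) / (1 - t)\<^sup>n\<close>, with \<open>t\<^sup>m\<close> for \<open>c = 2m\<close> and \<open>P\<close> the
  Laurent polynomial counting generators. An arc contributes the factor \<open>1 + t\<close> to \<open>P\<close>, and a crossing of either sign contributes
  \<open>(1 + t)\<^sup>2\<close> modulo 2. There are as many factors \<open>1 + t\<close> as variables, so \<open>P(t) / (1 - t)\<^sup>n = 1\<close> modulo 2,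
  that is, \<open>q(c)\<close> is odd only for \<open>c = 0\<close> (\<open>genct_parity\<close>). Since \<open>e(c) = 0\<close> for very negative \<open>c\<close>, it is odd for
  all even \<open>c > 0\<close>.

  The dimensions are computed with subspaces of a fixed rational vector space. The last section
  identifies the graded pieces of \<open>H\<close>, which consist of cosets of cosets, with the quotients \<open>Z / B\<close>.
\<close>

section \<open>Dimensions of subspaces\<close>

text \<open>Only finite-dimensional subspaces of an infinite-dimensional space occur, so dimension counts are
  stated for subspaces with a finite spanning set.\<close>

locale rational_space = vector_space scale
  for scale :: "rat \<Rightarrow> 'b::ab_group_add \<Rightarrow> 'b"
begin

definition finite_span :: "'b set \<Rightarrow> bool"
  where "finite_span S \<longleftrightarrow> (\<exists>B. finite B \<and> S \<subseteq> span B)"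

lemma finite_span_subset: "finite_span T \<Longrightarrow> S \<subseteq> T \<Longrightarrow> finite_span S"
  unfolding finite_span_def by blast

lemma finite_span_basis:
  assumes "finite_span S"
  obtains B where "finite B" "B \<subseteq> S" "independent B" "S \<subseteq> span B" "card B = dim S"
proof -
  obtain B where B: "B \<subseteq> S" "independent B" "S \<subseteq> span B" "card B = dim S"
    using basis_exists by blast
  from assms obtain A where A: "finite A" "S \<subseteq> span A" unfolding finite_span_def by blast
  have "finite B" using independent_span_bound[OF A(1) B(2)] A(2) B(1) by blast
  with B that show thesis by blast
qed

lemma finite_span_image:
  assumes "Vector_Spaces.linear scale scale f" "finite_span S"
  shows "finite_span (f ` S)"
proof -
  interpret f: Vector_Spaces.linear scale scale f by fact
  from assms(2) obtain A where A: "finite A" "S \<subseteq> span A" unfolding finite_span_def by blast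
  then have "f ` S \<subseteq> span (f ` A)" using f.span_image by blast
  with A(1) show ?thesis unfolding finite_span_def by blast
qed

lemma finite_span_sums:
  assumes "finite_span S" "finite_span T"
  shows "finite_span {x + y |x y. x \<in> S \<and> y \<in> T}"
proof -
  from assms obtain A B where A: "finite A" "S \<subseteq> span A" "finite B" "T \<subseteq> span B"
    unfolding finite_span_def by blast
  then have "{x + y |x y. x \<in> S \<and> y \<in> T} \<subseteq> span (A \<union> B)"
    unfolding span_Un by blast
  with A show ?thesis unfolding finite_span_def by blast
qed

lemma dim_mono:
  assumes "finite_span T" "S \<subseteq> T"
  shows "dim S \<le> dim T"
proof -
  obtain B where B: "finite B" "T \<subseteq> span B" "card B = dim T"
    using finite_span_basis[OF assms(1)] by metis
  show ?thesis using dim_le_card[of S B] B assms(2) by auto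
qed

lemma dim_zero: "dim {0} = 0"
  using dim_eq_card[of "{}" "{0}"] independent_empty by auto

lemma rank_nullity:
  assumes f: "Vector_Spaces.linear scale scale f" and S: "subspace S" "finite_span S"
  shows "dim S = dim {x \<in> S. f x = 0} + dim (f ` S)"
proof -
  interpret f: Vector_Spaces.linear scale scale f by fact
  let ?K = "{x \<in> S. f x = 0}"
  have K: "subspace ?K"
    using S(1) unfolding subspace_def by (auto simp: f.add f.scale)
  have fK: "finite_span ?K" by (rule finite_span_subset[OF S(2)]) blast
  obtain B0 where B0: "finite B0" "B0 \<subseteq> ?K" "independent B0" "?K \<subseteq> span B0" "card B0 = dim ?K"
    by (rule finite_span_basis[OF fK])
  have "B0 \<subseteq> S" using B0(2) by blast
  then obtain B where B: "B0 \<subseteq> B" "B \<subseteq> S" "independent B" "S \<subseteq> span B"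
    using maximal_independent_subset_extend B0(3) by metis
  obtain A where A: "finite A" "S \<subseteq> span A" using S(2) unfolding finite_span_def by blast
  have finB: "finite B" using independent_span_bound[OF A(1) B(3)] A(2) B(2) by blast
  let ?C = "B - B0"
  have iC: "independent ?C" using independent_mono[OF B(3)] by blast
  have spS: "span B = S" using B S(1) by (metis span_subspace)
  have CS: "span ?C \<subseteq> S" using spS span_mono[of ?C B] by blast
  have zero: "x = 0" if x: "x \<in> span ?C" "f x = 0" for x
  proof -
    have x0: "x \<in> span B0" using x CS B0(4) by blast
    have r1: "representation B x = representation B0 x"
      by (rule representation_extend[OF B(3) x0 B(1)])
    have r2: "representation B x = representation ?C x"
      by (rule representation_extend[OF B(3) x(1)]) blast
    have "representation B0 x b = 0" for b
    proof (cases "b \<in> B0")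
      case True
      then have "representation ?C x b = 0" using representation_ne_zero[of ?C x b] by blast
      then show ?thesis using r1 r2 by simp
    next
      case False
      then show ?thesis using representation_ne_zero[of B0 x b] by blast
    qed
    then show ?thesis
      using sum_representation_eq[OF B0(3) x0 B0(1) order_refl] by simp
  qed
  have inj: "inj_on f (span ?C)"
    using f.inj_on_iff_eq_0[OF subspace_span] zero by blast
  have ind: "independent (f ` ?C)" by (rule f.independent_injective_image[OF iC inj])
  have card: "card (f ` ?C) = card ?C"
    by (rule card_image) (rule inj_on_subset[OF inj span_superset])
  have sub: "f ` S \<subseteq> span (f ` ?C)"
  proof -
    have "f ` S = span (f ` B)" using f.span_image spS by metis
    moreover have "f ` B \<subseteq> insert 0 (f ` ?C)" using B0(2) by auto
    ultimately show ?thesis using span_mono span_insert_0 by metis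
  qed
  have "dim (f ` S) = card (f ` ?C)"
    by (rule dim_unique[OF _ sub ind refl]) (use B in blast)
  moreover have "card B = dim S" by (rule basis_card_eq_dim[OF B(2,4,3)])
  moreover have "card B = card B0 + card ?C"
    using finB B(1) by (metis card_Diff_subset card_mono finite_subset le_add_diff_inverse)
  ultimately show ?thesis using B0(5) card by simp
qed

text \<open>Composition with such a \<open>p\<close> turns statements about quotients by \<open>T\<close> into statements about images.\<close>

lemma linear_with_kernel:
  assumes T: "subspace T"
  obtains p where "Vector_Spaces.linear scale scale p" "\<And>x. p x = 0 \<longleftrightarrow> x \<in> T"
proof -
  interpret P: vector_space_pair scale scale by unfold_locales
  obtain B0 where B0: "B0 \<subseteq> T" "independent B0" "T \<subseteq> span B0"
    using maximal_independent_subset by blast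
  have sp0: "span B0 = T" using B0 T by (metis span_subspace)
  obtain B where B: "B0 \<subseteq> B" "independent B" "UNIV \<subseteq> span B"
    using maximal_independent_subset_extend[OF subset_UNIV B0(2)] by metis
  define p where "p = P.construct B (\<lambda>b. if b \<in> B0 then 0 else b)"
  have lp: "Vector_Spaces.linear scale scale p" unfolding p_def by (rule P.linear_construct[OF B(2)])
  interpret p: Vector_Spaces.linear scale scale p by fact
  have pb: "p b = (if b \<in> B0 then 0 else b)" if "b \<in> B" for b
    unfolding p_def by (rule P.construct_basis[OF B(2) that])
  have diff: "x - p x \<in> T" for x
  proof -
    have "subspace {x. x - p x \<in> T}"
      using T unfolding subspace_def
      by (auto simp: p.add p.scale add_diff_add scale_right_diff_distrib[symmetric])
    moreover have "B \<subseteq> {x. x - p x \<in> T}"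
      using pb B0(1) subspace_0[OF T] by auto
    ultimately show ?thesis using B(3) span_minimal[of B "{x. x - p x \<in> T}"] by blast
  qed
  have "p x = 0" if "x \<in> T" for x
  proof -
    have "x \<in> span B0" using that sp0 by simp
    then show ?thesis using p.eq_0_on_span[of B0 x] pb B(1) by (metis subsetD)
  qed
  with diff have "p x = 0 \<longleftrightarrow> x \<in> T" for x by (metis diff_zero)
  with lp that show thesis by blast
qed

text \<open>This is the rank formula for the map \<open>S \<rightarrow> V / T\<close> induced by \<open>f\<close>, written without the quotient: its kernel
  is \<open>{x \<in> S. f x \<in> T}\<close> and its image is \<open>(f S + T) / T\<close>.\<close>

lemma dim_preimage:
  assumes f: "Vector_Spaces.linear scale scale f" and S: "subspace S" "finite_span S"
    and T: "subspace T" "finite_span T"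
  shows "dim S + dim T = dim {x \<in> S. f x \<in> T} + dim {f x + t |x t. x \<in> S \<and> t \<in> T}"
proof -
  interpret f: Vector_Spaces.linear scale scale f by fact
  obtain p where p: "Vector_Spaces.linear scale scale p" "\<And>x. p x = 0 \<longleftrightarrow> x \<in> T"
    using linear_with_kernel[OF T(1)] by blast
  interpret p: Vector_Spaces.linear scale scale p by (rule p)
  let ?W = "{f x + t |x t. x \<in> S \<and> t \<in> T}"
  have W: "?W = {y + t |y t. y \<in> f ` S \<and> t \<in> T}" by blast
  have sW: "subspace ?W" unfolding W
    by (rule subspace_sums[OF f.subspace_image[OF S(1)] T(1)])
  have fW: "finite_span ?W" unfolding W
    by (rule finite_span_sums[OF finite_span_image[OF f S(2)] T(2)])
  have lpf: "Vector_Spaces.linear scale scale (\<lambda>x. p (f x))"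
    by (unfold_locales) (auto simp: f.add f.scale p.add p.scale)
  have 1: "dim S = dim {x \<in> S. p (f x) = 0} + dim ((\<lambda>x. p (f x)) ` S)"
    by (rule rank_nullity[OF lpf S])
  have 2: "dim ?W = dim {x \<in> ?W. p x = 0} + dim (p ` ?W)"
    by (rule rank_nullity[OF p(1) sW fW])
  have 3: "{x \<in> ?W. p x = 0} = T"
  proof -
    have "t \<in> ?W" if "t \<in> T" for t
      using that subspace_0[OF S(1)] f.zero by (intro CollectI exI[of _ 0] exI[of _ t]) simp
    then show ?thesis using p(2) by blast
  qed
  have 4: "p ` ?W = (\<lambda>x. p (f x)) ` S"
  proof -
    have pt: "p (f x + t) = p (f x)" if "t \<in> T" for x t using that p(2)[of t] by (simp add: p.add)
    have "p (f x) \<in> p ` ?W" if "x \<in> S" for x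
      using that subspace_0[OF T(1)]
      by (intro image_eqI[of _ _ "f x + 0"] CollectI exI[of _ x] exI[of _ 0]) simp_all
    then show ?thesis using pt by blast
  qed
  have 5: "{x \<in> S. p (f x) = 0} = {x \<in> S. f x \<in> T}" by (simp only: p(2))
  show ?thesis using 1 2 unfolding 3 4 5 by linarith
qed

end

section \<open>The parity of stable dimensions\<close>

lemma sum_int_Suc:
  fixes f :: "int \<Rightarrow> int"
  assumes "l \<le> u + 1"
  shows "(\<Sum>j\<in>{l..u + 1}. f j) = (\<Sum>j\<in>{l..u}. f j) + f (u + 1)"
proof -
  have "{l..u + 1} = insert (u + 1) {l..u}" using assms by auto
  then show ?thesis by simp
qed

lemma even_telescope:
  fixes f :: "int \<Rightarrow> int"
  assumes "l - 1 \<le> u" "f (l - 1) = 0"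
  shows "even ((\<Sum>j\<in>{l..u}. f j + f (j - 1)) + f u)"
  using assms(1)
proof (induction u rule: int_ge_induct)
  case base
  then show ?case using assms(2) by simp
next
  case (step u)
  have "(\<Sum>j\<in>{l..u + 1}. f j + f (j - 1)) = (\<Sum>j\<in>{l..u}. f j + f (j - 1)) + (f (u + 1) + f u)"
    using sum_int_Suc[of l u "\<lambda>j. f j + f (j - 1)"] step(1) by simp
  then show ?case using step.IH by presburger
qed

lemma sum_int_shift:
  fixes f :: "int \<Rightarrow> int"
  shows "(\<Sum>j\<in>{l..u}. f (j - d)) = (\<Sum>j\<in>{l - d..u - d}. f j)"
  by (rule sum.reindex_bij_witness[of _ "\<lambda>j. j + d" "\<lambda>j. j - d"]) auto

text \<open>The linear algebra behind the theorem: \<open>d\<close> and \<open>s\<close> play the roles of \<open>d\<^sub>m\<^sub>f\<close> and \<open>d\<^sub>\<chi>\<close>, and \<open>a\<close> that of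
  multiplication by the variable \<open>a\<close>. The assumption \<open>a_null\<close> says that \<open>a\<close> is zero on the homology of \<open>d\<close>, and
  \<open>a_surj\<close> that \<open>C / aC\<close> lives in \<open>a\<close>-degrees at most \<open>jmax\<close>. The sum in \<open>count\<close> is the dimension of the part of
  \<open>C / aC\<close> with \<open>k - j = c\<close>.\<close>

locale trigraded_complex = rational_space scale
  for scale :: "rat \<Rightarrow> 'b::ab_group_add \<Rightarrow> 'b" +
  fixes C :: "int \<Rightarrow> int \<Rightarrow> int \<Rightarrow> 'b set"
    and d s a :: "'b \<Rightarrow> 'b"
    and imin imax jmin jmax kmin :: int
  assumes subspace_C: "subspace (C i j k)"
    and finite_span_C: "finite_span (C i j k)"
    and C_low_i: "i < imin \<Longrightarrow> C i j k = {0}"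
    and C_high_i: "imax < i \<Longrightarrow> C i j k = {0}"
    and C_low_j: "j < jmin \<Longrightarrow> C i j k = {0}"
    and C_low_k: "k < kmin \<Longrightarrow> C i j k = {0}"
    and range_i: "imin \<le> imax" and range_j: "jmin \<le> jmax"
    and linear_d: "Vector_Spaces.linear scale scale d"
    and linear_s: "Vector_Spaces.linear scale scale s"
    and linear_a: "Vector_Spaces.linear scale scale a"
    and d_C: "z \<in> C i j k \<Longrightarrow> d z \<in> C i (j + 1) (k + 1)"
    and s_C: "z \<in> C i j k \<Longrightarrow> s z \<in> C (i + 1) j k"
    and a_C: "z \<in> C i j k \<Longrightarrow> a z \<in> C i (j + 2) k"
    and d_d: "z \<in> C i j k \<Longrightarrow> d (d z) = 0"
    and s_s: "z \<in> C i j k \<Longrightarrow> s (s z) = 0"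
    and d_s: "z \<in> C i j k \<Longrightarrow> d (s z) = s (d z)"
    and a_d: "z \<in> C i j k \<Longrightarrow> a (d z) = d (a z)"
    and a_inj: "z \<in> C i j k \<Longrightarrow> a z = 0 \<Longrightarrow> z = 0"
    and a_surj: "jmax < j \<Longrightarrow> z \<in> C i j k \<Longrightarrow> \<exists>y\<in>C i (j - 2) k. z = a y"
    and a_null: "z \<in> C i j k \<Longrightarrow> d z = 0 \<Longrightarrow> \<exists>u\<in>C i (j + 1) (k - 1). a z = d u"
    and count: "even c \<Longrightarrow>
      odd (\<Sum>i\<in>{imin..imax}. \<Sum>j\<in>{jmin..jmax}.
        int (dim (C i j (j + c))) - int (dim (C i (j - 2) (j + c)))) \<longleftrightarrow> c = 0"
begin

interpretation d: Vector_Spaces.linear scale scale d by (rule linear_d)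
interpretation s: Vector_Spaces.linear scale scale s by (rule linear_s)
interpretation a: Vector_Spaces.linear scale scale a by (rule linear_a)

text \<open>The homology of \<open>d\<close> is \<open>Zd / Bd\<close>, and the homology of \<open>s\<close> on it is \<open>Zh / Bh\<close>.\<close>

definition Zd where "Zd i j k = {z \<in> C i j k. d z = 0}"
definition Bd where "Bd i j k = d ` C i (j - 1) (k - 1)"
definition Zh where "Zh i j k = {z \<in> Zd i j k. s z \<in> Bd (i + 1) j k}"
definition Bh where "Bh i j k = {s w + b |w b. w \<in> Zd (i - 1) j k \<and> b \<in> Bd i j k}"
definition hdim where "hdim i j k = dim (Zh i j k) - dim (Bh i j k)"

lemma subspace_Zd: "subspace (Zd i j k)"
  using subspace_C[of i j k] unfolding Zd_def subspace_def by (auto simp: d.add d.scale)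

lemma subspace_Bd: "subspace (Bd i j k)"
  unfolding Bd_def by (rule d.subspace_image[OF subspace_C])

lemma Bd_subset: "Bd i j k \<subseteq> Zd i j k"
  unfolding Bd_def Zd_def using d_C[of _ i "j - 1" "k - 1"] d_d[of _ i "j - 1" "k - 1"] by auto

lemma finite_span_Zd: "finite_span (Zd i j k)"
  by (rule finite_span_subset[OF finite_span_C[of i j k]]) (auto simp: Zd_def)

lemma finite_span_Bd: "finite_span (Bd i j k)"
  by (rule finite_span_subset[OF finite_span_Zd Bd_subset])

lemma subspace_Zh: "subspace (Zh i j k)"
  using subspace_Zd[of i j k] subspace_Bd[of "i + 1" j k] unfolding Zh_def subspace_def
  by (auto simp: s.add s.scale)

lemma finite_span_Zh: "finite_span (Zh i j k)"
  by (rule finite_span_subset[OF finite_span_Zd[of i j k]]) (auto simp: Zh_def)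

lemma s_Zd: "z \<in> Zd i j k \<Longrightarrow> s z \<in> Zd (i + 1) j k"
  using s_C d_s unfolding Zd_def by (auto simp: s.zero)

lemma Bh_subset: "Bh i j k \<subseteq> Zh i j k"
proof
  fix x assume "x \<in> Bh i j k"
  then obtain w b where x: "x = s w + b" and w: "w \<in> Zd (i - 1) j k" and b: "b \<in> Bd i j k"
    unfolding Bh_def by blast
  obtain u where u: "u \<in> C i (j - 1) (k - 1)" "b = d u" using b unfolding Bd_def by blast
  have "s w \<in> Zd i j k" using s_Zd[OF w] by simp
  then have xz: "x \<in> Zd i j k"
    unfolding x using subspace_add[OF subspace_Zd] b Bd_subset by blast
  have "s (s w) = 0" using w s_s unfolding Zd_def by blast
  then have "s x = d (s u)" using u d_s[OF u(1)] by (simp add: x s.add)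
  then have "s x \<in> Bd (i + 1) j k" unfolding Bd_def using s_C[OF u(1)] by blast
  with xz show "x \<in> Zh i j k" unfolding Zh_def by blast
qed

lemma subspace_Bh: "subspace (Bh i j k)"
proof -
  have "Bh i j k = {x + y |x y. x \<in> s ` Zd (i - 1) j k \<and> y \<in> Bd i j k}"
    unfolding Bh_def by blast
  then show ?thesis
    using subspace_sums[OF s.subspace_image[OF subspace_Zd] subspace_Bd] by simp
qed

lemma finite_span_Bh: "finite_span (Bh i j k)"
  by (rule finite_span_subset[OF finite_span_Zh Bh_subset])

lemma hdim_eq: "int (hdim i j k) = int (dim (Zh i j k)) - int (dim (Bh i j k))"
  unfolding hdim_def using dim_mono[OF finite_span_Zh Bh_subset] by (simp add: of_nat_diff)

text \<open>The map induced by \<open>s\<close> from \<open>Zd i / Bd i\<close> to the next homology has kernel \<open>Zh i / Bd i\<close> and image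
  \<open>Bh (i + 1) / Bd (i + 1)\<close>.\<close>

lemma Zh_Bh_next:
  "int (dim (Zd i j k)) + int (dim (Bd (i + 1) j k))
    = int (dim (Zh i j k)) + int (dim (Bh (i + 1) j k))"
  using dim_preimage[OF linear_s subspace_Zd finite_span_Zd subspace_Bd finite_span_Bd,
      of i j k "i + 1" j k]
  unfolding Zh_def Bh_def by (simp flip: of_nat_add)

lemma zero_outside:
  assumes "C i j k = {0}"
  shows "Zd i j k = {0}" "Zh i j k = {0}" "Bd i j k = {0}" "Bh i j k = {0}"
proof -
  have only: "S = {0}" if "subspace S" "S \<subseteq> {0}" for S
    using subspace_0[OF that(1)] that(2) by (metis subset_singletonD empty_iff)
  have 1: "Zd i j k \<subseteq> {0}" unfolding assms[symmetric] Zd_def by (rule Collect_restrict)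
  have 2: "Zh i j k \<subseteq> {0}" unfolding Zh_def by (rule subset_trans[OF Collect_restrict 1])
  show "Zd i j k = {0}" by (rule only[OF subspace_Zd 1])
  show "Zh i j k = {0}" by (rule only[OF subspace_Zh 2])
  show "Bd i j k = {0}" by (rule only[OF subspace_Bd subset_trans[OF Bd_subset 1]])
  show "Bh i j k = {0}" by (rule only[OF subspace_Bh subset_trans[OF Bh_subset 2]])
qed

definition edim where "edim i j k = int (dim (Zd i j k)) - int (dim (Bd i j k))"

text \<open>Modulo 2 the total dimension does not change when passing to the homology of \<open>s\<close>: by
  \<open>Zh_Bh_next\<close> the two sides differ by the ranks of \<open>s\<close>, each of which is counted twice.\<close>

lemma sum_hdim_parity:
  "even ((\<Sum>i\<in>{imin..imax}. int (hdim i j k)) + (\<Sum>i\<in>{imin..imax}. edim i j k))"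
proof -
  define f where "f i = int (dim (Bd (i + 1) j k)) - int (dim (Bh (i + 1) j k))" for i
  have z: "f (imin - 1 - 1) = 0" "f imax = 0"
    using zero_outside[OF C_low_i[of "imin - 1"]] zero_outside[OF C_high_i[of "imax + 1"]]
    by (simp_all add: f_def)
  have eq: "int (hdim i j k) + edim i j k
      = (f i + f (i - 1)) + 2 * (int (dim (Zd i j k)) - int (dim (Bd i j k)))" for i
    using Zh_Bh_next[of i j k] unfolding hdim_eq edim_def f_def by simp
  have "even ((\<Sum>i\<in>{imin - 1..imax}. f i + f (i - 1)) + f imax)"
    by (rule even_telescope) (use z range_i in auto)
  moreover have "(\<Sum>i\<in>{imin - 1..imax}. f i + f (i - 1))
      = (\<Sum>i\<in>{imin..imax}. f i + f (i - 1)) + (f (imin - 1) + f (imin - 1 - 1))"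
  proof -
    have "{imin - 1..imax} = insert (imin - 1) {imin..imax}" using range_i by auto
    then show ?thesis by simp
  qed
  moreover have "f (imin - 1) = 0"
  proof -
    have "Zd (imin - 1) j k = {0}" using zero_outside[OF C_low_i[of "imin - 1"]] by simp
    then have "Bh imin j k = Bd imin j k"
      unfolding Bh_def by (auto simp: s.zero)
    then show ?thesis by (simp add: f_def)
  qed
  ultimately have "even (\<Sum>i\<in>{imin..imax}. f i + f (i - 1))" using z by simp
  then have "even ((\<Sum>i\<in>{imin..imax}. f i + f (i - 1))
      + (\<Sum>i\<in>{imin..imax}. 2 * (int (dim (Zd i j k)) - int (dim (Bd i j k)))))"
    by (rule dvd_add) (auto intro: dvd_sum)
  then show ?thesis
    unfolding sum.distrib[symmetric] eq .
qed

text \<open>Above \<open>jmax\<close> a cycle \<open>z\<close> is divisible by \<open>a\<close>, say \<open>z = a y\<close>. Injectivity of \<open>a\<close> makes \<open>y\<close> a cycle, and then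
  \<open>a y\<close> is a boundary because \<open>a\<close> is zero on homology.\<close>

lemma edim_high:
  assumes "jmax < j" shows "edim i j k = 0"
proof -
  have "Zd i j k \<subseteq> Bd i j k"
  proof
    fix z assume z: "z \<in> Zd i j k"
    then have zC: "z \<in> C i j k" "d z = 0" unfolding Zd_def by auto
    obtain y where y: "y \<in> C i (j - 2) k" "z = a y" using a_surj[OF assms zC(1)] by blast
    have "a (d y) = 0" using a_d[OF y(1)] y(2) zC(2) by simp
    then have "d y = 0" using a_inj d_C[OF y(1)] by blast
    then obtain u where "u \<in> C i (j - 2 + 1) (k - 1)" "a y = d u" using a_null[OF y(1)] by blast
    then show "z \<in> Bd i j k" unfolding Bd_def y(2) by auto
  qed
  then have "Zd i j k = Bd i j k" using Bd_subset by blast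
  then show ?thesis unfolding edim_def by simp
qed

lemma hdim_high:
  assumes "jmax < j" shows "hdim i j k = 0"
proof -
  have "int (dim (Bd i j k)) = int (dim (Zd i j k))" using edim_high[OF assms, of i k]
    unfolding edim_def by simp
  moreover have "dim (Bd i j k) \<le> dim (Bh i j k)"
  proof (rule dim_mono[OF finite_span_Bh])
    show "Bd i j k \<subseteq> Bh i j k"
    proof
      fix b assume "b \<in> Bd i j k"
      then show "b \<in> Bh i j k" unfolding Bh_def
        using subspace_0[OF subspace_Zd] s.zero by (intro CollectI exI[of _ 0] exI[of _ b]) simp
    qed
  qed
  moreover have "dim (Zh i j k) \<le> dim (Zd i j k)"
    by (rule dim_mono[OF finite_span_Zd]) (auto simp: Zh_def)
  ultimately show ?thesis unfolding hdim_def by simp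
qed

definition echar where "echar c = (\<Sum>i\<in>{imin..imax}. \<Sum>j\<in>{jmin..jmax}. edim i j (j + c))"

text \<open>This is what remains modulo 2 of the long exact sequence of \<open>0 \<rightarrow> C \<rightarrow> C \<rightarrow> C/aC \<rightarrow> 0\<close>. Since the complexes are unbounded
  in \<open>j\<close>, the rank-nullity equations are summed up to just above \<open>jmax\<close>. The boundary terms that are left over cancel,
  because multiplication by \<open>a\<close> is an isomorphism there.\<close>

lemma echar_step_row:
  "even ((\<Sum>j\<in>{jmin..jmax}. edim i j (j + c)) + (\<Sum>j\<in>{jmin..jmax}. edim i j (j + (c + 2)))
    + (\<Sum>j\<in>{jmin..jmax}. int (dim (C i j (j + c))) - int (dim (C i (j - 2) (j + c)))))"
proof -
  define D where "D c j = int (dim (C i j (j + c)))" for c j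
  define r where "r c j = int (dim (d ` C i j (j + c)))" for c j
  have nullity: "edim i j (j + c) = D c j - (r c j + r c (j - 1))" for c j
  proof -
    have "dim (C i j (j + c)) = dim (Zd i j (j + c)) + dim (d ` C i j (j + c))"
      unfolding Zd_def by (rule rank_nullity[OF linear_d subspace_C finite_span_C])
    moreover have "Bd i j (j + c) = d ` C i (j - 1) (j - 1 + c)"
      unfolding Bd_def by (simp add: algebra_simps)
    ultimately show ?thesis unfolding edim_def D_def r_def by simp
  qed
  have a_iso: "D c (j + 2) = D (c + 2) j" if "jmax < j + 2" for j
  proof -
    have "C i (j + 2) (j + 2 + c) = a ` C i j (j + (c + 2))"
      using a_surj[OF that, of _ i "j + 2 + c"] a_C[of _ i j "j + 2 + c"]
      by (auto simp: algebra_simps)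
    moreover have "dim (C i j (j + (c + 2))) = dim {x \<in> C i j (j + (c + 2)). a x = 0}
        + dim (a ` C i j (j + (c + 2)))"
      by (rule rank_nullity[OF linear_a subspace_C finite_span_C])
    moreover have "{x \<in> C i j (j + (c + 2)). a x = 0} = {0}"
      using a_inj subspace_0[OF subspace_C] a.zero by blast
    ultimately show ?thesis unfolding D_def by (simp add: dim_zero)
  qed
  have r_iso: "r c (j + 2) = r (c + 2) j" if "jmax < j + 2" for j
  proof -
    have "C i (j + 2) (j + 2 + c) = a ` C i j (j + (c + 2))"
      using a_surj[OF that, of _ i "j + 2 + c"] a_C[of _ i j "j + 2 + c"]
      by (auto simp: algebra_simps)
    then have "d ` C i (j + 2) (j + 2 + c) = (\<lambda>x. d (a x)) ` C i j (j + (c + 2))"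
      by (simp add: image_image)
    also have "\<dots> = a ` (d ` C i j (j + (c + 2)))"
      unfolding image_image using a_d[of _ i j "j + (c + 2)"] by (intro image_cong) auto
    finally have img: "d ` C i (j + 2) (j + 2 + c) = a ` (d ` C i j (j + (c + 2)))" .
    have sub: "d ` C i j (j + (c + 2)) \<subseteq> C i (j + 1) (j + (c + 2) + 1)"
      using d_C by blast
    have "dim (d ` C i j (j + (c + 2))) = dim {x \<in> d ` C i j (j + (c + 2)). a x = 0}
        + dim (a ` (d ` C i j (j + (c + 2))))"
      by (rule rank_nullity[OF linear_a d.subspace_image[OF subspace_C]
            finite_span_image[OF linear_d finite_span_C]])
    moreover have "{x \<in> d ` C i j (j + (c + 2)). a x = 0} = {0}"
      using a_inj sub subspace_0[OF d.subspace_image[OF subspace_C[of i j "j + (c + 2)"]]] a.zero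
      by blast
    ultimately show ?thesis unfolding r_def img by (simp add: dim_zero)
  qed
  have Dlow: "D c j = 0" "r c j = 0" if "j < jmin" for c j
    unfolding D_def r_def C_low_j[OF that] by (simp_all add: dim_zero d.zero)
  have S: "even ((\<Sum>j\<in>{jmin..u}. edim i j (j + c)) + (\<Sum>j\<in>{jmin..u}. D c j) + r c u)"
    if "jmin - 1 \<le> u" for c u
  proof -
    have "even ((\<Sum>j\<in>{jmin..u}. r c j + r c (j - 1)) + r c u)"
      by (rule even_telescope) (use that Dlow in auto)
    moreover have "(\<Sum>j\<in>{jmin..u}. edim i j (j + c))
        = (\<Sum>j\<in>{jmin..u}. D c j) - (\<Sum>j\<in>{jmin..u}. r c j + r c (j - 1))"
      unfolding nullity sum_subtractf ..
    ultimately show ?thesis by presburger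
  qed
  have e0: "edim i (jmax + 1) (jmax + 1 + c) = 0" "edim i (jmax + 2) (jmax + 2 + c) = 0"
    by (rule edim_high, simp)+
  have s1: "(\<Sum>j\<in>{jmin..jmax + 1}. edim i j (j + c)) = (\<Sum>j\<in>{jmin..jmax}. edim i j (j + c))"
    using sum_int_Suc[of jmin jmax "\<lambda>j. edim i j (j + c)"] e0 range_j by simp
  have s2: "(\<Sum>j\<in>{jmin..jmax}. D c j - D (c + 2) (j - 2))
      = (\<Sum>j\<in>{jmin..jmax + 1}. D c j) - (\<Sum>j\<in>{jmin..jmax - 1}. D (c + 2) j)"
  proof -
    have "(\<Sum>j\<in>{jmin..jmax}. D c j - D (c + 2) (j - 2))
        = (\<Sum>j\<in>{jmin..jmax + 1}. D c j - D (c + 2) (j - 2))"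
      using sum_int_Suc[of jmin jmax "\<lambda>j. D c j - D (c + 2) (j - 2)"] a_iso[of "jmax - 1"] range_j
      by (simp add: add.commute)
    also have "\<dots> = (\<Sum>j\<in>{jmin..jmax + 1}. D c j) - (\<Sum>j\<in>{jmin - 2..jmax - 1}. D (c + 2) j)"
      unfolding sum_subtractf sum_int_shift[of "D (c + 2)" 2] by simp
    also have "(\<Sum>j\<in>{jmin - 2..jmax - 1}. D (c + 2) j) = (\<Sum>j\<in>{jmin..jmax - 1}. D (c + 2) j)"
      by (rule sum.mono_neutral_right) (auto simp: Dlow)
    finally show ?thesis .
  qed
  have s3: "(\<Sum>j\<in>{jmin..jmax}. D (c + 2) j) = (\<Sum>j\<in>{jmin..jmax - 1}. D (c + 2) j) + D (c + 2) jmax"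
    using sum_int_Suc[of jmin "jmax - 1" "D (c + 2)"] range_j by simp
  have top: "D (c + 2) jmax = r (c + 2) jmax + r c (jmax + 1)"
    using nullity[of "jmax + 2" c] e0 a_iso[of jmax] r_iso[of jmax] by (simp add: add.commute)
  have "D c j - D (c + 2) (j - 2) = int (dim (C i j (j + c))) - int (dim (C i (j - 2) (j + c)))" for j
    unfolding D_def by simp
  then have q: "(\<Sum>j\<in>{jmin..jmax}. int (dim (C i j (j + c))) - int (dim (C i (j - 2) (j + c))))
      = (\<Sum>j\<in>{jmin..jmax}. D c j - D (c + 2) (j - 2))" by simp
  have "even ((\<Sum>j\<in>{jmin..jmax}. edim i j (j + c)) + (\<Sum>j\<in>{jmin..jmax + 1}. D c j) + r c (jmax + 1))"
    using S[of "jmax + 1" c] s1 range_j by simp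
  moreover have "even ((\<Sum>j\<in>{jmin..jmax}. edim i j (j + (c + 2)))
      + (\<Sum>j\<in>{jmin..jmax}. D (c + 2) j) + r (c + 2) jmax)"
    using S[of jmax "c + 2"] range_j by simp
  ultimately show ?thesis unfolding q s2 s3 top by presburger
qed

lemma echar_step:
  assumes "even c"
  shows "odd (echar c + echar (c + 2)) \<longleftrightarrow> c = 0"
proof -
  let ?q = "\<lambda>i. \<Sum>j\<in>{jmin..jmax}. int (dim (C i j (j + c))) - int (dim (C i (j - 2) (j + c)))"
  have "even (\<Sum>i\<in>{imin..imax}. (\<Sum>j\<in>{jmin..jmax}. edim i j (j + c))
      + (\<Sum>j\<in>{jmin..jmax}. edim i j (j + (c + 2))) + ?q i)"
    by (rule dvd_sum) (rule echar_step_row)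
  then have "even (echar c + echar (c + 2) + (\<Sum>i\<in>{imin..imax}. ?q i))"
    unfolding echar_def sum.distrib .
  then show ?thesis using count[OF assms] unfolding even_add by blast
qed

lemma echar_low:
  assumes "c < kmin - jmax" shows "echar c = 0"
proof -
  have "edim i j (j + c) = 0" if "j \<le> jmax" for i j
    using zero_outside[OF C_low_k[of "j + c"]] that assms unfolding edim_def by simp
  then show ?thesis unfolding echar_def by simp
qed

lemma echar_parity:
  assumes "even c" shows "odd (echar c) \<longleftrightarrow> 0 < c"
proof -
  \<comment> \<open>low enough for \<open>echar_low\<close>, and below the jump at 0\<close>
  define m where "m = min (- 1) ((kmin - jmax) div 2 - 1)"
  have low: "echar (2 * b) = 0" if "b \<le> m" for b
    by (rule echar_low) (use that m_def in auto)
  have high: "odd (echar (2 * b)) \<longleftrightarrow> 0 < b" if "m \<le> b" for b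
    using that
  proof (induction b rule: int_ge_induct)
    case base
    have "m < 0" unfolding m_def by linarith
    then show ?case using low[of m] by simp
  next
    case (step b)
    have "odd (echar (2 * b) + echar (2 * (b + 1))) \<longleftrightarrow> b = 0"
      using echar_step[of "2 * b"] by (simp add: algebra_simps)
    then show ?case using step.IH by auto
  qed
  obtain b where "c = 2 * b" using assms by blast
  moreover have "m < 0" unfolding m_def by linarith
  ultimately show ?thesis using low[of b] high[of b] by (cases "m \<le> b") auto
qed

text \<open>The sum of the limits is read off from a single line \<open>k - j = 2 M\<close>, with \<open>M\<close> so large that all of the
  finitely many nonzero sequences are constant from there on.\<close>

theorem stable_dimensions_odd:
  assumes noninc: "\<And>i j. \<exists>K. \<forall>k\<ge>K. hdim i j (k + 2) \<le> hdim i j k"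
  shows "\<exists>D :: int \<Rightarrow> int \<Rightarrow> nat.
    finite {(i, j). D i j \<noteq> 0} \<and>
    (\<forall>i j. \<exists>T0 :: int. \<forall>T\<ge>T0. hdim i j (2 * T - j) = D i j) \<and>
    odd (\<Sum>(i, j) \<in> {(i, j). D i j \<noteq> 0}. D i j)"
proof -
  have stab: "\<exists>D. \<exists>T0 :: int. \<forall>T\<ge>T0. hdim i j (2 * T - j) = D" for i j
  proof -
    obtain K where K: "\<forall>k\<ge>K. hdim i j (k + 2) \<le> hdim i j k" using noninc by blast
    obtain T1 where T1: "K + j \<le> 2 * T1" by (rule that[of "max 0 (K + j)"]) (simp add: max_def)
    define f where "f m = hdim i j (2 * (T1 + int m) - j)" for m :: nat
    have le: "f (Suc m) \<le> f m" for m
    proof -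
      have "K \<le> 2 * (T1 + int m) - j" using T1 by simp
      then have "hdim i j (2 * (T1 + int m) - j + 2) \<le> hdim i j (2 * (T1 + int m) - j)"
        using K by blast
      moreover have "2 * (T1 + int (Suc m)) - j = 2 * (T1 + int m) - j + 2" by simp
      ultimately show ?thesis unfolding f_def by presburger
    qed
    define v where "v = (LEAST v. \<exists>m. f m = v)"
    have "\<exists>m. f m = v" unfolding v_def by (rule LeastI_ex) blast
    then obtain m0 where m0: "f m0 = v" by blast
    have min: "v \<le> f m" for m unfolding v_def by (rule Least_le) blast
    have "f m = v" if "m0 \<le> m" for m
      using that
    proof (induction m rule: dec_induct)
      case base show ?case by (rule m0)
    next
      case (step m) then show ?case using le[of m] min[of "Suc m"] by simp
    qed
    then have "hdim i j (2 * T - j) = v" if "T1 + int m0 \<le> T" for T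
    proof -
      have "m0 \<le> nat (T - T1)" "T1 + int (nat (T - T1)) = T" using that by linarith+
      then show ?thesis using \<open>\<And>m. m0 \<le> m \<Longrightarrow> f m = v\<close>[of "nat (T - T1)"] unfolding f_def by simp
    qed
    then show ?thesis by blast
  qed
  then obtain D where D: "\<And>i j. \<exists>T0 :: int. \<forall>T\<ge>T0. hdim i j (2 * T - j) = D i j" by metis
  then obtain T0 where T0: "\<And>i j T. T0 i j \<le> T \<Longrightarrow> hdim i j (2 * T - j) = D i j" by metis
  let ?I = "{imin..imax} \<times> {jmin..jmax}"
  have hz: "hdim i j k = 0" if "(i, j) \<notin> ?I" for i j k
  proof (cases "jmax < j")
    case True then show ?thesis by (rule hdim_high)
  next
    case False
    then have "i < imin \<or> imax < i \<or> j < jmin" using that by auto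
    then have "C i j k = {0}" using C_low_i C_high_i C_low_j by metis
    then show ?thesis unfolding hdim_def by (simp add: zero_outside(2,4))
  qed
  have out: "D i j = 0" if "(i, j) \<notin> ?I" for i j
    using T0[of i j "T0 i j"] hz[OF that] by simp
  then have supp: "{(i, j). D i j \<noteq> 0} \<subseteq> ?I"
    using out by (metis (mono_tags, lifting) case_prod_beta mem_Collect_eq prod.collapse subsetI)
  define M where "M = Max (insert 1 ((\<lambda>(i, j). T0 i j - j) ` ?I))"
  have M: "T0 i j - j \<le> M" if "(i, j) \<in> ?I" for i j
    unfolding M_def using that by (intro Max_ge) auto
  have M1: "1 \<le> M" unfolding M_def by (intro Max_ge) auto
  have Deq: "D i j = hdim i j (j + 2 * M)" if "(i, j) \<in> ?I" for i j
    using T0[of i j "j + M"] M[OF that] by (simp add: algebra_simps)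
  have "(\<Sum>(i, j) \<in> {(i, j). D i j \<noteq> 0}. D i j) = (\<Sum>(i, j) \<in> ?I. D i j)"
    by (rule sum.mono_neutral_left) (use supp in auto)
  also have "\<dots> = (\<Sum>(i, j) \<in> ?I. hdim i j (j + 2 * M))"
    by (rule sum.cong) (use Deq in auto)
  finally have "int (\<Sum>(i, j) \<in> {(i, j). D i j \<noteq> 0}. D i j)
      = (\<Sum>i\<in>{imin..imax}. \<Sum>j\<in>{jmin..jmax}. int (hdim i j (j + 2 * M)))"
    by (simp add: sum.cartesian_product case_prod_unfold)
  also have "\<dots> = (\<Sum>j\<in>{jmin..jmax}. \<Sum>i\<in>{imin..imax}. int (hdim i j (j + 2 * M)))"
    by (rule sum.swap)
  finally have sumD: "int (\<Sum>(i, j) \<in> {(i, j). D i j \<noteq> 0}. D i j)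
      = (\<Sum>j\<in>{jmin..jmax}. \<Sum>i\<in>{imin..imax}. int (hdim i j (j + 2 * M)))" .
  have "even (\<Sum>j\<in>{jmin..jmax}. (\<Sum>i\<in>{imin..imax}. int (hdim i j (j + 2 * M)))
      + (\<Sum>i\<in>{imin..imax}. edim i j (j + 2 * M)))"
    by (rule dvd_sum) (rule sum_hdim_parity)
  then have "even (int (\<Sum>(i, j) \<in> {(i, j). D i j \<noteq> 0}. D i j) + echar (2 * M))"
    unfolding sum.distrib sumD echar_def by (subst (asm) (2) sum.swap) 
  moreover have "odd (echar (2 * M))" using echar_parity[of "2 * M"] M1 by simp
  ultimately have "odd (int (\<Sum>(i, j) \<in> {(i, j). D i j \<noteq> 0}. D i j))"
    unfolding even_add by blast
  then have "odd (\<Sum>(i, j) \<in> {(i, j). D i j \<noteq> 0}. D i j)" by (simp only: even_of_nat not_False_eq_True)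
  moreover have "finite {(i, j). D i j \<noteq> 0}" using supp by (rule finite_subset) auto
  ultimately show ?thesis using D by blast
qed

text \<open>The map need only be onto for the quotients \<open>Zh / Bh\<close>, hence the error term in \<open>Bh\<close>.\<close>

lemma hdim_noninc:
  assumes x: "Vector_Spaces.linear scale scale x"
    and xB: "\<And>z. z \<in> Bh i j k \<Longrightarrow> x z \<in> Bh i j k'"
    and surj: "\<And>z. z \<in> Zh i j k' \<Longrightarrow> \<exists>y\<in>Zh i j k. z - x y \<in> Bh i j k'"
  shows "hdim i j k' \<le> hdim i j k"
proof -
  interpret x: Vector_Spaces.linear scale scale x by (rule x)
  have "dim (Zh i j k) + dim (Bh i j k') = dim {z \<in> Zh i j k. x z \<in> Bh i j k'}
      + dim {x z + t |z t. z \<in> Zh i j k \<and> t \<in> Bh i j k'}"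
    by (rule dim_preimage[OF x subspace_Zh finite_span_Zh subspace_Bh finite_span_Bh])
  moreover have "dim (Bh i j k) \<le> dim {z \<in> Zh i j k. x z \<in> Bh i j k'}"
    by (rule dim_mono[OF finite_span_subset[OF finite_span_Zh[of i j k]]])
      (use xB Bh_subset[of i j k] in blast)+
  moreover have "dim (Zh i j k') \<le> dim {x z + t |z t. z \<in> Zh i j k \<and> t \<in> Bh i j k'}"
  proof (rule dim_mono)
    have eq: "{x z + t |z t. z \<in> Zh i j k \<and> t \<in> Bh i j k'}
        = {y + t |y t. y \<in> x ` Zh i j k \<and> t \<in> Bh i j k'}" by blast
    show "finite_span {x z + t |z t. z \<in> Zh i j k \<and> t \<in> Bh i j k'}" unfolding eq
      by (rule finite_span_sums[OF finite_span_image[OF x finite_span_Zh] finite_span_Bh])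
    show "Zh i j k' \<subseteq> {x z + t |z t. z \<in> Zh i j k \<and> t \<in> Bh i j k'}"
    proof
      fix z assume "z \<in> Zh i j k'"
      then obtain y where "y \<in> Zh i j k" "z - x y \<in> Bh i j k'" using surj by blast
      then show "z \<in> {x z + t |z t. z \<in> Zh i j k \<and> t \<in> Bh i j k'}"
        by (intro CollectI exI[of _ y] exI[of _ "z - x y"]) simp
    qed
  qed
  ultimately show ?thesis unfolding hdim_def by linarith
qed

end

section \<open>Polynomials\<close>

subsection \<open>Monomials and degrees\<close>

definition mdeg :: "(var \<Rightarrow>\<^sub>0 nat) \<Rightarrow> int \<times> int"
  where "mdeg m = (deg_a m, deg_x m)"

lemma deg_x_superset:
  assumes "finite A" "Poly_Mapping.keys m \<subseteq> A"
  shows "deg_x m = 2 * (\<Sum>v\<in>A - {VarA}. int (Poly_Mapping.lookup m v))"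
proof -
  have "(\<Sum>v\<in>Poly_Mapping.keys m - {VarA}. int (Poly_Mapping.lookup m v))
      = (\<Sum>v\<in>A - {VarA}. int (Poly_Mapping.lookup m v))"
    by (rule sum.mono_neutral_left) (use assms in \<open>auto simp: in_keys_iff\<close>)
  then show ?thesis unfolding deg_x_def by simp
qed

lemma mdeg_add: "mdeg (m + m') = mdeg m + mdeg m'"
proof -
  let ?A = "Poly_Mapping.keys m \<union> Poly_Mapping.keys m'"
  have "deg_x (m + m') = 2 * (\<Sum>v\<in>?A - {VarA}. int (Poly_Mapping.lookup (m + m') v))"
    by (rule deg_x_superset) (use Poly_Mapping.keys_add[of m m'] in auto)
  moreover have "deg_x m = 2 * (\<Sum>v\<in>?A - {VarA}. int (Poly_Mapping.lookup m v))"
    by (rule deg_x_superset) auto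
  moreover have "deg_x m' = 2 * (\<Sum>v\<in>?A - {VarA}. int (Poly_Mapping.lookup m' v))"
    by (rule deg_x_superset) auto
  ultimately have "deg_x (m + m') = deg_x m + deg_x m'"
    by (simp add: lookup_add sum.distrib)
  then show ?thesis unfolding mdeg_def deg_a_def by (simp add: lookup_add)
qed

lemma mdeg_0: "mdeg 0 = (0, 0)"
  unfolding mdeg_def deg_a_def deg_x_def by simp

definition vdeg :: "var \<Rightarrow> int \<times> int"
  where "vdeg v = (if v = VarA then (2, 0) else (0, 2))"

abbreviation unit_mon :: "var \<Rightarrow> (var \<Rightarrow>\<^sub>0 nat)"
  where "unit_mon v \<equiv> Poly_Mapping.single v 1"

lemma mdeg_unit: "mdeg (unit_mon v) = vdeg v"
  unfolding mdeg_def deg_a_def deg_x_def vdeg_def by (auto simp: lookup_single)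

lemma mdeg_unit_Suc [simp]: "mdeg (Poly_Mapping.single v (Suc 0)) = vdeg v"
  using mdeg_unit by simp

lemma homog_mdeg: "homog d p \<longleftrightarrow> (\<forall>m\<in>Poly_Mapping.keys p. mdeg m = d)"
  unfolding homog_def mdeg_def ..

subsection \<open>Coefficients of products\<close>

lemma poly_mapping_sum_singles:
  fixes p :: qpoly
  shows "p = (\<Sum>m\<in>Poly_Mapping.keys p. Poly_Mapping.single m (Poly_Mapping.lookup p m))"
proof (rule poly_mapping_eqI)
  fix k
  show "Poly_Mapping.lookup p k
    = Poly_Mapping.lookup (\<Sum>m\<in>Poly_Mapping.keys p. Poly_Mapping.single m (Poly_Mapping.lookup p m)) k"
    by (auto simp: lookup_sum lookup_single when_def in_keys_iff)
qed

lemma keys_mult_elim: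
  fixes p q :: qpoly
  assumes "k \<in> Poly_Mapping.keys (p * q)"
  obtains l m where "k = l + m" "l \<in> Poly_Mapping.keys p" "m \<in> Poly_Mapping.keys q"
  using assms Poly_Mapping.keys_mult[of p q] by blast

lemma lookup_single_times:
  fixes p :: qpoly
  shows "Poly_Mapping.lookup (Poly_Mapping.single u c * p) (u + m) = c * Poly_Mapping.lookup p m"
proof -
  have "Poly_Mapping.single u c * p = (\<Sum>k\<in>Poly_Mapping.keys p. Poly_Mapping.single (u + k) (c * Poly_Mapping.lookup p k))"
    by (subst poly_mapping_sum_singles[of p]) (simp add: sum_distrib_left mult_single)
  then show ?thesis
    by (auto simp: lookup_sum lookup_single when_def in_keys_iff)
qed

lemma lookup_Const_times: "Poly_Mapping.lookup (Const c * p) m = c * Poly_Mapping.lookup p m"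
  using lookup_single_times[of 0 c p m] unfolding Const_def by simp

lemma lookup_Var_times:
  "Poly_Mapping.lookup (Var v * p) k = (if Poly_Mapping.lookup k v = 0 then 0
    else Poly_Mapping.lookup p (k - unit_mon v))"
proof (cases "Poly_Mapping.lookup k v = 0")
  case True
  have "k \<notin> Poly_Mapping.keys (Var v * p)"
  proof
    assume "k \<in> Poly_Mapping.keys (Var v * p)"
    then obtain l m where "k = l + m" "l \<in> Poly_Mapping.keys (Var v)" by (rule keys_mult_elim)
    then show False using True unfolding Var_def by (simp add: lookup_add)
  qed
  with True show ?thesis by (simp add: in_keys_iff)
next
  case False
  have "unit_mon v + (k - unit_mon v) = k"
    by (rule poly_mapping_eqI) (use False in \<open>auto simp: lookup_add lookup_minus lookup_single when_def\<close>)
  then show ?thesis using False lookup_single_times[of "unit_mon v" 1 p "k - unit_mon v"]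
    unfolding Var_def by simp
qed

lemma lookup_Var_times_add: "Poly_Mapping.lookup (Var v * p) (unit_mon v + m) = Poly_Mapping.lookup p m"
  using lookup_single_times[of "unit_mon v" 1 p m] unfolding Var_def by simp

lemma Var_times_eq_0: "Var v * p = 0 \<Longrightarrow> p = 0"
  by (rule poly_mapping_eqI) (metis lookup_Var_times_add lookup_zero)

text \<open>Division by a variable; all monomials without this variable are discarded.\<close>

lift_definition drop_var :: "var \<Rightarrow> qpoly \<Rightarrow> qpoly"
  is "\<lambda>v p m. p (unit_mon v + m)"
proof -
  fix v :: var and p :: "(var \<Rightarrow>\<^sub>0 nat) \<Rightarrow> rat"
  assume "finite {m. p m \<noteq> 0}"
  then have "finite ((\<lambda>m. unit_mon v + m) -` {m. p m \<noteq> 0})"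
    by (rule finite_vimageI) (auto simp: inj_on_def)
  then show "finite {m. p (unit_mon v + m) \<noteq> 0}" by (simp add: vimage_def)
qed

lemma Var_times_drop_var:
  assumes "\<And>m. m \<in> Poly_Mapping.keys p \<Longrightarrow> Poly_Mapping.lookup m v \<noteq> 0"
  shows "Var v * drop_var v p = p"
proof (rule poly_mapping_eqI)
  fix k
  show "Poly_Mapping.lookup (Var v * drop_var v p) k = Poly_Mapping.lookup p k"
  proof (cases "Poly_Mapping.lookup k v = 0")
    case True
    then show ?thesis using assms[of k] by (auto simp: lookup_Var_times in_keys_iff)
  next
    case False
    have "unit_mon v + (k - unit_mon v) = k"
      by (rule poly_mapping_eqI) (use False in \<open>auto simp: lookup_add lookup_minus lookup_single when_def\<close>)
    then show ?thesis using False by (simp add: lookup_Var_times drop_var.rep_eq)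
  qed
qed

lemma keys_drop_var: "m \<in> Poly_Mapping.keys (drop_var v p) \<longleftrightarrow> unit_mon v + m \<in> Poly_Mapping.keys p"
  by (simp add: in_keys_iff drop_var.rep_eq)

subsection \<open>Homogeneous polynomials\<close>

lemma homog_0 [simp]: "homog d 0"
  unfolding homog_def by simp

lemma homog_add: "homog d p \<Longrightarrow> homog d q \<Longrightarrow> homog d (p + q)"
  unfolding homog_def using Poly_Mapping.keys_add[of p q] by blast

lemma homog_uminus: "homog d p \<Longrightarrow> homog d (- p)"
  unfolding homog_def by (simp add: in_keys_iff)

lemma homog_diff: "homog d p \<Longrightarrow> homog d q \<Longrightarrow> homog d (p - q)"
  using homog_add[of d p "- q"] homog_uminus[of d q] by simp

lemma homog_sum: "(\<And>i. i \<in> A \<Longrightarrow> homog d (f i)) \<Longrightarrow> homog d (sum f A)"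
  by (induction A rule: infinite_finite_induct) (auto intro: homog_add)

lemma homog_mult: "homog d p \<Longrightarrow> homog e q \<Longrightarrow> homog (d + e) (p * q)"
  unfolding homog_mdeg by (metis keys_mult_elim mdeg_add)

lemma homog_mult': "homog (d1, d2) p \<Longrightarrow> homog (e1, e2) q \<Longrightarrow> f1 = d1 + e1 \<Longrightarrow> f2 = d2 + e2
    \<Longrightarrow> homog (f1, f2) (p * q)"
  using homog_mult[of "(d1, d2)" p "(e1, e2)" q] by simp

lemma homog_Const: "homog (0, 0) (Const c)"
  unfolding homog_mdeg Const_def by (simp add: mdeg_0)

lemma homog_1: "homog (0, 0) 1"
  unfolding homog_mdeg by (simp add: mdeg_0)

lemma homog_Var: "homog (vdeg v) (Var v)"
  unfolding homog_mdeg Var_def by (simp add: mdeg_unit)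

lemma homog_Const_mult: "homog d p \<Longrightarrow> homog d (Const c * p)"
  using homog_mult[OF homog_Const, of d p c] by (cases d) simp

lift_definition hpart :: "int \<times> int \<Rightarrow> qpoly \<Rightarrow> qpoly"
  is "\<lambda>d p m. if mdeg m = d then p m else 0"
  by (rule finite_subset[rotated]) auto

lemma homog_hpart: "homog d (hpart d p)"
  unfolding homog_mdeg by (auto simp: in_keys_iff hpart.rep_eq split: if_splits)

lemma hpart_homog: "homog d p \<Longrightarrow> hpart d p = p"
  unfolding homog_mdeg by (intro poly_mapping_eqI) (auto simp: hpart.rep_eq in_keys_iff)

lemma hpart_add: "hpart d (p + q) = hpart d p + hpart d q"
  by (intro poly_mapping_eqI) (simp add: hpart.rep_eq lookup_add)

lemma hpart_0 [simp]: "hpart d 0 = 0"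
  by (intro poly_mapping_eqI) (simp add: hpart.rep_eq)

lemma hpart_sum: "hpart d (sum f A) = (\<Sum>i\<in>A. hpart d (f i))"
  by (induction A rule: infinite_finite_induct) (simp_all add: hpart_add)

lemma hpart_keys: "Poly_Mapping.keys (hpart d p) \<subseteq> Poly_Mapping.keys p"
  by (auto simp: in_keys_iff hpart.rep_eq split: if_splits)

lemma hpart_single: "hpart d (Poly_Mapping.single m c) = (if mdeg m = d then Poly_Mapping.single m c else 0)"
  by (intro poly_mapping_eqI) (auto simp: hpart.rep_eq lookup_single when_def)

lemma hpart_mult:
  assumes "homog e q"
  shows "hpart (e + d) (q * p) = q * hpart d p"
proof -
  let ?s = "\<lambda>p m. Poly_Mapping.single m (Poly_Mapping.lookup p m)"
  have eq: "q * p = (\<Sum>l\<in>Poly_Mapping.keys q. \<Sum>m\<in>Poly_Mapping.keys p. ?s q l * ?s p m)" for p :: qpoly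
    by (subst poly_mapping_sum_singles[of q], subst poly_mapping_sum_singles[of p])
      (simp add: sum_product)
  have "hpart (e + d) (?s q l * ?s p m) = ?s q l * hpart d (?s p m)"
    if "l \<in> Poly_Mapping.keys q" for l m
    using assms that unfolding homog_mdeg
    by (auto simp: mult_single hpart_single mdeg_add)
  then have "hpart (e + d) (q * p)
      = (\<Sum>l\<in>Poly_Mapping.keys q. \<Sum>m\<in>Poly_Mapping.keys p. ?s q l * hpart d (?s p m))"
    unfolding eq[of p] hpart_sum by (intro sum.cong) auto
  also have "\<dots> = (\<Sum>l\<in>Poly_Mapping.keys q. ?s q l) * hpart d (\<Sum>m\<in>Poly_Mapping.keys p. ?s p m)"
    by (simp add: sum_product hpart_sum)
  finally show ?thesis by (simp flip: poly_mapping_sum_singles)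
qed

subsection \<open>The subrings\<close>

lemma poly_ring_0 [simp]: "0 \<in> poly_ring L" unfolding poly_ring_def by simp
lemma poly_ring_1 [simp]: "1 \<in> poly_ring L" unfolding poly_ring_def by simp
lemma poly_ring_Const [simp]: "Const c \<in> poly_ring L" unfolding poly_ring_def Const_def by simp
lemma poly_ring_pA [simp]: "pA \<in> poly_ring L" unfolding poly_ring_def Var_def by simp
lemma poly_ring_pX [simp]: "k \<in> L \<Longrightarrow> pX k \<in> poly_ring L" unfolding poly_ring_def Var_def by simp
lemma poly_ring_add: "p \<in> poly_ring L \<Longrightarrow> q \<in> poly_ring L \<Longrightarrow> p + q \<in> poly_ring L"
  unfolding poly_ring_def using Poly_Mapping.keys_add[of p q] by blast
lemma poly_ring_uminus: "p \<in> poly_ring L \<Longrightarrow> - p \<in> poly_ring L"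
  unfolding poly_ring_def by (simp add: in_keys_iff)
lemma poly_ring_diff: "p \<in> poly_ring L \<Longrightarrow> q \<in> poly_ring L \<Longrightarrow> p - q \<in> poly_ring L"
  using poly_ring_add[of p L "- q"] poly_ring_uminus[of q L] by simp
lemma poly_ring_sum: "(\<And>i. i \<in> A \<Longrightarrow> f i \<in> poly_ring L) \<Longrightarrow> sum f A \<in> poly_ring L"
  by (induction A rule: infinite_finite_induct) (auto intro: poly_ring_add)
lemma poly_ring_mult:
  assumes "p \<in> poly_ring L" "q \<in> poly_ring L" shows "p * q \<in> poly_ring L"
proof -
  have "Poly_Mapping.keys k \<subseteq> insert VarA (VarX ` L)" if k: "k \<in> Poly_Mapping.keys (p * q)" for k
  proof -
    obtain l m where "k = l + m" "l \<in> Poly_Mapping.keys p" "m \<in> Poly_Mapping.keys q"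
      using k by (rule keys_mult_elim)
    then show ?thesis using assms Poly_Mapping.keys_add[of l m] unfolding poly_ring_def by blast
  qed
  then show ?thesis unfolding poly_ring_def by blast
qed
lemma poly_ring_power: "p \<in> poly_ring L \<Longrightarrow> p ^ n \<in> poly_ring L"
  by (induction n) (auto intro: poly_ring_mult)
lemma poly_ring_prod: "(\<And>i. i \<in> A \<Longrightarrow> f i \<in> poly_ring L) \<Longrightarrow> prod f A \<in> poly_ring L"
  by (induction A rule: infinite_finite_induct) (auto intro: poly_ring_mult)
lemma poly_ring_hpart: "p \<in> poly_ring L \<Longrightarrow> hpart d p \<in> poly_ring L"
  unfolding poly_ring_def using hpart_keys[of d p] by blast

lemma keys_le_add: "Poly_Mapping.keys m \<subseteq> Poly_Mapping.keys (m' + m :: var \<Rightarrow>\<^sub>0 nat)"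
  by (auto simp: in_keys_iff lookup_add)

lemma poly_ring_drop_var: "p \<in> poly_ring L \<Longrightarrow> drop_var v p \<in> poly_ring L"
  unfolding poly_ring_def using keys_le_add by (fastforce simp: keys_drop_var)

lemma homog_drop_var: "homog (vdeg v + d) p \<Longrightarrow> homog d (drop_var v p)"
  unfolding homog_mdeg
proof
  fix m assume h: "\<forall>m\<in>Poly_Mapping.keys p. mdeg m = vdeg v + d" and "m \<in> Poly_Mapping.keys (drop_var v p)"
  then have "unit_mon v + m \<in> Poly_Mapping.keys p" by (simp only: keys_drop_var)
  then have "mdeg (unit_mon v + m) = vdeg v + d" using h by blast
  then show "mdeg m = d" unfolding mdeg_add mdeg_unit by simp
qed

subsection \<open>Change of variables\<close>

definition relabel_mon :: "(var \<Rightarrow> var) \<Rightarrow> (var \<Rightarrow>\<^sub>0 nat) \<Rightarrow> qpoly"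
  where "relabel_mon f m = (\<Prod>v\<in>Poly_Mapping.keys m. Var (f v) ^ Poly_Mapping.lookup m v)"

lemma relabel_mon_superset:
  assumes "finite A" "Poly_Mapping.keys m \<subseteq> A"
  shows "relabel_mon f m = (\<Prod>v\<in>A. Var (f v) ^ Poly_Mapping.lookup m v)"
  unfolding relabel_mon_def
  by (rule prod.mono_neutral_left) (use assms in \<open>auto simp: in_keys_iff\<close>)

lemma relabel_mon_add: "relabel_mon f (m + m') = relabel_mon f m * relabel_mon f m'"
proof -
  let ?A = "Poly_Mapping.keys m \<union> Poly_Mapping.keys m'"
  have "relabel_mon f (m + m') = (\<Prod>v\<in>?A. Var (f v) ^ Poly_Mapping.lookup (m + m') v)"
    by (rule relabel_mon_superset) (use Poly_Mapping.keys_add[of m m'] in auto)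
  moreover have "relabel_mon f m = (\<Prod>v\<in>?A. Var (f v) ^ Poly_Mapping.lookup m v)"
    by (rule relabel_mon_superset) auto
  moreover have "relabel_mon f m' = (\<Prod>v\<in>?A. Var (f v) ^ Poly_Mapping.lookup m' v)"
    by (rule relabel_mon_superset) auto
  ultimately show ?thesis by (simp add: lookup_add power_add prod.distrib)
qed

lemma relabel_superset:
  assumes "finite A" "Poly_Mapping.keys p \<subseteq> A"
  shows "relabel f p = (\<Sum>m\<in>A. Const (Poly_Mapping.lookup p m) * relabel_mon f m)"
  unfolding relabel_def relabel_mon_def[symmetric]
  by (rule sum.mono_neutral_left) (use assms in \<open>auto simp: in_keys_iff Const_def\<close>)

lemma Const_add: "Const (a + b) = Const a + Const b"
  unfolding Const_def by (simp add: single_add)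
lemma Const_mult: "Const (a * b) = Const a * Const b"
  unfolding Const_def by (simp add: mult_single)
lemma Const_0 [simp]: "Const 0 = 0" unfolding Const_def by simp
lemma Const_1 [simp]: "Const 1 = 1" unfolding Const_def by simp

lemma relabel_single: "relabel f (Poly_Mapping.single m c) = Const c * relabel_mon f m"
  using relabel_superset[of "{m}" "Poly_Mapping.single m c" f] by (simp split: if_splits)

lemma relabel_0 [simp]: "relabel f 0 = 0"
  unfolding relabel_def by simp

lemma relabel_add: "relabel f (p + q) = relabel f p + relabel f q"
proof -
  let ?A = "Poly_Mapping.keys p \<union> Poly_Mapping.keys q"
  have "relabel f (p + q) = (\<Sum>m\<in>?A. Const (Poly_Mapping.lookup (p + q) m) * relabel_mon f m)"
    by (rule relabel_superset) (use Poly_Mapping.keys_add[of p q] in auto)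
  moreover have "relabel f p = (\<Sum>m\<in>?A. Const (Poly_Mapping.lookup p m) * relabel_mon f m)"
    by (rule relabel_superset) auto
  moreover have "relabel f q = (\<Sum>m\<in>?A. Const (Poly_Mapping.lookup q m) * relabel_mon f m)"
    by (rule relabel_superset) auto
  ultimately show ?thesis by (simp add: lookup_add Const_add distrib_right sum.distrib)
qed

lemma relabel_sum: "relabel f (sum g A) = (\<Sum>i\<in>A. relabel f (g i))"
  by (induction A rule: infinite_finite_induct) (simp_all add: relabel_add)

lemma relabel_mult: "relabel f (p * q) = relabel f p * relabel f q"
proof -
  let ?s = "\<lambda>p m. Poly_Mapping.single m (Poly_Mapping.lookup p m)"
  have "p * q = (\<Sum>l\<in>Poly_Mapping.keys p. ?s p l) * (\<Sum>m\<in>Poly_Mapping.keys q. ?s q m)"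
    by (simp flip: poly_mapping_sum_singles)
  then have "relabel f (p * q)
      = (\<Sum>l\<in>Poly_Mapping.keys p. \<Sum>m\<in>Poly_Mapping.keys q. relabel f (?s p l * ?s q m))"
    by (simp add: sum_product relabel_sum)
  also have "\<dots> = (\<Sum>l\<in>Poly_Mapping.keys p. \<Sum>m\<in>Poly_Mapping.keys q. relabel f (?s p l) * relabel f (?s q m))"
    by (simp add: mult_single relabel_single relabel_mon_add Const_mult mult_ac)
  also have "\<dots> = relabel f (\<Sum>l\<in>Poly_Mapping.keys p. ?s p l) * relabel f (\<Sum>m\<in>Poly_Mapping.keys q. ?s q m)"
    by (simp add: sum_product relabel_sum)
  finally show ?thesis by (simp flip: poly_mapping_sum_singles)
qed

lemma relabel_1 [simp]: "relabel f 1 = 1"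
  using relabel_single[of f 0 1] by (simp add: relabel_mon_def)

lemma relabel_uminus: "relabel f (- p) = - relabel f p"
  using relabel_add[of f p "- p"] by (simp add: add_eq_0_iff)

lemma relabel_diff: "relabel f (p - q) = relabel f p - relabel f q"
  using relabel_add[of f p "- q"] relabel_uminus[of f q] by simp

lemma relabel_Var: "relabel f (Var v) = Var (f v)"
  unfolding Var_def[of v] relabel_single by (simp add: relabel_mon_def)

lemma homog_power:
  assumes "homog d p" shows "homog (int n * fst d, int n * snd d) (p ^ n)"
proof (induction n)
  case 0
  show ?case using homog_1 by simp
next
  case (Suc n)
  show ?case using homog_mult[OF assms Suc] by (simp add: plus_prod_def algebra_simps)
qed

lemma homog_prod:
  assumes "\<And>i. i \<in> A \<Longrightarrow> homog (g i, h i) (f i)"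
  shows "homog (\<Sum>i\<in>A. g i, \<Sum>i\<in>A. h i) (prod f A)"
  using assms
proof (induction A rule: infinite_finite_induct)
  case (insert x A)
  then show ?case using homog_mult[of "(g x, h x)" "f x" "(sum g A, sum h A)"] by simp
qed (use homog_1 in auto)

lemma homog_relabel_mon:
  assumes "\<And>v. vdeg (f v) = vdeg v"
  shows "homog (mdeg m) (relabel_mon f m)"
proof -
  let ?n = "\<lambda>v. int (Poly_Mapping.lookup m v)"
  have h: "homog (\<Sum>v\<in>Poly_Mapping.keys m. ?n v * fst (vdeg v), \<Sum>v\<in>Poly_Mapping.keys m. ?n v * snd (vdeg v))
      (relabel_mon f m)"
    unfolding relabel_mon_def
    by (rule homog_prod) (metis assms homog_Var homog_power)
  have "(\<Sum>v\<in>Poly_Mapping.keys m. ?n v * fst (vdeg v)) = (\<Sum>v\<in>Poly_Mapping.keys m. if v = VarA then 2 * ?n v else 0)"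
    by (rule sum.cong) (auto simp: vdeg_def)
  then have "(\<Sum>v\<in>Poly_Mapping.keys m. ?n v * fst (vdeg v)) = deg_a m"
    unfolding deg_a_def by (simp add: in_keys_iff)
  moreover have "(\<Sum>v\<in>Poly_Mapping.keys m. ?n v * snd (vdeg v)) = deg_x m"
  proof -
    have "(\<Sum>v\<in>Poly_Mapping.keys m. ?n v * snd (vdeg v)) = (\<Sum>v\<in>Poly_Mapping.keys m - {VarA}. 2 * ?n v)"
      by (rule sum.mono_neutral_cong_right) (auto simp: vdeg_def)
    then show ?thesis unfolding deg_x_def by (simp add: sum_distrib_left)
  qed
  ultimately show ?thesis using h unfolding mdeg_def by simp
qed

lemma homog_relabel:
  assumes "\<And>v. vdeg (f v) = vdeg v" "homog d p"
  shows "homog d (relabel f p)"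
  unfolding relabel_superset[OF finite_keys order_refl]
  by (rule homog_sum) (metis assms homog_Const_mult homog_mdeg homog_relabel_mon)

lemma poly_ring_relabel:
  assumes "p \<in> poly_ring L" "f VarA = VarA" "\<And>k. k \<in> L \<Longrightarrow> f (VarX k) \<in> VarX ` L'"
  shows "relabel f p \<in> poly_ring L'"
  unfolding relabel_superset[OF finite_keys order_refl] relabel_mon_def
proof (intro poly_ring_sum poly_ring_mult poly_ring_prod poly_ring_power poly_ring_Const)
  fix m v assume "m \<in> Poly_Mapping.keys p" "v \<in> Poly_Mapping.keys m"
  then have "v \<in> insert VarA (VarX ` L)" using assms(1) unfolding poly_ring_def by blast
  then show "Var (f v) \<in> poly_ring L'" using assms(2,3) poly_ring_pX by fastforce
qed

lemma vdeg_place: "vdeg (place ls v) = vdeg v"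
  unfolding place_def vdeg_def by (auto split: var.split)

lemma poly_ring_place:
  assumes "p \<in> poly_ring {..<length ls}"
  shows "relabel (place ls) p \<in> poly_ring (set ls)"
  by (rule poly_ring_relabel[OF assms]) (auto simp: place_def)

section \<open>Matrix factorizations with two differentials\<close>

subsection \<open>Matrices over the polynomial ring\<close>

type_synonym mat = "gen \<Rightarrow> gen \<Rightarrow> qpoly"

definition mprod :: "gen set \<Rightarrow> mat \<Rightarrow> mat \<Rightarrow> mat"
  where "mprod A f g = (\<lambda>c b. \<Sum>e\<in>A. f c e * g e b)"

definition diag :: "(gen \<Rightarrow> qpoly) \<Rightarrow> mat"
  where "diag s = (\<lambda>c b. if c = b then s b else 0)"

text \<open>The Kronecker product. Both differentials of a tensor product are sums of two Kronecker
  products, one factor of which is a diagonal matrix of signs, so the identities for tensor products reduce to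
  the mixed product rule \<open>mprod_kron\<close> and to moving signs past matrices of known parity.\<close>

definition kron :: "mat \<Rightarrow> mat \<Rightarrow> mat"
  where "kron f g = (\<lambda>x y. case (x, y) of (Tens c c', Tens b b') \<Rightarrow> f c b * g c' b' | _ \<Rightarrow> 0)"

lemma kron_Tens [simp]: "kron f g (Tens c c') (Tens b b') = f c b * g c' b'"
  unfolding kron_def by simp

lemma mprod_add_left: "mprod A (f + g) h = mprod A f h + mprod A g h"
  unfolding mprod_def by (intro ext) (simp add: distrib_right sum.distrib)
lemma mprod_add_right: "mprod A h (f + g) = mprod A h f + mprod A h g"
  unfolding mprod_def by (intro ext) (simp add: distrib_left sum.distrib)
lemma mprod_0_left [simp]: "mprod A 0 f = 0"
  unfolding mprod_def by (intro ext) simp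
lemma mprod_0_right [simp]: "mprod A f 0 = 0"
  unfolding mprod_def by (intro ext) simp
lemma kron_0_left [simp]: "kron 0 f = 0"
  unfolding kron_def by (intro ext) (simp split: gen.split)

lemma mprod_diag_left: "finite A \<Longrightarrow> c \<in> A \<Longrightarrow> mprod A (diag s) f c b = s c * f c b"
  unfolding mprod_def diag_def by (simp add: if_distrib[of "\<lambda>x. x * _"] cong: if_cong)
lemma mprod_diag_right: "finite A \<Longrightarrow> b \<in> A \<Longrightarrow> mprod A f (diag s) c b = f c b * s b"
  unfolding mprod_def diag_def by (simp add: if_distrib[of "\<lambda>x. _ * x"] cong: if_cong)

definition zsign :: "cmf \<Rightarrow> gen \<Rightarrow> qpoly"
  where "zsign M b = (if zodd M b then - 1 else 1)"
definition hsign :: "cmf \<Rightarrow> gen \<Rightarrow> qpoly"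
  where "hsign M b = (if odd (hdeg M b) then - 1 else 1)"

lemma sign_squares [simp]: "zsign M b * zsign M b = 1" "hsign M b * hsign M b = 1"
  unfolding zsign_def hsign_def by auto

lemma gens_tensor: "gens (tensor M N) = (\<lambda>(b, b'). Tens b b') ` (gens M \<times> gens N)"
  unfolding tensor_def by auto

lemma sum_gens_tensor: "(\<Sum>e\<in>gens (tensor M N). F e) = (\<Sum>b\<in>gens M. \<Sum>b'\<in>gens N. F (Tens b b'))"
  unfolding gens_tensor
  by (subst sum.reindex) (auto simp: inj_on_def sum.cartesian_product case_prod_unfold)

lemma mprod_kron [simp]: "mprod (gens (tensor M N)) (kron f g) (kron f' g') (Tens c c') (Tens b b')
    = mprod (gens M) f f' c b * mprod (gens N) g g' c' b'"
  unfolding mprod_def sum_gens_tensor by (simp add: sum_product mult_ac)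

lemma dmf_tensor: "dmf (tensor M N) = kron (dmf M) (diag (\<lambda>_. 1)) + kron (diag (zsign M)) (dmf N)"
  unfolding tensor_def kron_def diag_def zsign_def by (intro ext) (auto split: gen.split)

lemma dchi_tensor: "dchi (tensor M N) = kron (dchi M) (diag (\<lambda>_. 1)) + kron (diag (hsign M)) (dchi N)"
  unfolding tensor_def kron_def diag_def hsign_def by (intro ext) (auto split: gen.split)

lemma tensor_degrees [simp]:
  "zodd (tensor M N) (Tens b b') = (zodd M b \<noteq> zodd N b')"
  "adeg (tensor M N) (Tens b b') = adeg M b + adeg N b'"
  "xdeg (tensor M N) (Tens b b') = xdeg M b + xdeg N b'"
  "hdeg (tensor M N) (Tens b b') = hdeg M b + hdeg N b'"
  unfolding tensor_def by simp_all

subsection \<open>Complexes of matrix factorizations\<close>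

text \<open>A matrix factorization of \<open>w\<close> with a second differential that commutes with the first. The
  differential \<open>d\<^sub>m\<^sub>f\<close> has bidegree \<open>(1, 1)\<close> and \<open>d\<^sub>\<chi>\<close> has bidegree \<open>(0, 0)\<close> but raises the homological degree.\<close>

definition mf_complex :: "nat set \<Rightarrow> qpoly \<Rightarrow> cmf \<Rightarrow> bool" where
  "mf_complex L w M \<longleftrightarrow> finite (gens M) \<and>
    (\<forall>b\<in>gens M. \<forall>c\<in>gens M.
      dmf M c b \<in> poly_ring L \<and> dchi M c b \<in> poly_ring L \<and>
      homog (adeg M b + 1 - adeg M c, xdeg M b + 1 - xdeg M c) (dmf M c b) \<and>
      homog (adeg M b - adeg M c, xdeg M b - xdeg M c) (dchi M c b) \<and>
      (dmf M c b \<noteq> 0 \<longrightarrow> hdeg M c = hdeg M b \<and> zodd M c \<noteq> zodd M b) \<and>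
      (dchi M c b \<noteq> 0 \<longrightarrow> hdeg M c = hdeg M b + 1 \<and> zodd M c = zodd M b) \<and>
      mprod (gens M) (dmf M) (dmf M) c b = diag (\<lambda>_. w) c b \<and>
      mprod (gens M) (dchi M) (dchi M) c b = 0 \<and>
      mprod (gens M) (dmf M) (dchi M) c b = mprod (gens M) (dchi M) (dmf M) c b)"

lemma mf_complexD:
  assumes "mf_complex L w M"
  shows "finite (gens M)"
    and "b \<in> gens M \<Longrightarrow> c \<in> gens M \<Longrightarrow> dmf M c b \<in> poly_ring L"
    and "b \<in> gens M \<Longrightarrow> c \<in> gens M \<Longrightarrow> dchi M c b \<in> poly_ring L"
    and "b \<in> gens M \<Longrightarrow> c \<in> gens M \<Longrightarrow> homog (adeg M b + 1 - adeg M c, xdeg M b + 1 - xdeg M c) (dmf M c b)"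
    and "b \<in> gens M \<Longrightarrow> c \<in> gens M \<Longrightarrow> homog (adeg M b - adeg M c, xdeg M b - xdeg M c) (dchi M c b)"
    and "b \<in> gens M \<Longrightarrow> c \<in> gens M \<Longrightarrow> dmf M c b \<noteq> 0 \<Longrightarrow> hdeg M c = hdeg M b"
    and "b \<in> gens M \<Longrightarrow> c \<in> gens M \<Longrightarrow> dmf M c b \<noteq> 0 \<Longrightarrow> zodd M c \<noteq> zodd M b"
    and "b \<in> gens M \<Longrightarrow> c \<in> gens M \<Longrightarrow> dchi M c b \<noteq> 0 \<Longrightarrow> hdeg M c = hdeg M b + 1"
    and "b \<in> gens M \<Longrightarrow> c \<in> gens M \<Longrightarrow> dchi M c b \<noteq> 0 \<Longrightarrow> zodd M c = zodd M b"
    and "b \<in> gens M \<Longrightarrow> c \<in> gens M \<Longrightarrow> mprod (gens M) (dmf M) (dmf M) c b = diag (\<lambda>_. w) c b"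
    and "b \<in> gens M \<Longrightarrow> c \<in> gens M \<Longrightarrow> mprod (gens M) (dchi M) (dchi M) c b = 0"
    and "b \<in> gens M \<Longrightarrow> c \<in> gens M \<Longrightarrow>
      mprod (gens M) (dmf M) (dchi M) c b = mprod (gens M) (dchi M) (dmf M) c b"
proof -
  show "finite (gens M)" using assms unfolding mf_complex_def by (rule conjunct1)
  note D = assms[unfolded mf_complex_def, THEN conjunct2, THEN bspec, THEN bspec, of b c]
  assume bc: "b \<in> gens M" "c \<in> gens M"
  note D = D[OF bc]
  show "dmf M c b \<in> poly_ring L" "dchi M c b \<in> poly_ring L"
    "homog (adeg M b + 1 - adeg M c, xdeg M b + 1 - xdeg M c) (dmf M c b)"
    "homog (adeg M b - adeg M c, xdeg M b - xdeg M c) (dchi M c b)"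
    "dmf M c b \<noteq> 0 \<Longrightarrow> hdeg M c = hdeg M b"
    "dmf M c b \<noteq> 0 \<Longrightarrow> zodd M c \<noteq> zodd M b"
    "dchi M c b \<noteq> 0 \<Longrightarrow> hdeg M c = hdeg M b + 1"
    "dchi M c b \<noteq> 0 \<Longrightarrow> zodd M c = zodd M b"
    "mprod (gens M) (dmf M) (dmf M) c b = diag (\<lambda>_. w) c b"
    "mprod (gens M) (dchi M) (dchi M) c b = 0"
    "mprod (gens M) (dmf M) (dchi M) c b = mprod (gens M) (dchi M) (dmf M) c b"
    using D by blast+
qed

lemma mf_complexI:
  assumes "finite (gens M)"
    and "\<And>b c. b \<in> gens M \<Longrightarrow> c \<in> gens M \<Longrightarrow> dmf M c b \<in> poly_ring L"
    and "\<And>b c. b \<in> gens M \<Longrightarrow> c \<in> gens M \<Longrightarrow> dchi M c b \<in> poly_ring L"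
    and "\<And>b c. b \<in> gens M \<Longrightarrow> c \<in> gens M \<Longrightarrow> homog (adeg M b + 1 - adeg M c, xdeg M b + 1 - xdeg M c) (dmf M c b)"
    and "\<And>b c. b \<in> gens M \<Longrightarrow> c \<in> gens M \<Longrightarrow> homog (adeg M b - adeg M c, xdeg M b - xdeg M c) (dchi M c b)"
    and "\<And>b c. b \<in> gens M \<Longrightarrow> c \<in> gens M \<Longrightarrow> dmf M c b \<noteq> 0 \<Longrightarrow> hdeg M c = hdeg M b"
    and "\<And>b c. b \<in> gens M \<Longrightarrow> c \<in> gens M \<Longrightarrow> dmf M c b \<noteq> 0 \<Longrightarrow> zodd M c \<noteq> zodd M b"
    and "\<And>b c. b \<in> gens M \<Longrightarrow> c \<in> gens M \<Longrightarrow> dchi M c b \<noteq> 0 \<Longrightarrow> hdeg M c = hdeg M b + 1"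
    and "\<And>b c. b \<in> gens M \<Longrightarrow> c \<in> gens M \<Longrightarrow> dchi M c b \<noteq> 0 \<Longrightarrow> zodd M c = zodd M b"
    and "\<And>b c. b \<in> gens M \<Longrightarrow> c \<in> gens M \<Longrightarrow> mprod (gens M) (dmf M) (dmf M) c b = diag (\<lambda>_. w) c b"
    and "\<And>b c. b \<in> gens M \<Longrightarrow> c \<in> gens M \<Longrightarrow> mprod (gens M) (dchi M) (dchi M) c b = 0"
    and "\<And>b c. b \<in> gens M \<Longrightarrow> c \<in> gens M \<Longrightarrow>
      mprod (gens M) (dmf M) (dchi M) c b = mprod (gens M) (dchi M) (dmf M) c b"
  shows "mf_complex L w M"
  unfolding mf_complex_def using assms by (intro conjI ballI impI)

text \<open>For a cycle \<open>z\<close> of \<open>d\<^sub>m\<^sub>f\<close> whose class is a cycle of \<open>d\<^sub>\<chi>\<close>, the last equation exhibits \<open>p z\<close> as a boundary. With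
  \<open>k = 0\<close> it is an ordinary null-homotopy for \<open>d\<^sub>m\<^sub>f\<close>; the homotopies between composites of the \<open>\<chi>\<close>-maps and
  multiplication by \<open>x\<^sub>j - x\<^sub>s\<close> require the general form.\<close>

definition homotopy :: "nat set \<Rightarrow> cmf \<Rightarrow> qpoly \<Rightarrow> mat \<Rightarrow> mat \<Rightarrow> bool" where
  "homotopy L M p h k \<longleftrightarrow> (\<forall>b\<in>gens M. \<forall>c\<in>gens M.
      h c b \<in> poly_ring L \<and> k c b \<in> poly_ring L \<and>
      (h c b \<noteq> 0 \<longrightarrow> zodd M c \<noteq> zodd M b) \<and>
      (k c b \<noteq> 0 \<longrightarrow> zodd M c = zodd M b \<and> odd (hdeg M c) \<noteq> odd (hdeg M b)) \<and>
      mprod (gens M) (dmf M) k c b = mprod (gens M) k (dmf M) c b \<and>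
      mprod (gens M) (dchi M) k c b + mprod (gens M) k (dchi M) c b
        = diag (\<lambda>_. p) c b + mprod (gens M) (dmf M) h c b + mprod (gens M) h (dmf M) c b)"

lemma homotopyD:
  assumes "homotopy L M p h k" "b \<in> gens M" "c \<in> gens M"
  shows "h c b \<in> poly_ring L" and "k c b \<in> poly_ring L"
    and "h c b \<noteq> 0 \<Longrightarrow> zodd M c \<noteq> zodd M b"
    and "k c b \<noteq> 0 \<Longrightarrow> zodd M c = zodd M b"
    and "k c b \<noteq> 0 \<Longrightarrow> odd (hdeg M c) \<noteq> odd (hdeg M b)"
    and "mprod (gens M) (dmf M) k c b = mprod (gens M) k (dmf M) c b"
    and "mprod (gens M) (dchi M) k c b + mprod (gens M) k (dchi M) c b
        = diag (\<lambda>_. p) c b + mprod (gens M) (dmf M) h c b + mprod (gens M) h (dmf M) c b"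
  using assms(1)[unfolded homotopy_def, THEN bspec, THEN bspec, OF assms(2,3)] by blast+

lemma homotopyI:
  assumes "\<And>b c. b \<in> gens M \<Longrightarrow> c \<in> gens M \<Longrightarrow> h c b \<in> poly_ring L"
    and "\<And>b c. b \<in> gens M \<Longrightarrow> c \<in> gens M \<Longrightarrow> k c b \<in> poly_ring L"
    and "\<And>b c. b \<in> gens M \<Longrightarrow> c \<in> gens M \<Longrightarrow> h c b \<noteq> 0 \<Longrightarrow> zodd M c \<noteq> zodd M b"
    and "\<And>b c. b \<in> gens M \<Longrightarrow> c \<in> gens M \<Longrightarrow> k c b \<noteq> 0 \<Longrightarrow> zodd M c = zodd M b"
    and "\<And>b c. b \<in> gens M \<Longrightarrow> c \<in> gens M \<Longrightarrow> k c b \<noteq> 0 \<Longrightarrow> odd (hdeg M c) \<noteq> odd (hdeg M b)"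
    and "\<And>b c. b \<in> gens M \<Longrightarrow> c \<in> gens M \<Longrightarrow> mprod (gens M) (dmf M) k c b = mprod (gens M) k (dmf M) c b"
    and "\<And>b c. b \<in> gens M \<Longrightarrow> c \<in> gens M \<Longrightarrow>
      mprod (gens M) (dchi M) k c b + mprod (gens M) k (dchi M) c b
        = diag (\<lambda>_. p) c b + mprod (gens M) (dmf M) h c b + mprod (gens M) h (dmf M) c b"
  shows "homotopy L M p h k"
  unfolding homotopy_def using assms by (intro conjI ballI impI)

lemma zsign_anti: "(x \<noteq> 0 \<Longrightarrow> zodd M c \<noteq> zodd M b) \<Longrightarrow> x * zsign M b = - (zsign M c * x)"
  unfolding zsign_def by (cases "x = 0") auto
lemma zsign_comm: "(x \<noteq> 0 \<Longrightarrow> zodd M c = zodd M b) \<Longrightarrow> x * zsign M b = zsign M c * x"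
  unfolding zsign_def by (cases "x = 0") auto
lemma hsign_anti: "(x \<noteq> 0 \<Longrightarrow> odd (hdeg M c) \<noteq> odd (hdeg M b)) \<Longrightarrow> x * hsign M b = - (hsign M c * x)"
  unfolding hsign_def by (cases "x = 0") auto
lemma hsign_comm: "(x \<noteq> 0 \<Longrightarrow> hdeg M c = hdeg M b) \<Longrightarrow> x * hsign M b = hsign M c * x"
  unfolding hsign_def by (cases "x = 0") auto

lemmas tensor_expand = dmf_tensor dchi_tensor mprod_add_left mprod_add_right plus_fun_apply
  mprod_kron mprod_diag_left mprod_diag_right

lemma mf_complex_signs:
  assumes "mf_complex L w M" "b \<in> gens M" "c \<in> gens M"
  shows "dmf M c b * zsign M b = - (zsign M c * dmf M c b)"
    and "dmf M c b * hsign M b = hsign M c * dmf M c b"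
    and "dchi M c b * zsign M b = zsign M c * dchi M c b"
    and "dchi M c b * hsign M b = - (hsign M c * dchi M c b)"
  using mf_complexD(6-9)[OF assms]
  by (auto intro!: zsign_anti zsign_comm hsign_anti hsign_comm)

theorem mf_complex_tensor:
  assumes M: "mf_complex L w M" and N: "mf_complex L w' N"
  shows "mf_complex L (w + w') (tensor M N)"
proof -
  let ?T = "tensor M N"
  note finM = mf_complexD(1)[OF M] and finN = mf_complexD(1)[OF N]
  note sM = mf_complex_signs[OF M] and sN = mf_complex_signs[OF N]
  note DM = mf_complexD(2-)[OF M] and DN = mf_complexD(2-)[OF N]
  show ?thesis
  proof (rule mf_complexI)
    show "finite (gens ?T)" unfolding gens_tensor using finM finN by simp
  next
    fix y x assume "y \<in> gens ?T" "x \<in> gens ?T"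
    then obtain b b' c c' where y: "y = Tens b b'" "b \<in> gens M" "b' \<in> gens N"
      and x: "x = Tens c c'" "c \<in> gens M" "c' \<in> gens N" unfolding gens_tensor by auto
    show "dmf ?T x y \<in> poly_ring L"
      unfolding x(1) y(1) using DM(1)[OF y(2) x(2)] DN(1)[OF y(3) x(3)]
      by (auto simp: dmf_tensor diag_def zsign_def poly_ring_add poly_ring_uminus)
    show "dchi ?T x y \<in> poly_ring L"
      unfolding x(1) y(1) using DM(2)[OF y(2) x(2)] DN(2)[OF y(3) x(3)]
      by (auto simp: dchi_tensor diag_def hsign_def poly_ring_add poly_ring_uminus)
    have h1: "c' = b' \<Longrightarrow> homog (adeg M b + adeg N b' + 1 - (adeg M c + adeg N c'),
        xdeg M b + xdeg N b' + 1 - (xdeg M c + xdeg N c')) (dmf M c b)"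
      using DM(3)[OF y(2) x(2)] by (simp add: algebra_simps)
    have h2: "c = b \<Longrightarrow> homog (adeg M b + adeg N b' + 1 - (adeg M c + adeg N c'),
        xdeg M b + xdeg N b' + 1 - (xdeg M c + xdeg N c')) (dmf N c' b')"
      using DN(3)[OF y(3) x(3)] by (simp add: algebra_simps)
    show "homog (adeg ?T y + 1 - adeg ?T x,
        xdeg ?T y + 1 - xdeg ?T x) (dmf ?T x y)"
      unfolding x(1) y(1) tensor_degrees dmf_tensor plus_fun_apply kron_Tens
      by (rule homog_add) (use h1 h2 in \<open>auto simp: diag_def zsign_def intro: homog_uminus\<close>)
    have h3: "c' = b' \<Longrightarrow> homog (adeg M b + adeg N b' - (adeg M c + adeg N c'),
        xdeg M b + xdeg N b' - (xdeg M c + xdeg N c')) (dchi M c b)"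
      using DM(4)[OF y(2) x(2)] by (simp add: algebra_simps)
    have h4: "c = b \<Longrightarrow> homog (adeg M b + adeg N b' - (adeg M c + adeg N c'),
        xdeg M b + xdeg N b' - (xdeg M c + xdeg N c')) (dchi N c' b')"
      using DN(4)[OF y(3) x(3)] by (simp add: algebra_simps)
    show "homog (adeg ?T y - adeg ?T x,
        xdeg ?T y - xdeg ?T x) (dchi ?T x y)"
      unfolding x(1) y(1) tensor_degrees dchi_tensor plus_fun_apply kron_Tens
      by (rule homog_add) (use h3 h4 in \<open>auto simp: diag_def hsign_def intro: homog_uminus\<close>)
    have nz: "dmf ?T x y \<noteq> 0 \<Longrightarrow>
        c' = b' \<and> dmf M c b \<noteq> 0 \<or> c = b \<and> dmf N c' b' \<noteq> 0"
      "dchi ?T x y \<noteq> 0 \<Longrightarrow>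
        c' = b' \<and> dchi M c b \<noteq> 0 \<or> c = b \<and> dchi N c' b' \<noteq> 0"
      unfolding x(1) y(1) dmf_tensor dchi_tensor plus_fun_apply kron_Tens diag_def
      by (auto split: if_splits)
    show "hdeg ?T x = hdeg ?T y" if "dmf ?T x y \<noteq> 0"
      using nz(1)[OF that] DM(5)[OF y(2) x(2)] DN(5)[OF y(3) x(3)]
      unfolding x(1) y(1) tensor_degrees by (elim disjE conjE) simp_all
    show "zodd ?T x \<noteq> zodd ?T y" if "dmf ?T x y \<noteq> 0"
      using nz(1)[OF that] DM(6)[OF y(2) x(2)] DN(6)[OF y(3) x(3)]
      unfolding x(1) y(1) tensor_degrees by blast
    show "hdeg ?T x = hdeg ?T y + 1" if "dchi ?T x y \<noteq> 0"
      using nz(2)[OF that] DM(7)[OF y(2) x(2)] DN(7)[OF y(3) x(3)]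
      unfolding x(1) y(1) tensor_degrees by (elim disjE conjE) simp_all
    show "zodd ?T x = zodd ?T y" if "dchi ?T x y \<noteq> 0"
      using nz(2)[OF that] DM(8)[OF y(2) x(2)] DN(8)[OF y(3) x(3)]
      unfolding x(1) y(1) tensor_degrees by blast
    have mm: "mprod (gens M) (dmf M) (dmf M) c b = diag (\<lambda>_. w) c b"
      "mprod (gens N) (dmf N) (dmf N) c' b' = diag (\<lambda>_. w') c' b'"
      "mprod (gens M) (dchi M) (dchi M) c b = 0" "mprod (gens N) (dchi N) (dchi N) c' b' = 0"
      "mprod (gens M) (dmf M) (dchi M) c b = mprod (gens M) (dchi M) (dmf M) c b"
      "mprod (gens N) (dmf N) (dchi N) c' b' = mprod (gens N) (dchi N) (dmf N) c' b'"
      by (rule DM(9)[OF y(2) x(2)] DN(9)[OF y(3) x(3)] DM(10)[OF y(2) x(2)] DN(10)[OF y(3) x(3)]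
          DM(11)[OF y(2) x(2)] DN(11)[OF y(3) x(3)])+
    have dd: "diag (zsign M) c b * zsign M b = diag (\<lambda>_. 1) c b"
      "zsign M c * diag (zsign M) c b = diag (\<lambda>_. 1) c b"
      "hsign M c * diag (hsign M) c b = diag (\<lambda>_. 1) c b"
      "diag (zsign M) c b * zsign M b = diag (\<lambda>_. 1) c b"
      "diag (hsign M) c b * hsign M b = diag (\<lambda>_. 1) c b"
      "zsign M c * diag (hsign M) c b = hsign M c * diag (zsign M) c b"
      "diag (zsign M) c b * hsign M b = hsign M c * diag (zsign M) c b"
      "diag (hsign M) c b * zsign M b = hsign M c * diag (zsign M) c b"
      unfolding diag_def by auto
    note S = sM[OF y(2) x(2)]
    show "mprod (gens ?T) (dmf ?T) (dmf ?T) x y = diag (\<lambda>_. w + w') x y"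
      unfolding x(1) y(1)
      by (simp add: tensor_expand finM finN x y mm S dd) (auto simp: diag_def algebra_simps)
    show "mprod (gens ?T) (dchi ?T) (dchi ?T) x y = 0"
      unfolding x(1) y(1)
      by (simp add: tensor_expand finM finN x y mm S dd)
    show "mprod (gens ?T) (dmf ?T) (dchi ?T) x y
        = mprod (gens ?T) (dchi ?T) (dmf ?T) x y"
      unfolding x(1) y(1)
      by (simp add: tensor_expand finM finN x y mm S dd; simp add: algebra_simps)
  qed
qed

text \<open>The maps \<open>h \<otimes> 1\<close> and \<open>k \<otimes> 1\<close> work because \<open>h\<close> is odd for the
  \<open>\<int>\<^sub>2\<close>-grading, so that it anticommutes with the sign in front of \<open>d\<^sub>m\<^sub>f\<close> of the right factor, and \<open>k\<close> has odd
  homological degree, so that it anticommutes with the sign in front of \<open>d\<^sub>\<chi>\<close>.\<close>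

theorem homotopy_tensor_left:
  assumes M: "mf_complex L w M" and N: "mf_complex L w' N" and H: "homotopy L M p h k"
  shows "homotopy L (tensor M N) p (kron h (diag (\<lambda>_. 1))) (kron k (diag (\<lambda>_. 1)))"
proof -
  let ?T = "tensor M N"
  note finM = mf_complexD(1)[OF M] and finN = mf_complexD(1)[OF N]
  show ?thesis
  proof (rule homotopyI)
    fix y x assume "y \<in> gens ?T" "x \<in> gens ?T"
    then obtain b b' c c' where y: "y = Tens b b'" "b \<in> gens M" "b' \<in> gens N"
      and x: "x = Tens c c'" "c \<in> gens M" "c' \<in> gens N" unfolding gens_tensor by auto
    note D = homotopyD[OF H y(2) x(2)]
    show "kron h (diag (\<lambda>_. 1)) x y \<in> poly_ring L" "kron k (diag (\<lambda>_. 1)) x y \<in> poly_ring L"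
      using D(1,2) by (auto simp: x y diag_def)
    show "kron h (diag (\<lambda>_. 1)) x y \<noteq> 0 \<Longrightarrow> zodd ?T x \<noteq> zodd ?T y"
      "kron k (diag (\<lambda>_. 1)) x y \<noteq> 0 \<Longrightarrow> zodd ?T x = zodd ?T y"
      "kron k (diag (\<lambda>_. 1)) x y \<noteq> 0 \<Longrightarrow> odd (hdeg ?T x) \<noteq> odd (hdeg ?T y)"
      using D(3-5) by (auto simp: x y diag_def split: if_splits)
    have S: "h c b * zsign M b = - (zsign M c * h c b)" "k c b * zsign M b = zsign M c * k c b"
      "k c b * hsign M b = - (hsign M c * k c b)"
      using D(3-5) by (auto intro!: zsign_anti zsign_comm hsign_anti)
    show "mprod (gens ?T) (dmf ?T) (kron k (diag (\<lambda>_. 1))) x y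
        = mprod (gens ?T) (kron k (diag (\<lambda>_. 1))) (dmf ?T) x y"
      unfolding x(1) y(1) by (simp add: tensor_expand finM finN x y D(6) S)
    have "(mprod (gens M) (dchi M) k c b + mprod (gens M) k (dchi M) c b) * diag (\<lambda>_. 1) c' b'
        = (diag (\<lambda>_. p) c b + mprod (gens M) (dmf M) h c b + mprod (gens M) h (dmf M) c b)
          * diag (\<lambda>_. 1) c' b'" by (simp only: D(7))
    moreover have "diag (\<lambda>_. p) c b * diag (\<lambda>_. 1) c' b' = diag (\<lambda>_. p) x y"
      unfolding x(1) y(1) diag_def by simp
    ultimately show "mprod (gens ?T) (dchi ?T) (kron k (diag (\<lambda>_. 1))) x y
        + mprod (gens ?T) (kron k (diag (\<lambda>_. 1))) (dchi ?T) x y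
        = diag (\<lambda>_. p) x y
        + mprod (gens ?T) (dmf ?T) (kron h (diag (\<lambda>_. 1))) x y
        + mprod (gens ?T) (kron h (diag (\<lambda>_. 1))) (dmf ?T) x y"
      unfolding x(1) y(1) by (simp add: tensor_expand finM finN x y S) (simp add: algebra_simps)
  qed
qed

theorem homotopy_tensor_right:
  assumes M: "mf_complex L w M" and N: "mf_complex L w' N" and H: "homotopy L N p h k"
  shows "homotopy L (tensor M N) p (kron (diag (zsign M)) h) (kron (diag (hsign M)) k)"
proof -
  let ?T = "tensor M N"
  note finM = mf_complexD(1)[OF M] and finN = mf_complexD(1)[OF N]
  show ?thesis
  proof (rule homotopyI)
    fix y x assume "y \<in> gens ?T" "x \<in> gens ?T"
    then obtain b b' c c' where y: "y = Tens b b'" "b \<in> gens M" "b' \<in> gens N"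
      and x: "x = Tens c c'" "c \<in> gens M" "c' \<in> gens N" unfolding gens_tensor by auto
    note D = homotopyD[OF H y(3) x(3)]
    note S = mf_complex_signs[OF M y(2) x(2)]
    show "kron (diag (zsign M)) h x y \<in> poly_ring L" "kron (diag (hsign M)) k x y \<in> poly_ring L"
      using D(1,2) by (auto simp: x y diag_def zsign_def hsign_def poly_ring_uminus)
    have nz: "kron (diag (zsign M)) h x y \<noteq> 0 \<Longrightarrow> c = b \<and> h c' b' \<noteq> 0"
      "kron (diag (hsign M)) k x y \<noteq> 0 \<Longrightarrow> c = b \<and> k c' b' \<noteq> 0"
      unfolding x(1) y(1) kron_Tens diag_def by (auto split: if_splits)
    show "zodd ?T x \<noteq> zodd ?T y" if "kron (diag (zsign M)) h x y \<noteq> 0"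
      using nz(1)[OF that] D(3) unfolding x(1) y(1) tensor_degrees by blast
    show "zodd ?T x = zodd ?T y" if "kron (diag (hsign M)) k x y \<noteq> 0"
      using nz(2)[OF that] D(4) unfolding x(1) y(1) tensor_degrees by blast
    show "odd (hdeg ?T x) \<noteq> odd (hdeg ?T y)" if "kron (diag (hsign M)) k x y \<noteq> 0"
      using nz(2)[OF that] D(5) unfolding x(1) y(1) tensor_degrees even_add by blast
    have dd: "zsign M c * diag (zsign M) c b = diag (\<lambda>_. 1) c b"
      "hsign M c * diag (hsign M) c b = diag (\<lambda>_. 1) c b"
      "diag (zsign M) c b * zsign M b = diag (\<lambda>_. 1) c b"
      "diag (hsign M) c b * hsign M b = diag (\<lambda>_. 1) c b"
      "zsign M c * diag (hsign M) c b = hsign M c * diag (zsign M) c b"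
      "diag (zsign M) c b * hsign M b = hsign M c * diag (zsign M) c b"
      "diag (hsign M) c b * zsign M b = hsign M c * diag (zsign M) c b"
      unfolding diag_def by auto
    show "mprod (gens ?T) (dmf ?T) (kron (diag (hsign M)) k) x y
        = mprod (gens ?T) (kron (diag (hsign M)) k) (dmf ?T) x y"
      unfolding x(1) y(1) by (simp add: tensor_expand finM finN x y D(6) S dd)
    have "diag (\<lambda>_. 1) c b * (mprod (gens N) (dchi N) k c' b' + mprod (gens N) k (dchi N) c' b')
        = diag (\<lambda>_. 1) c b
          * (diag (\<lambda>_. p) c' b' + mprod (gens N) (dmf N) h c' b' + mprod (gens N) h (dmf N) c' b')"
      by (simp only: D(7))
    moreover have "diag (\<lambda>_. 1) c b * diag (\<lambda>_. p) c' b' = diag (\<lambda>_. p) x y"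
      unfolding x(1) y(1) diag_def by simp
    ultimately show "mprod (gens ?T) (dchi ?T) (kron (diag (hsign M)) k) x y
        + mprod (gens ?T) (kron (diag (hsign M)) k) (dchi ?T) x y
        = diag (\<lambda>_. p) x y
        + mprod (gens ?T) (dmf ?T) (kron (diag (zsign M)) h) x y
        + mprod (gens ?T) (kron (diag (zsign M)) h) (dmf ?T) x y"
      unfolding x(1) y(1) by (simp add: tensor_expand finM finN x y S dd) (simp add: algebra_simps)
  qed
qed

subsection \<open>Shifts, base change and two-term complexes\<close>

lemma mf_complex_shift: "mf_complex L w M \<Longrightarrow> mf_complex L w (shift d M)"
  unfolding mf_complex_def shift_def by (simp add: algebra_simps)

lemma mf_complex_flip: "mf_complex L w M \<Longrightarrow> mf_complex L w (flip M)"
  unfolding mf_complex_def flip_def by simp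

lemma homotopy_shift: "homotopy L M p h k \<Longrightarrow> homotopy L (shift d M) p h k"
  unfolding homotopy_def shift_def by simp

lemma homotopy_flip: "homotopy L M p h k \<Longrightarrow> homotopy L (flip M) p h k"
  unfolding homotopy_def flip_def by simp

lemma mf_complex_mono:
  assumes "mf_complex L w M" "L \<subseteq> L'" shows "mf_complex L' w M"
proof -
  have "poly_ring L \<subseteq> poly_ring L'" using assms(2) unfolding poly_ring_def by blast
  then show ?thesis using assms(1) unfolding mf_complex_def by blast
qed

lemma homotopy_mono:
  assumes "homotopy L M p h k" "L \<subseteq> L'" shows "homotopy L' M p h k"
proof -
  have "poly_ring L \<subseteq> poly_ring L'" using assms(2) unfolding poly_ring_def by blast
  then show ?thesis using assms(1) unfolding homotopy_def by blast
qed

definition relabel_mat :: "(var \<Rightarrow> var) \<Rightarrow> mat \<Rightarrow> mat"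
  where "relabel_mat r f = (\<lambda>c b. relabel r (f c b))"

lemma relabel_mprod: "mprod A (relabel_mat r f) (relabel_mat r g) c b = relabel r (mprod A f g c b)"
  unfolding mprod_def relabel_mat_def by (simp add: relabel_sum relabel_mult)

lemma relabel_diag: "diag (\<lambda>_. relabel r w) c b = relabel r (diag (\<lambda>_. w) c b)"
  unfolding diag_def by simp

lemma base_change_simps [simp]:
  "gens (base_change r M) = gens M" "zodd (base_change r M) = zodd M"
  "adeg (base_change r M) = adeg M" "xdeg (base_change r M) = xdeg M" "hdeg (base_change r M) = hdeg M"
  "dmf (base_change r M) = relabel_mat r (dmf M)" "dchi (base_change r M) = relabel_mat r (dchi M)"
  unfolding base_change_def relabel_mat_def by simp_all

lemma relabel_nonzero: "relabel_mat r f c b \<noteq> 0 \<Longrightarrow> f c b \<noteq> 0"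
  unfolding relabel_mat_def by auto

lemma mf_complex_base_change:
  assumes M: "mf_complex {..<length ls} w M"
  shows "mf_complex (set ls) (relabel (place ls) w) (base_change (place ls) M)"
proof (rule mf_complexI)
  let ?B = "base_change (place ls) M"
  note D = mf_complexD[OF M]
  show "finite (gens ?B)" using D(1) by simp
  fix b c assume "b \<in> gens ?B" "c \<in> gens ?B"
  then have bc: "b \<in> gens M" "c \<in> gens M" by simp_all
  note D = D(2-)[OF bc]
  note S = base_change_simps relabel_mprod relabel_diag
  show "dmf ?B c b \<in> poly_ring (set ls)"
    "dchi ?B c b \<in> poly_ring (set ls)"
    unfolding S relabel_mat_def using D(1,2) by (auto intro: poly_ring_place)
  show "homog (adeg ?B b + 1 - adeg ?B c,
      xdeg ?B b + 1 - xdeg ?B c)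
      (dmf ?B c b)"
    "homog (adeg ?B b - adeg ?B c,
      xdeg ?B b - xdeg ?B c)
      (dchi ?B c b)"
    unfolding S relabel_mat_def using D(3,4) by (auto intro: homog_relabel vdeg_place)
  show "dmf ?B c b \<noteq> 0 \<Longrightarrow>
      hdeg ?B c = hdeg ?B b"
    "dmf ?B c b \<noteq> 0 \<Longrightarrow>
      zodd ?B c \<noteq> zodd ?B b"
    "dchi ?B c b \<noteq> 0 \<Longrightarrow>
      hdeg ?B c = hdeg ?B b + 1"
    "dchi ?B c b \<noteq> 0 \<Longrightarrow>
      zodd ?B c = zodd ?B b"
    unfolding S using D(5-8) relabel_nonzero by blast+
  show "mprod (gens ?B) (dmf ?B)
      (dmf ?B) c b = diag (\<lambda>_. relabel (place ls) w) c b"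
    unfolding S D(9) ..
  show "mprod (gens ?B) (dchi ?B)
      (dchi ?B) c b = 0"
    unfolding S D(10) by simp
  show "mprod (gens ?B) (dmf ?B)
      (dchi ?B) c b = mprod (gens ?B)
      (dchi ?B) (dmf ?B) c b"
    unfolding S D(11) ..
qed

lemma homotopy_base_change:
  assumes H: "homotopy {..<length ls} M p h k"
  shows "homotopy (set ls) (base_change (place ls) M) (relabel (place ls) p)
    (relabel_mat (place ls) h) (relabel_mat (place ls) k)"
proof (rule homotopyI)
  let ?B = "base_change (place ls) M"
  fix b c assume "b \<in> gens ?B" "c \<in> gens ?B"
  then have bc: "b \<in> gens M" "c \<in> gens M" by simp_all
  note D = homotopyD[OF H bc]
  note S = base_change_simps relabel_mprod relabel_diag
  show "relabel_mat (place ls) h c b \<in> poly_ring (set ls)"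
    "relabel_mat (place ls) k c b \<in> poly_ring (set ls)"
    unfolding relabel_mat_def using D(1,2) by (auto intro: poly_ring_place)
  show "relabel_mat (place ls) h c b \<noteq> 0 \<Longrightarrow>
      zodd ?B c \<noteq> zodd ?B b"
    "relabel_mat (place ls) k c b \<noteq> 0 \<Longrightarrow>
      zodd ?B c = zodd ?B b"
    "relabel_mat (place ls) k c b \<noteq> 0 \<Longrightarrow>
      odd (hdeg ?B c) \<noteq> odd (hdeg ?B b)"
    unfolding S using D(3-5) relabel_nonzero by blast+
  show "mprod (gens ?B) (dmf ?B) (relabel_mat (place ls) k) c b
    = mprod (gens ?B) (relabel_mat (place ls) k) (dmf ?B) c b"
    unfolding S D(6) ..
  show "mprod (gens ?B) (dchi ?B) (relabel_mat (place ls) k) c b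
    + mprod (gens ?B) (relabel_mat (place ls) k) (dchi ?B) c b
    = diag (\<lambda>_. relabel (place ls) p) c b
    + mprod (gens ?B) (dmf ?B) (relabel_mat (place ls) h) c b
    + mprod (gens ?B) (relabel_mat (place ls) h) (dmf ?B) c b"
    unfolding S relabel_add[symmetric] D(7) ..
qed

lemma gens_two_term: "gens (two_term r M f N) = Src ` gens M \<union> Tgt ` gens N"
  unfolding two_term_def by simp

lemma sum_gens_two_term:
  assumes "finite (gens M)" "finite (gens N)"
  shows "(\<Sum>e\<in>gens (two_term r M f N). F e) = (\<Sum>b\<in>gens M. F (Src b)) + (\<Sum>b\<in>gens N. F (Tgt b))"
  unfolding gens_two_term
  by (subst sum.union_disjoint) (use assms in \<open>auto simp: sum.reindex inj_on_def\<close>)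

lemma two_term_simps [simp]:
  "zodd (two_term r M f N) (Src b) = zodd M b" "zodd (two_term r M f N) (Tgt b') = zodd N b'"
  "adeg (two_term r M f N) (Src b) = adeg M b" "adeg (two_term r M f N) (Tgt b') = adeg N b'"
  "xdeg (two_term r M f N) (Src b) = xdeg M b" "xdeg (two_term r M f N) (Tgt b') = xdeg N b'"
  "hdeg (two_term r M f N) (Src b) = r" "hdeg (two_term r M f N) (Tgt b') = r + 1"
  "dmf (two_term r M f N) (Src c) (Src b) = dmf M c b"
  "dmf (two_term r M f N) (Tgt c') (Tgt b') = dmf N c' b'"
  "dmf (two_term r M f N) (Src c) (Tgt b') = 0" "dmf (two_term r M f N) (Tgt c') (Src b) = 0"
  "dchi (two_term r M f N) (Src c) (Src b) = 0" "dchi (two_term r M f N) (Tgt c') (Tgt b') = 0"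
  "dchi (two_term r M f N) (Src c) (Tgt b') = 0" "dchi (two_term r M f N) (Tgt c') (Src b) = f c' b"
  unfolding two_term_def by simp_all

lemma mf_complex_two_term:
  assumes M: "mf_complex L w M" and N: "mf_complex L w N"
    and f: "\<And>b c. b \<in> gens M \<Longrightarrow> c \<in> gens N \<Longrightarrow> f c b \<in> poly_ring L"
      "\<And>b c. b \<in> gens M \<Longrightarrow> c \<in> gens N \<Longrightarrow> homog (adeg M b - adeg N c, xdeg M b - xdeg N c) (f c b)"
      "\<And>b c. b \<in> gens M \<Longrightarrow> c \<in> gens N \<Longrightarrow> f c b \<noteq> 0 \<Longrightarrow> zodd N c = zodd M b"
      "\<And>b c. b \<in> gens M \<Longrightarrow> c \<in> gens N \<Longrightarrow> mprod (gens N) (dmf N) f c b = mprod (gens M) f (dmf M) c b"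
  shows "mf_complex L w (two_term r M f N)"
proof (rule mf_complexI)
  let ?T = "two_term r M f N"
  note fin = mf_complexD(1)[OF M] mf_complexD(1)[OF N]
  note DM = mf_complexD(2-)[OF M] and DN = mf_complexD(2-)[OF N]
  show "finite (gens ?T)" unfolding gens_two_term using fin by simp
  fix y x assume "y \<in> gens ?T" "x \<in> gens ?T"
  then have yx: "y \<in> Src ` gens M \<union> Tgt ` gens N" "x \<in> Src ` gens M \<union> Tgt ` gens N"
    unfolding gens_two_term by auto
  show "dmf ?T x y \<in> poly_ring L" using yx DM(1) DN(1) by auto
  show "dchi ?T x y \<in> poly_ring L" using yx f(1) by auto
  show "homog (adeg ?T y + 1 - adeg ?T x, xdeg ?T y + 1 - xdeg ?T x) (dmf ?T x y)"
    using yx DM(3) DN(3) by auto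
  show "homog (adeg ?T y - adeg ?T x, xdeg ?T y - xdeg ?T x) (dchi ?T x y)"
    using yx f(2) by auto
  show "dmf ?T x y \<noteq> 0 \<Longrightarrow> hdeg ?T x = hdeg ?T y" using yx by auto
  show "dmf ?T x y \<noteq> 0 \<Longrightarrow> zodd ?T x \<noteq> zodd ?T y" using yx DM(6) DN(6) by auto
  show "dchi ?T x y \<noteq> 0 \<Longrightarrow> hdeg ?T x = hdeg ?T y + 1" using yx by auto
  show "dchi ?T x y \<noteq> 0 \<Longrightarrow> zodd ?T x = zodd ?T y" using yx f(3) by auto
  have prod: "mprod (gens ?T) g h = (\<lambda>c b. (\<Sum>e\<in>gens M. g c (Src e) * h (Src e) b)
      + (\<Sum>e\<in>gens N. g c (Tgt e) * h (Tgt e) b))" for g h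
    unfolding mprod_def sum_gens_two_term[OF fin] ..
  have dM: "(\<Sum>e\<in>gens M. dmf M c e * dmf M e b) = diag (\<lambda>_. w) c b"
    if "b \<in> gens M" "c \<in> gens M" for c b using DM(9)[OF that] unfolding mprod_def .
  have dN: "(\<Sum>e\<in>gens N. dmf N c e * dmf N e b) = diag (\<lambda>_. w) c b"
    if "b \<in> gens N" "c \<in> gens N" for c b using DN(9)[OF that] unfolding mprod_def .
  have df: "(\<Sum>e\<in>gens N. dmf N c e * f e b) = (\<Sum>e\<in>gens M. f c e * dmf M e b)"
    if "b \<in> gens M" "c \<in> gens N" for c b using f(4)[OF that] unfolding mprod_def .
  show "mprod (gens ?T) (dmf ?T) (dmf ?T) x y = diag (\<lambda>_. w) x y"
    unfolding prod using yx by (auto simp: dM dN) (auto simp: diag_def)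
  show "mprod (gens ?T) (dchi ?T) (dchi ?T) x y = 0" unfolding prod using yx by auto
  show "mprod (gens ?T) (dmf ?T) (dchi ?T) x y = mprod (gens ?T) (dchi ?T) (dmf ?T) x y"
    unfolding prod using yx by (auto simp: df)
qed

definition block_diag :: "mat \<Rightarrow> mat \<Rightarrow> mat" where
  "block_diag h h' = (\<lambda>x y. case (x, y) of (Src c, Src b) \<Rightarrow> h c b | (Tgt c, Tgt b) \<Rightarrow> h' c b | _ \<Rightarrow> 0)"
definition block_back :: "mat \<Rightarrow> mat" where
  "block_back g = (\<lambda>x y. case (x, y) of (Src c, Tgt b) \<Rightarrow> g c b | _ \<Rightarrow> 0)"

lemma block_simps [simp]:
  "block_diag h h' (Src c) (Src b) = h c b" "block_diag h h' (Tgt c') (Tgt b') = h' c' b'"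
  "block_diag h h' (Src c) (Tgt b') = 0" "block_diag h h' (Tgt c') (Src b) = 0"
  "block_back g (Src c) (Src b) = 0" "block_back g (Tgt c') (Tgt b') = 0"
  "block_back g (Src c) (Tgt b') = g c b'" "block_back g (Tgt c') (Src b) = 0"
  unfolding block_diag_def block_back_def by simp_all

text \<open>If \<open>g f \<simeq> p\<close> and \<open>f g \<simeq> p\<close>, then \<open>g\<close> in the backward direction contracts \<open>p\<close> on \<open>M \<rightarrow> N\<close>: \<open>d\<^sub>\<chi> k + k d\<^sub>\<chi>\<close> is \<open>g f\<close> on the source and
  \<open>f g\<close> on the target.\<close>

lemma homotopy_two_term:
  assumes fin: "finite (gens M)" "finite (gens N)"
    and h: "\<And>b c. b \<in> gens M \<Longrightarrow> c \<in> gens M \<Longrightarrow> h c b \<in> poly_ring L"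
      "\<And>b c. b \<in> gens M \<Longrightarrow> c \<in> gens M \<Longrightarrow> h c b \<noteq> 0 \<Longrightarrow> zodd M c \<noteq> zodd M b"
    and h': "\<And>b c. b \<in> gens N \<Longrightarrow> c \<in> gens N \<Longrightarrow> h' c b \<in> poly_ring L"
      "\<And>b c. b \<in> gens N \<Longrightarrow> c \<in> gens N \<Longrightarrow> h' c b \<noteq> 0 \<Longrightarrow> zodd N c \<noteq> zodd N b"
    and g: "\<And>b c. b \<in> gens N \<Longrightarrow> c \<in> gens M \<Longrightarrow> g c b \<in> poly_ring L"
      "\<And>b c. b \<in> gens N \<Longrightarrow> c \<in> gens M \<Longrightarrow> g c b \<noteq> 0 \<Longrightarrow> zodd M c = zodd N b"
      "\<And>b c. b \<in> gens N \<Longrightarrow> c \<in> gens M \<Longrightarrow> mprod (gens M) (dmf M) g c b = mprod (gens N) g (dmf N) c b"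
    and gf: "\<And>b c. b \<in> gens M \<Longrightarrow> c \<in> gens M \<Longrightarrow> mprod (gens N) g f c b
      = diag (\<lambda>_. p) c b + mprod (gens M) (dmf M) h c b + mprod (gens M) h (dmf M) c b"
    and fg: "\<And>b c. b \<in> gens N \<Longrightarrow> c \<in> gens N \<Longrightarrow> mprod (gens M) f g c b
      = diag (\<lambda>_. p) c b + mprod (gens N) (dmf N) h' c b + mprod (gens N) h' (dmf N) c b"
  shows "homotopy L (two_term r M f N) p (block_diag h h') (block_back g)"
proof (rule homotopyI)
  let ?T = "two_term r M f N"
  fix y x assume "y \<in> gens ?T" "x \<in> gens ?T"
  then have yx: "y \<in> Src ` gens M \<union> Tgt ` gens N" "x \<in> Src ` gens M \<union> Tgt ` gens N"
    unfolding gens_two_term by auto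
  show "block_diag h h' x y \<in> poly_ring L" using yx h(1) h'(1) by auto
  show "block_back g x y \<in> poly_ring L" using yx g(1) by auto
  show "block_diag h h' x y \<noteq> 0 \<Longrightarrow> zodd ?T x \<noteq> zodd ?T y" using yx h(2) h'(2) by auto
  show "block_back g x y \<noteq> 0 \<Longrightarrow> zodd ?T x = zodd ?T y" using yx g(2) by auto
  show "block_back g x y \<noteq> 0 \<Longrightarrow> odd (hdeg ?T x) \<noteq> odd (hdeg ?T y)" using yx by auto
  have prod: "mprod (gens ?T) g h = (\<lambda>c b. (\<Sum>e\<in>gens M. g c (Src e) * h (Src e) b)
      + (\<Sum>e\<in>gens N. g c (Tgt e) * h (Tgt e) b))" for g h
    unfolding mprod_def sum_gens_two_term[OF fin] ..
  note G = g(3)[unfolded mprod_def] gf[unfolded mprod_def] fg[unfolded mprod_def]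
  have dd: "diag (\<lambda>_. p) (Src c) (Src b) = diag (\<lambda>_. p) c b" "diag (\<lambda>_. p) (Tgt c) (Tgt b) = diag (\<lambda>_. p) c b"
    "diag (\<lambda>_. p) (Src c) (Tgt b) = 0" "diag (\<lambda>_. p) (Tgt c) (Src b) = 0" for c b
    unfolding diag_def by auto
  show "mprod (gens ?T) (dmf ?T) (block_back g) x y = mprod (gens ?T) (block_back g) (dmf ?T) x y"
    unfolding prod using yx by (auto simp: G)
  show "mprod (gens ?T) (dchi ?T) (block_back g) x y + mprod (gens ?T) (block_back g) (dchi ?T) x y
      = diag (\<lambda>_. p) x y + mprod (gens ?T) (dmf ?T) (block_diag h h') x y
        + mprod (gens ?T) (block_diag h h') (dmf ?T) x y"
    unfolding prod using yx by (auto simp: G dd)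
qed

lemma homotopy_two_term_direct:
  assumes fin: "finite (gens M)" "finite (gens N)"
    and M: "homotopy L M p h 0" and N: "homotopy L N p h' 0"
  shows "homotopy L (two_term r M f N) p (block_diag h h') 0"
proof (rule homotopyI)
  let ?T = "two_term r M f N"
  fix y x assume "y \<in> gens ?T" "x \<in> gens ?T"
  then have yx: "y \<in> Src ` gens M \<union> Tgt ` gens N" "x \<in> Src ` gens M \<union> Tgt ` gens N"
    unfolding gens_two_term by auto
  show "block_diag h h' x y \<in> poly_ring L" using yx homotopyD(1)[OF M] homotopyD(1)[OF N] by auto
  show "block_diag h h' x y \<noteq> 0 \<Longrightarrow> zodd ?T x \<noteq> zodd ?T y"
    using yx homotopyD(3)[OF M] homotopyD(3)[OF N] by auto
  have prod: "mprod (gens ?T) g h = (\<lambda>c b. (\<Sum>e\<in>gens M. g c (Src e) * h (Src e) b)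
      + (\<Sum>e\<in>gens N. g c (Tgt e) * h (Tgt e) b))" for g h
    unfolding mprod_def sum_gens_two_term[OF fin] ..
  note G = homotopyD(7)[OF M, unfolded mprod_0_left mprod_0_right zero_fun_apply, unfolded mprod_def]
    homotopyD(7)[OF N, unfolded mprod_0_left mprod_0_right zero_fun_apply, unfolded mprod_def]
  have dd: "diag (\<lambda>_. p) (Src c) (Src b) = diag (\<lambda>_. p) c b" "diag (\<lambda>_. p) (Tgt c) (Tgt b) = diag (\<lambda>_. p) c b"
    "diag (\<lambda>_. p) (Src c) (Tgt b) = 0" "diag (\<lambda>_. p) (Tgt c) (Src b) = 0" for c b
    unfolding diag_def by auto
  have "diag (\<lambda>_. p) x y + mprod (gens ?T) (dmf ?T) (block_diag h h') x y
        + mprod (gens ?T) (block_diag h h') (dmf ?T) x y = 0"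
    unfolding prod using yx G by (auto simp: dd)
  then show "mprod (gens ?T) (dchi ?T) 0 x y + mprod (gens ?T) 0 (dchi ?T) x y
      = diag (\<lambda>_. p) x y + mprod (gens ?T) (dmf ?T) (block_diag h h') x y
        + mprod (gens ?T) (block_diag h h') (dmf ?T) x y" by simp
qed simp_all

lemma mprod_uminus_left: "mprod A (- f) g c b = - mprod A f g c b"
  unfolding mprod_def by (simp add: sum_negf)
lemma mprod_uminus_right: "mprod A f (- g) c b = - mprod A f g c b"
  unfolding mprod_def by (simp add: sum_negf)

lemma homotopy_add:
  assumes "homotopy L M p h 0" "homotopy L M p' h' 0"
  shows "homotopy L M (p + p') (h + h') 0"
proof (rule homotopyI)
  fix b c assume bc: "b \<in> gens M" "c \<in> gens M"
  note D = homotopyD[OF assms(1) bc] and D' = homotopyD[OF assms(2) bc]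
  show "(h + h') c b \<in> poly_ring L" using D(1) D'(1) by (simp add: poly_ring_add)
  show "(h + h') c b \<noteq> 0 \<Longrightarrow> zodd M c \<noteq> zodd M b" using D(3) D'(3) by (cases "h c b = 0") auto
  have "diag (\<lambda>_. p + p') c b = diag (\<lambda>_. p) c b + diag (\<lambda>_. p') c b" unfolding diag_def by simp
  moreover have "0 = (diag (\<lambda>_. p) c b + mprod (gens M) (dmf M) h c b + mprod (gens M) h (dmf M) c b)
      + (diag (\<lambda>_. p') c b + mprod (gens M) (dmf M) h' c b + mprod (gens M) h' (dmf M) c b)"
    using D(7) D'(7) by simp
  ultimately show "mprod (gens M) (dchi M) 0 c b + mprod (gens M) 0 (dchi M) c b
      = diag (\<lambda>_. p + p') c b + mprod (gens M) (dmf M) (h + h') c b + mprod (gens M) (h + h') (dmf M) c b"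
    by (simp add: mprod_add_left mprod_add_right algebra_simps)
qed simp_all

subsection \<open>The local pieces\<close>

lemma koszul_row_simps [simp]:
  "gens (koszul_row a0 a1 d) = {Row False, Row True}"
  "zodd (koszul_row a0 a1 d) (Row t) = t"
  "adeg (koszul_row a0 a1 d) (Row t) = (if t then 1 - fst d else 0)"
  "xdeg (koszul_row a0 a1 d) (Row t) = (if t then 1 - snd d else 0)"
  "hdeg (koszul_row a0 a1 d) g = 0"
  "dmf (koszul_row a0 a1 d) (Row t) (Row u) = (if t = u then 0 else if t then a0 else a1)"
  "dchi (koszul_row a0 a1 d) = 0"
  unfolding koszul_row_def by (auto simp: fun_eq_iff)

lemma mf_complex_koszul_row:
  assumes "a0 \<in> poly_ring L" "a1 \<in> poly_ring L" "homog (d1, d2) a0" "homog (2 - d1, 2 - d2) a1"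
  shows "mf_complex L (a0 * a1) (koszul_row a0 a1 (d1, d2))"
  using assms unfolding mf_complex_def by (auto simp: mprod_def diag_def mult.commute)

definition row_up :: "qpoly \<Rightarrow> mat" where "row_up p = (\<lambda>c b. if c = Row True \<and> b = Row False then p else 0)"
definition row_down :: "qpoly \<Rightarrow> mat" where "row_down p = (\<lambda>c b. if c = Row False \<and> b = Row True then p else 0)"

lemma homotopy_row_first: "homotopy L (koszul_row a0 a1 d) a0 (row_down (- 1)) 0"
  unfolding homotopy_def by (auto simp: mprod_def diag_def row_down_def poly_ring_uminus)

lemma homotopy_row_second: "homotopy L (koszul_row a0 a1 d) a1 (row_up (- 1)) 0"
  unfolding homotopy_def by (auto simp: mprod_def diag_def row_up_def poly_ring_uminus)

section \<open>Multiplications that are null-homotopic\<close>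

lemma kron_0_right [simp]: "kron f 0 = 0"
  unfolding kron_def by (intro ext) (simp split: gen.split)

text \<open>\<open>null_mf\<close> gives zero on the homology of \<open>d\<^sub>m\<^sub>f\<close>, and \<open>null_total\<close> only on the homology of \<open>d\<^sub>\<chi>\<close> on it.\<close>

definition null_mf :: "nat set \<Rightarrow> cmf \<Rightarrow> qpoly \<Rightarrow> bool"
  where "null_mf L M p \<longleftrightarrow> (\<exists>h. homotopy L M p h 0)"
definition null_total :: "nat set \<Rightarrow> cmf \<Rightarrow> qpoly \<Rightarrow> bool"
  where "null_total L M p \<longleftrightarrow> (\<exists>h k. homotopy L M p h k)"

lemma null_mf_total: "null_mf L M p \<Longrightarrow> null_total L M p"
  unfolding null_mf_def null_total_def by blast
lemma null_mf_add: "null_mf L M p \<Longrightarrow> null_mf L M q \<Longrightarrow> null_mf L M (p + q)"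
  unfolding null_mf_def using homotopy_add by blast
lemma null_tensor_left:
  assumes "mf_complex L w M" "mf_complex L w' N"
  shows "null_mf L M p \<Longrightarrow> null_mf L (tensor M N) p" "null_total L M p \<Longrightarrow> null_total L (tensor M N) p"
  unfolding null_mf_def null_total_def
  using homotopy_tensor_left[OF assms, of p _ 0, unfolded kron_0_left]
    homotopy_tensor_left[OF assms] by blast+
lemma null_tensor_right:
  assumes "mf_complex L w M" "mf_complex L w' N"
  shows "null_mf L N p \<Longrightarrow> null_mf L (tensor M N) p" "null_total L N p \<Longrightarrow> null_total L (tensor M N) p"
  unfolding null_mf_def null_total_def
  using homotopy_tensor_right[OF assms, of p _ 0, unfolded kron_0_right]
    homotopy_tensor_right[OF assms] by blast+
lemma null_mf_shift_flip: "null_mf L M p \<Longrightarrow> null_mf L (shift d (flip M)) p"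
  unfolding null_mf_def using homotopy_flip homotopy_shift by blast
lemma null_mf_shift: "null_mf L M p \<Longrightarrow> null_mf L (shift d M) p"
  unfolding null_mf_def using homotopy_shift by blast
lemma null_mf_two_term:
  assumes "finite (gens M)" "finite (gens N)" "null_mf L M p" "null_mf L N p"
  shows "null_mf L (two_term r M f N) p"
  using homotopy_two_term_direct[OF assms(1,2)] assms(3,4) unfolding null_mf_def by blast
lemma relabel_mat_0 [simp]: "relabel_mat r 0 = 0"
  unfolding relabel_mat_def by (intro ext) simp
lemma null_base_change:
  "null_mf {..<length ls} M p \<Longrightarrow> null_mf (set ls) (base_change (place ls) M) (relabel (place ls) p)"
  "null_total {..<length ls} M p \<Longrightarrow> null_total (set ls) (base_change (place ls) M) (relabel (place ls) p)"
  unfolding null_mf_def null_total_def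
  using homotopy_base_change[of ls M p _ 0, unfolded relabel_mat_0] homotopy_base_change[of ls M p]
  by blast+
lemma null_mono:
  assumes "L \<subseteq> L'"
  shows "null_mf L M p \<Longrightarrow> null_mf L' M p" "null_total L M p \<Longrightarrow> null_total L' M p"
  unfolding null_mf_def null_total_def using homotopy_mono[OF _ assms] by blast+
lemma null_row:
  "null_mf L (koszul_row a0 a1 d) a0" "null_mf L (koszul_row a0 a1 d) a1"
  unfolding null_mf_def using homotopy_row_first homotopy_row_second by blast+

abbreviation L4 :: "nat set" where "L4 \<equiv> {..<4}"

lemma homog_pX_diff: "homog (0, 2) (pX i - pX j)"
  using homog_Var[of "VarX i"] homog_Var[of "VarX j"] unfolding vdeg_def by (simp add: homog_diff)

lemma homog_pA: "homog (2, 0) pA"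
  using homog_Var[of VarA] unfolding vdeg_def by simp

lemma mf_complex_arc_row: "i \<in> L \<Longrightarrow> s \<in> L \<Longrightarrow>
    mf_complex L (pA * (pX s - pX i)) (koszul_row pA (pX s - pX i) (2, 0))"
  by (rule mf_complex_koszul_row) (use homog_pX_diff homog_pA in \<open>auto intro: poly_ring_diff\<close>)

definition crossing_potential :: qpoly
  where "crossing_potential = pA * (pX 2 + pX 3 - pX 0 - pX 1)"

lemma mf_complex_Gamma0: "mf_complex L4 crossing_potential C0_Gamma0"
proof -
  have "mf_complex L4 (pA * (pX 2 - pX 0) + pA * (pX 3 - pX 1)) C0_Gamma0"
    unfolding C0_Gamma0_def by (intro mf_complex_tensor mf_complex_arc_row) auto
  then show ?thesis unfolding crossing_potential_def by (simp add: algebra_simps)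
qed

lemma wide_row: "mf_complex L4 crossing_potential (koszul_row pA (pX 2 + pX 3 - pX 0 - pX 1) (2, 0))"
proof -
  have "homog (0, 2) ((pX 2 - pX 0) + (pX 3 - pX 1))" by (intro homog_add homog_pX_diff)
  then have "homog (0, 2) (pX 2 + pX 3 - pX 0 - pX 1)" by (simp add: algebra_simps)
  then show ?thesis unfolding crossing_potential_def
    by (intro mf_complex_koszul_row) (use homog_pA in \<open>auto intro!: poly_ring_diff poly_ring_add\<close>)
qed

lemma quadratic_row: "mf_complex L4 0 (koszul_row 0 (pX 2 * pX 3 - pX 0 * pX 1) (2, - 2))"
proof -
  have X: "homog (0, 2) (pX i)" for i using homog_Var[of "VarX i"] unfolding vdeg_def by simp
  have "homog (0, 4) (pX 2 * pX 3 - pX 0 * pX 1)"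
    by (intro homog_diff homog_mult'[OF X X]) auto
  then have "mf_complex L4 (0 * (pX 2 * pX 3 - pX 0 * pX 1)) (koszul_row 0 (pX 2 * pX 3 - pX 0 * pX 1) (2, - 2))"
    by (intro mf_complex_koszul_row) (auto intro!: poly_ring_diff poly_ring_mult)
  then show ?thesis by simp
qed

lemma mf_complex_Gamma1: "mf_complex L4 crossing_potential C0_Gamma1"
  using mf_complex_shift[OF mf_complex_tensor[OF wide_row quadratic_row], of "(0, - 1)"]
  unfolding C0_Gamma1_def by simp

lemma null_Gamma0: "null_mf L4 C0_Gamma0 pA" "null_mf L4 C0_Gamma0 (pX 2 + pX 3 - pX 0 - pX 1)"
proof -
  have r: "mf_complex L4 (pA * (pX 2 - pX 0)) (koszul_row pA (pX 2 - pX 0) (2, 0))"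
    "mf_complex L4 (pA * (pX 3 - pX 1)) (koszul_row pA (pX 3 - pX 1) (2, 0))"
    by (rule mf_complex_arc_row; simp)+
  show "null_mf L4 C0_Gamma0 pA" unfolding C0_Gamma0_def by (rule null_tensor_left(1)[OF r null_row(1)])
  have "null_mf L4 C0_Gamma0 ((pX 2 - pX 0) + (pX 3 - pX 1))" unfolding C0_Gamma0_def
    by (rule null_mf_add[OF null_tensor_left(1)[OF r null_row(2)] null_tensor_right(1)[OF r null_row(2)]])
  then show "null_mf L4 C0_Gamma0 (pX 2 + pX 3 - pX 0 - pX 1)" by (simp add: algebra_simps)
qed

lemma null_Gamma1: "null_mf L4 C0_Gamma1 pA" "null_mf L4 C0_Gamma1 (pX 2 + pX 3 - pX 0 - pX 1)"
  unfolding C0_Gamma1_def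
  by (rule null_mf_shift[OF null_tensor_left(1)[OF wide_row quadratic_row null_row(1)]]
      null_mf_shift[OF null_tensor_left(1)[OF wide_row quadratic_row null_row(2)]])+

lemma graded_mapD:
  assumes "graded_map L M N (d1, d2) f" "b \<in> gens M" "c \<in> gens N"
  shows "f c b \<in> poly_ring L" "f c b \<noteq> 0 \<Longrightarrow> zodd N c = zodd M b"
    "homog (adeg M b + d1 - adeg N c, xdeg M b + d2 - xdeg N c) (f c b)"
  using assms(1)[unfolded graded_map_def, THEN bspec, THEN bspec, OF assms(2,3)] by auto

lemma mf_morphismD:
  assumes "mf_morphism L M N d f"
  shows "graded_map L M N d f"
    "\<And>b c. b \<in> gens M \<Longrightarrow> c \<in> gens N \<Longrightarrow> mprod (gens N) (dmf N) f c b = mprod (gens M) f (dmf M) c b"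
  using assms unfolding mf_morphism_def mprod_def by auto

lemma homotopicD:
  assumes "homotopic L M M d (compose_via N g f) (scalar_map p)"
  obtains h where "\<And>b c. b \<in> gens M \<Longrightarrow> c \<in> gens M \<Longrightarrow> h c b \<in> poly_ring L"
    "\<And>b c. b \<in> gens M \<Longrightarrow> c \<in> gens M \<Longrightarrow> h c b \<noteq> 0 \<Longrightarrow> zodd M c \<noteq> zodd M b"
    "\<And>b c. b \<in> gens M \<Longrightarrow> c \<in> gens M \<Longrightarrow> mprod (gens N) g f c b
      = diag (\<lambda>_. p) c b + mprod (gens M) (dmf M) h c b + mprod (gens M) h (dmf M) c b"
proof -
  obtain h where h: "graded_map L M (flip M) (fst d - 1, snd d - 1) h"
    and e: "\<And>b c. b \<in> gens M \<Longrightarrow> c \<in> gens M \<Longrightarrow> compose_via N g f c b - scalar_map p c b =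
        (\<Sum>e\<in>gens M. dmf M c e * h e b) + (\<Sum>e\<in>gens M. h c e * dmf M e b)"
    using assms unfolding homotopic_def by blast
  have fl: "gens (flip M) = gens M" "zodd (flip M) c = (\<not> zodd M c)" for c unfolding flip_def by simp_all
  show thesis
  proof (rule that[of h])
    fix b c assume bc: "b \<in> gens M" "c \<in> gens M"
    show "h c b \<in> poly_ring L" using graded_mapD(1)[OF h bc(1)] bc(2) fl by simp
    show "zodd M c \<noteq> zodd M b" if "h c b \<noteq> 0" using graded_mapD(2)[OF h bc(1)] bc(2) that fl by auto
    show "mprod (gens N) g f c b
      = diag (\<lambda>_. p) c b + mprod (gens M) (dmf M) h c b + mprod (gens M) h (dmf M) c b"
      using e[OF bc] unfolding compose_via_def scalar_map_def mprod_def diag_def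
      by (simp add: diff_eq_eq add.assoc)
  qed
qed

text \<open>Common to both crossings: \<open>f\<close> is the morphism used as differential, \<open>g\<close> the other one. The
  difference of the shifts compensates the degree \<open>(0, 1)\<close> of \<open>f\<close>.\<close>

lemma crossing_piece:
  assumes M: "mf_complex L w M" and N: "mf_complex L w N"
    and f: "mf_morphism L M N (0, 1) f" and g: "mf_morphism L N M (0, 1) g"
    and gf: "homotopic L M M (0, 2) (compose_via N g f) (scalar_map p)"
    and fg: "homotopic L N N (0, 2) (compose_via M f g) (scalar_map p)"
    and d: "d1 = d1'" "d2 = d2' + 1"
  shows "mf_complex L w (two_term r (shift (d1, d2) (flip M)) f (shift (d1', d2') (flip N)))"
    and "null_total L (two_term r (shift (d1, d2) (flip M)) f (shift (d1', d2') (flip N))) p"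
proof -
  let ?M = "shift (d1, d2) (flip M)" and ?N = "shift (d1', d2') (flip N)"
  have s: "gens (shift d (flip X)) = gens X" "dmf (shift d (flip X)) = dmf X"
    "zodd (shift d (flip X)) c = (\<not> zodd X c)" "adeg (shift d (flip X)) c = adeg X c + fst d"
    "xdeg (shift d (flip X)) c = xdeg X c + snd d" for d X c
    unfolding shift_def flip_def by simp_all
  have M': "mf_complex L w ?M" and N': "mf_complex L w ?N"
    using M N by (auto intro: mf_complex_shift mf_complex_flip)
  note F = graded_mapD[OF mf_morphismD(1)[OF f]] and G = graded_mapD[OF mf_morphismD(1)[OF g]]
  show "mf_complex L w (two_term r ?M f ?N)"
  proof (rule mf_complex_two_term[OF M' N'], unfold s)
    fix b c assume bc: "b \<in> gens M" "c \<in> gens N"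
    show "f c b \<in> poly_ring L" using F(1)[OF bc] .
    show "homog (adeg M b + fst (d1, d2) - (adeg N c + fst (d1', d2')),
        xdeg M b + snd (d1, d2) - (xdeg N c + snd (d1', d2'))) (f c b)"
      using F(3)[OF bc] d by (simp add: algebra_simps)
    show "(\<not> zodd N c) = (\<not> zodd M b)" if "f c b \<noteq> 0" using F(2)[OF bc that] by simp
    show "mprod (gens N) (dmf N) f c b = mprod (gens M) f (dmf M) c b"
      using mf_morphismD(2)[OF f bc] .
  qed
  obtain h where h: "\<And>b c. b \<in> gens M \<Longrightarrow> c \<in> gens M \<Longrightarrow> h c b \<in> poly_ring L"
    "\<And>b c. b \<in> gens M \<Longrightarrow> c \<in> gens M \<Longrightarrow> h c b \<noteq> 0 \<Longrightarrow> zodd M c \<noteq> zodd M b"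
    "\<And>b c. b \<in> gens M \<Longrightarrow> c \<in> gens M \<Longrightarrow> mprod (gens N) g f c b
      = diag (\<lambda>_. p) c b + mprod (gens M) (dmf M) h c b + mprod (gens M) h (dmf M) c b"
    using homotopicD[OF gf] by blast
  obtain h' where h': "\<And>b c. b \<in> gens N \<Longrightarrow> c \<in> gens N \<Longrightarrow> h' c b \<in> poly_ring L"
    "\<And>b c. b \<in> gens N \<Longrightarrow> c \<in> gens N \<Longrightarrow> h' c b \<noteq> 0 \<Longrightarrow> zodd N c \<noteq> zodd N b"
    "\<And>b c. b \<in> gens N \<Longrightarrow> c \<in> gens N \<Longrightarrow> mprod (gens M) f g c b
      = diag (\<lambda>_. p) c b + mprod (gens N) (dmf N) h' c b + mprod (gens N) h' (dmf N) c b"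
    using homotopicD[OF fg] by blast
  have "homotopy L (two_term r ?M f ?N) p (block_diag h h') (block_back g)"
    by (rule homotopy_two_term, unfold s)
      (use h h' G mf_morphismD(2)[OF g] mf_complexD(1)[OF M] mf_complexD(1)[OF N] in auto)
  then show "null_total L (two_term r ?M f ?N) p" unfolding null_total_def by blast
qed

fun bots :: "piece \<Rightarrow> nat list" where
  "bots (Arc i s) = [i]"
| "bots (Pos i j s t) = [i, j]"
| "bots (Neg i j s t) = [i, j]"

definition sumX :: "nat list \<Rightarrow> qpoly" where "sumX us = sum_list (map pX us)"

lemma place_simps:
  "place [i, s] VarA = VarA" "place [i, s] (VarX 0) = VarX i" "place [i, s] (VarX 1) = VarX s"
  "place [i, j, s, t] VarA = VarA" "place [i, j, s, t] (VarX 0) = VarX i" "place [i, j, s, t] (VarX 1) = VarX j"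
  "place [i, s] (VarX (Suc 0)) = VarX s" "place [i, j, s, t] (VarX (Suc 0)) = VarX j"
  "place [i, j, s, t] (VarX 2) = VarX s" "place [i, j, s, t] (VarX 3) = VarX t"
  unfolding place_def by (simp_all add: numeral_2_eq_2 numeral_3_eq_3)

lemmas relabel_simps = relabel_mult relabel_add relabel_diff relabel_Var place_simps

text \<open>Along both strands of a crossing the variables agree: \<open>x\<^sub>s - x\<^sub>j\<close> is contracted by the other
  \<open>\<chi>\<close>-map, and \<open>x\<^sub>t - x\<^sub>i\<close> is the difference of \<open>x\<^sub>s + x\<^sub>t - x\<^sub>i - x\<^sub>j\<close>, which is null-homotopic on both
  resolutions, and \<open>x\<^sub>s - x\<^sub>j\<close>. The two contractions are of different kinds, whence the difference
  \<open>p - q\<close> in the last statement.\<close>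

theorem piece_properties:
  assumes "chi_maps chi0 chi1"
  defines "M P \<equiv> C0_piece chi0 chi1 P" and "L P \<equiv> set (bots P) \<union> set (tops P)"
  shows "mf_complex (L P) (pA * (sumX (tops P) - sumX (bots P))) (M P)"
    and "null_mf (L P) (M P) pA"
    and "(u, v) \<in> strands P \<Longrightarrow> \<exists>p q. pX v - pX u = p - q \<and> null_total (L P) (M P) p \<and> (null_total (L P) (M P) q \<or> q = 0)"
proof -
  have L4: "{0, 1, 2, 3} = L4" by auto
  note chi = assms(1)[unfolded chi_maps_def Let_def L4]
  have chi0: "mf_morphism L4 C0_Gamma0 C0_Gamma1 (0, 1) chi0"
    and chi1: "mf_morphism L4 C0_Gamma1 C0_Gamma0 (0, 1) chi1"
    and h00: "homotopic L4 C0_Gamma0 C0_Gamma0 (0, 2) (compose_via C0_Gamma1 chi1 chi0) (scalar_map (pX 1 - pX 2))"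
    and h11: "homotopic L4 C0_Gamma1 C0_Gamma1 (0, 2) (compose_via C0_Gamma0 chi0 chi1) (scalar_map (pX 1 - pX 2))"
    using chi by blast+
  have pos: "mf_complex L4 crossing_potential (C0_pos chi1)" "null_total L4 (C0_pos chi1) (pX 1 - pX 2)"
    unfolding C0_pos_def by (rule crossing_piece[OF mf_complex_Gamma1 mf_complex_Gamma0 chi1 chi0 h11 h00]; simp)+
  have neg: "mf_complex L4 crossing_potential (C0_neg chi0)" "null_total L4 (C0_neg chi0) (pX 1 - pX 2)"
    unfolding C0_neg_def by (rule crossing_piece[OF mf_complex_Gamma0 mf_complex_Gamma1 chi0 chi1 h00 h11]; simp)+
  have fin: "finite (gens (shift d (flip C0_Gamma0)))" "finite (gens (shift d (flip C0_Gamma1)))" for d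
    using mf_complexD(1)[OF mf_complex_shift[OF mf_complex_flip[OF mf_complex_Gamma0]]]
      mf_complexD(1)[OF mf_complex_shift[OF mf_complex_flip[OF mf_complex_Gamma1]]] by auto
  have npos: "null_mf L4 (C0_pos chi1) pA" "null_mf L4 (C0_pos chi1) (pX 2 + pX 3 - pX 0 - pX 1)"
    unfolding C0_pos_def
    by (rule null_mf_two_term[OF fin(2,1)]; rule null_mf_shift_flip; rule null_Gamma0 null_Gamma1)+
  have nneg: "null_mf L4 (C0_neg chi0) pA" "null_mf L4 (C0_neg chi0) (pX 2 + pX 3 - pX 0 - pX 1)"
    unfolding C0_neg_def
    by (rule null_mf_two_term[OF fin]; rule null_mf_shift_flip; rule null_Gamma0 null_Gamma1)+
  have arc: "mf_complex {..<2} (pA * (pX 1 - pX 0)) C0_arc" "null_mf {..<2} C0_arc pA"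
    "null_mf {..<2} C0_arc (pX 1 - pX 0)"
    unfolding C0_arc_def by (rule mf_complex_arc_row; simp) (rule null_row)+
  have A: "mf_complex (set [i, s]) (relabel (place [i, s]) (pA * (pX 1 - pX 0))) (base_change (place [i, s]) C0_arc)"
    "null_mf (set [i, s]) (base_change (place [i, s]) C0_arc) (relabel (place [i, s]) pA)"
    "null_mf (set [i, s]) (base_change (place [i, s]) C0_arc) (relabel (place [i, s]) (pX 1 - pX 0))" for i s
    by (rule mf_complex_base_change null_base_change; use arc in \<open>simp add: numeral_2_eq_2\<close>)+
  have X: "mf_complex (set [i, j, s, t]) (relabel (place [i, j, s, t]) crossing_potential) (base_change (place [i, j, s, t]) K)"
    "null_mf (set [i, j, s, t]) (base_change (place [i, j, s, t]) K) (relabel (place [i, j, s, t]) pA)"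
    "null_mf (set [i, j, s, t]) (base_change (place [i, j, s, t]) K) (relabel (place [i, j, s, t]) (pX 2 + pX 3 - pX 0 - pX 1))"
    "null_total (set [i, j, s, t]) (base_change (place [i, j, s, t]) K) (relabel (place [i, j, s, t]) (pX 1 - pX 2))"
    if "K = C0_pos chi1 \<or> K = C0_neg chi0" for i j s t K
    by (rule mf_complex_base_change null_base_change; use that pos neg npos nneg in \<open>auto simp: eval_nat_numeral\<close>)+
  have L2: "L (Arc i s) = set [i, s]" "L (Pos i j s t) = set [i, j, s, t]" "L (Neg i j s t) = set [i, j, s, t]" for i j s t
    unfolding L_def by auto
  have cross: "\<exists>p q. pX v - pX u = p - q \<and> null_total LL MM p \<and> (null_total LL MM q \<or> q = 0)"
    if "null_mf LL MM (pX s + pX t - pX i - pX j)" "null_total LL MM (pX j - pX s)"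
      "(u, v) \<in> {(i, t), (j, s)}" for LL MM i j s t u v
  proof -
    have m: "\<exists>k. homotopy LL MM (- (pX j - pX s)) (fst k) (snd k)"
      if "homotopy LL MM (pX j - pX s) h k" for h k
    proof -
      have "homotopy LL MM (- (pX j - pX s)) (- h) (- k)"
        using that unfolding homotopy_def
        by (simp add: mprod_uminus_left mprod_uminus_right poly_ring_uminus diag_def algebra_simps)
      then show ?thesis by (intro exI[of _ "(- h, - k)"]) simp
    qed
    show ?thesis
    proof (cases "(u, v) = (j, s)")
      case True
      have "null_total LL MM (- (pX j - pX s))" using m that(2) unfolding null_total_def by blast
      then show ?thesis using True by (intro exI[of _ "- (pX j - pX s)"] exI[of _ 0]) simp
    next
      case False
      then have "u = i" "v = t" using that(3) by auto
      moreover have "null_total LL MM (pX s + pX t - pX i - pX j)" using null_mf_total that(1) by blast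
      moreover have "null_total LL MM (- (pX j - pX s))" using m that(2) unfolding null_total_def by blast
      ultimately show ?thesis
        by (intro exI[of _ "pX s + pX t - pX i - pX j"] exI[of _ "- (pX j - pX s)"]) simp
    qed
  qed
  show "mf_complex (L P) (pA * (sumX (tops P) - sumX (bots P))) (M P)"
    using A(1) X(1) unfolding M_def
    by (cases P) (simp_all add: L2 sumX_def crossing_potential_def relabel_simps algebra_simps)
  show "null_mf (L P) (M P) pA"
    using A(2) X(2) unfolding M_def by (cases P) (simp_all add: L2 relabel_simps)
  show "\<exists>p q. pX v - pX u = p - q \<and> null_total (L P) (M P) p \<and> (null_total (L P) (M P) q \<or> q = 0)"
    if uv: "(u, v) \<in> strands P"
  proof (cases P)
    case (Arc i s)
    then have "null_mf (L P) (M P) (pX v - pX u)"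
      using A(3)[of i s] uv unfolding M_def by (simp add: L2 relabel_simps)
    then show ?thesis using null_mf_total by (intro exI[of _ "pX v - pX u"] exI[of _ 0]) simp
  next
    case (Pos i j s t)
    show ?thesis
      by (rule cross[of _ _ s t i j])
        (use uv X(3,4)[of "C0_pos chi1" i j s t] in \<open>simp_all add: M_def Pos L2 relabel_simps\<close>)
  next
    case (Neg i j s t)
    show ?thesis
      by (rule cross[of _ _ s t i j])
        (use uv X(3,4)[of "C0_neg chi0" i j s t] in \<open>simp_all add: M_def Neg L2 relabel_simps\<close>)
  qed
qed

section \<open>Closed braids\<close>

lemma sumX_simps [simp]: "sumX [] = 0" "sumX (u # us) = pX u + sumX us" "sumX (us @ vs) = sumX us + sumX vs"
  unfolding sumX_def by simp_all

lemma sumX_update: "p < length F \<Longrightarrow> sumX (F[p := s]) = sumX F + pX s - pX (F ! p)"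
proof (induction F arbitrary: p)
  case (Cons u F)
  then show ?case by (cases p) (simp_all add: algebra_simps)
qed simp

text \<open>The potentials telescope, because the lower ends of each piece are the marked points
  that are replaced by its upper ends. For a closed braid the sum is therefore zero.\<close>

lemma stacks_potential:
  "stacks F Ps F' \<Longrightarrow>
    (\<Sum>P\<leftarrow>map snd Ps. pA * (sumX (tops P) - sumX (bots P))) = pA * (sumX F' - sumX F)"
proof (induction F Ps F' rule: stacks.induct)
  case (2 F p i s Ps F')
  then show ?case by (simp add: sumX_update algebra_simps)
next
  case (3 F p i j s t Ps F')
  then have "sumX (F[p := s, Suc p := t]) = sumX F + (pX s + pX t) - (pX i + pX j)"
    by (simp add: sumX_update)
  with 3 show ?case by (simp add: algebra_simps)
next
  case (4 F p i j s t Ps F')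
  then have "sumX (F[p := s, Suc p := t]) = sumX F + (pX s + pX t) - (pX i + pX j)"
    by (simp add: sumX_update)
  with 4 show ?case by (simp add: algebra_simps)
qed simp_all

definition all_tops :: "(nat \<times> piece) list \<Rightarrow> nat list"
  where "all_tops Ps = concat (map (tops \<circ> snd) Ps)"

lemma all_tops_simps [simp]: "all_tops [] = []" "all_tops (P # Ps) = tops (snd P) @ all_tops Ps"
  unfolding all_tops_def by simp_all

lemma stacks_top_label:
  "stacks F Ps F' \<Longrightarrow> length F' = length F \<and> (\<forall>p<length F.
    F' ! p \<in> set (all_tops Ps) \<or> (F' ! p = F ! p \<and> (\<forall>P\<in>set Ps. p \<notin> positions P)))"
proof (induction F Ps F' rule: stacks.induct)
  case (2 F p i s Ps F')
  then show ?case by (auto simp: nth_list_update split: if_splits)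
next
  case (3 F p i j s t Ps F')
  then show ?case by (auto simp: nth_list_update split: if_splits)
next
  case (4 F p i j s t Ps F')
  then show ?case by (auto simp: nth_list_update split: if_splits)
qed simp_all

lemma stacks_bots:
  "stacks F Ps F' \<Longrightarrow> P \<in> set Ps \<Longrightarrow> set (bots (snd P)) \<subseteq> set F \<union> set (all_tops Ps)"
proof (induction F Ps F' rule: stacks.induct)
  case (2 F p i s Ps F')
  then show ?case using set_update_subset_insert[of F p s] by fastforce
next
  case (3 F p i j s t Ps F')
  have "set (F[p := s, Suc p := t]) \<subseteq> insert t (insert s (set F))"
    using set_update_subset_insert[of "F[p := s]" "Suc p" t] set_update_subset_insert[of F p s] by blast
  with 3 show ?case by fastforce
next
  case (4 F p i j s t Ps F')
  have "set (F[p := s, Suc p := t]) \<subseteq> insert t (insert s (set F))"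
    using set_update_subset_insert[of "F[p := s]" "Suc p" t] set_update_subset_insert[of F p s] by blast
  with 4 show ?case by fastforce
qed simp_all

lemma marked_closed_braid_labels:
  assumes "marked_closed_braid n F Ps" "P \<in> set Ps"
  shows "set (bots (snd P)) \<union> set (tops (snd P)) \<subseteq> {1..n}"
proof -
  have st: "stacks F Ps F" and cov: "\<forall>p<length F. \<exists>P\<in>set Ps. p \<in> positions P"
    and tops: "set (all_tops Ps) = {1..n}"
    using assms(1) unfolding marked_closed_braid_def all_tops_def by auto
  have "set F \<subseteq> set (all_tops Ps)"
  proof
    fix u assume "u \<in> set F"
    then obtain p where "p < length F" "F ! p = u" by (auto simp: in_set_conv_nth)
    then show "u \<in> set (all_tops Ps)" using stacks_top_label[OF st] cov by blast
  qed
  then have "set (bots (snd P)) \<subseteq> {1..n}" using stacks_bots[OF st assms(2)] tops by blast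
  moreover have "set (tops (snd P)) \<subseteq> set (all_tops Ps)"
    using assms(2) unfolding all_tops_def by auto
  ultimately show ?thesis using tops by blast
qed

lemma C0_Cons: "C0 chi0 chi1 (P # Ps) = tensor (C0_piece chi0 chi1 (snd P)) (C0 chi0 chi1 Ps)"
  unfolding C0_def by simp

lemma mf_complex_unit: "mf_complex L 0 unit_cmf"
  unfolding mf_complex_def unit_cmf_def by (simp add: mprod_def diag_def)

text \<open>The label sets of the pieces have to be enlarged to a common one before tensoring, hence the set \<open>L\<close>.\<close>

theorem C0_properties:
  assumes chi: "chi_maps chi0 chi1"
    and L: "\<And>P. P \<in> set Ps \<Longrightarrow> set (bots (snd P)) \<union> set (tops (snd P)) \<subseteq> L"
  shows "mf_complex L (\<Sum>P\<leftarrow>map snd Ps. pA * (sumX (tops P) - sumX (bots P))) (C0 chi0 chi1 Ps)"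
    and "P \<in> set Ps \<Longrightarrow> null_mf L (C0_piece chi0 chi1 (snd P)) p \<Longrightarrow> null_mf L (C0 chi0 chi1 Ps) p"
    and "P \<in> set Ps \<Longrightarrow> null_total L (C0_piece chi0 chi1 (snd P)) p \<Longrightarrow> null_total L (C0 chi0 chi1 Ps) p"
proof -
  have piece: "mf_complex L (pA * (sumX (tops (snd P)) - sumX (bots (snd P)))) (C0_piece chi0 chi1 (snd P))"
    if "P \<in> set Ps" for P
    using mf_complex_mono[OF piece_properties(1)[OF chi] L[OF that]] .
  have all: "mf_complex L (\<Sum>P\<leftarrow>map snd Qs. pA * (sumX (tops P) - sumX (bots P))) (C0 chi0 chi1 Qs)
    \<and> (\<forall>P\<in>set Qs. \<forall>p. (null_mf L (C0_piece chi0 chi1 (snd P)) p \<longrightarrow> null_mf L (C0 chi0 chi1 Qs) p)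
      \<and> (null_total L (C0_piece chi0 chi1 (snd P)) p \<longrightarrow> null_total L (C0 chi0 chi1 Qs) p))"
    if "set Qs \<subseteq> set Ps" for Qs
    using that
  proof (induction Qs)
    case Nil
    show ?case using mf_complex_unit by (simp add: C0_def)
  next
    case (Cons P Qs)
    then have P: "mf_complex L (pA * (sumX (tops (snd P)) - sumX (bots (snd P)))) (C0_piece chi0 chi1 (snd P))"
      using piece by auto
    have Q: "mf_complex L (\<Sum>P\<leftarrow>map snd Qs. pA * (sumX (tops P) - sumX (bots P))) (C0 chi0 chi1 Qs)"
      using Cons by auto
    have nul: "null_mf L (C0 chi0 chi1 (P # Qs)) p"
      if "X \<in> set (P # Qs)" "null_mf L (C0_piece chi0 chi1 (snd X)) p" for X p
      using that Cons null_tensor_left(1)[OF P Q] null_tensor_right(1)[OF P Q] unfolding C0_Cons by auto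
    have nul': "null_total L (C0 chi0 chi1 (P # Qs)) p"
      if "X \<in> set (P # Qs)" "null_total L (C0_piece chi0 chi1 (snd X)) p" for X p
      using that Cons null_tensor_left(2)[OF P Q] null_tensor_right(2)[OF P Q] unfolding C0_Cons by auto
    show ?case using mf_complex_tensor[OF P Q] nul nul' unfolding C0_Cons by simp
  qed
  from all[OF order_refl]
  show "mf_complex L (\<Sum>P\<leftarrow>map snd Ps. pA * (sumX (tops P) - sumX (bots P))) (C0 chi0 chi1 Ps)"
    and "P \<in> set Ps \<Longrightarrow> null_mf L (C0_piece chi0 chi1 (snd P)) p \<Longrightarrow> null_mf L (C0 chi0 chi1 Ps) p"
    and "P \<in> set Ps \<Longrightarrow> null_total L (C0_piece chi0 chi1 (snd P)) p \<Longrightarrow> null_total L (C0 chi0 chi1 Ps) p"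
    by blast+
qed

lemma knot_connected:
  assumes "num_components n Ps = 1" "u \<in> {1..n}" "v \<in> {1..n}"
  shows "(u, v) \<in> (\<Union>P\<in>set Ps. strands (snd P))\<^sup>*"
proof -
  let ?R = "\<Union>P\<in>set Ps. strands (snd P)"
  have "card ((\<lambda>u. ?R\<^sup>* `` {u}) ` {1..n}) = 1" using assms(1) unfolding num_components_def .
  then obtain S where S: "(\<lambda>u. ?R\<^sup>* `` {u}) ` {1..n} = {S}" by (rule card_1_singletonE)
  have orbit: "?R\<^sup>* `` {w} = S" if "w \<in> {1..n}" for w
    using imageI[OF that, of "\<lambda>u. ?R\<^sup>* `` {u}"] unfolding S by (rule singletonD)
  have "v \<in> ?R\<^sup>* `` {v}" by simp
  then have "v \<in> ?R\<^sup>* `` {u}" unfolding orbit[OF assms(2)] orbit[OF assms(3)] .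
  then show ?thesis by (rule ImageE) simp
qed

section \<open>Graded submodules of free modules\<close>

subsection \<open>Dickson's lemma\<close>

lemma nat_incseq_subseq:
  fixes s :: "nat \<Rightarrow> nat"
  obtains q where "strict_mono q" "incseq (\<lambda>n. s (q n))"
proof -
  obtain q where q: "strict_mono q" "monoseq (\<lambda>n. s (q n))" using seq_monosub by blast
  from q(2) consider "incseq (\<lambda>n. s (q n))" | "decseq (\<lambda>n. s (q n))" unfolding monoseq_iff by blast
  then show thesis
  proof cases
    case 1
    with q(1) show thesis by (rule that)
  next
    case 2
    define m where "m = (LEAST m. \<exists>n. s (q n) = m)"
    have "\<exists>n. s (q n) = m" unfolding m_def by (rule LeastI_ex) blast
    then obtain n0 where n0: "s (q n0) = m" by blast
    have "m \<le> s (q n)" for n unfolding m_def by (rule Least_le) blast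
    then have "s (q (n + n0)) = m" for n using decseqD[OF 2, of n0 "n + n0"] n0 by (simp add: antisym)
    then have "incseq (\<lambda>n. s (q (n + n0)))" by (simp add: incseq_def)
    moreover have "strict_mono (\<lambda>n. q (n + n0))" using q(1) by (simp add: strict_mono_def)
    ultimately show thesis using that by blast
  qed
qed

lemma dickson_subsequence:
  fixes g :: "nat \<Rightarrow> 'v \<Rightarrow> nat"
  assumes "finite V"
  shows "\<exists>r. strict_mono r \<and> (\<forall>v\<in>V. incseq (\<lambda>n. g (r n) v))"
  using assms
proof (induction V rule: finite_induct)
  case empty
  show ?case by (intro exI[of _ id]) (simp add: strict_mono_def)
next
  case (insert x V)
  then obtain r where r: "strict_mono r" "\<forall>v\<in>V. incseq (\<lambda>n. g (r n) v)" by blast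
  obtain q where q: "strict_mono q" "incseq (\<lambda>n. g (r (q n)) x)" by (rule nat_incseq_subseq)
  have mq: "mono q" using q(1) by (rule strict_mono_mono)
  have "incseq (\<lambda>n. g (r (q n)) v)" if "v \<in> insert x V" for v
    using that q(2) r(2) mq unfolding incseq_def mono_def by blast
  moreover have "strict_mono (\<lambda>n. r (q n))" using r(1) q(1) by (simp add: strict_mono_def)
  ultimately show ?case by blast
qed

abbreviation mons :: "var set \<Rightarrow> (var \<Rightarrow>\<^sub>0 nat) set"
  where "mons V \<equiv> {m. Poly_Mapping.keys m \<subseteq> V}"

abbreviation tdeg :: "(var \<Rightarrow>\<^sub>0 nat) \<Rightarrow> int"
  where "tdeg m \<equiv> fst (mdeg m) + snd (mdeg m)"

text \<open>The generators of a monomial ideal have bounded degree. Otherwise there are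
  minimal elements of arbitrarily high degree. In a sequence of such elements one divides a later one
  properly, by the existence of a subsequence that is monotone in all exponents, against minimality.\<close>

lemma dickson:
  assumes V: "finite V" and S: "S \<subseteq> mons V"
    and up: "\<And>m u. m \<in> S \<Longrightarrow> u \<in> mons V \<Longrightarrow> u + m \<in> S"
  shows "\<exists>N. \<forall>m\<in>S. N \<le> tdeg m \<longrightarrow> (\<exists>v\<in>V. \<exists>m'\<in>S. m = unit_mon v + m')"
proof (rule ccontr)
  assume "\<not> ?thesis"
  then have "\<forall>n. \<exists>m. m \<in> S \<and> int n \<le> tdeg m \<and> \<not> (\<exists>v\<in>V. \<exists>m'\<in>S. m = unit_mon v + m')" by blast
  then obtain g where g: "\<And>n. g n \<in> S" "\<And>n. int n \<le> tdeg (g n)"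
      "\<And>n. \<not> (\<exists>v\<in>V. \<exists>m'\<in>S. g n = unit_mon v + m')" by metis
  obtain r where r: "strict_mono r" "\<forall>v\<in>V. incseq (\<lambda>n. Poly_Mapping.lookup (g (r n)) v)"
    using dickson_subsequence[OF V, of "\<lambda>n. Poly_Mapping.lookup (g n)"] by blast
  \<comment> \<open>the degree of \<open>g (r k)\<close> is at least \<open>k\<close>, so this one differs from \<open>g (r 0)\<close>\<close>
  define k where "k = Suc (nat (tdeg (g (r 0))))"
  have "int k \<le> int (r k)" using r(1) by (simp add: strict_mono_imp_increasing)
  with g(2)[of "r k"] have "int k \<le> tdeg (g (r k))" by linarith
  moreover have "tdeg (g (r 0)) < int k" unfolding k_def by linarith
  ultimately have ne: "g (r 0) \<noteq> g (r k)" by fastforce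
  have le: "Poly_Mapping.lookup (g (r 0)) v \<le> Poly_Mapping.lookup (g (r k)) v" if "v \<in> V" for v
    using r(2) that unfolding incseq_def by blast
  have zero: "Poly_Mapping.lookup (g n) v = 0" if "v \<notin> V" for n v
  proof -
    have "v \<notin> Poly_Mapping.keys (g n)" using g(1)[of n] S that by blast
    then show ?thesis by (simp add: in_keys_iff)
  qed
  obtain v where v: "Poly_Mapping.lookup (g (r 0)) v \<noteq> Poly_Mapping.lookup (g (r k)) v"
    using ne by (metis poly_mapping_eqI)
  then have vV: "v \<in> V" using zero by metis
  with le v have lt: "Poly_Mapping.lookup (g (r 0)) v < Poly_Mapping.lookup (g (r k)) v"
    by (simp add: order.not_eq_order_implies_strict)
  define u where "u = g (r k) - unit_mon v - g (r 0)"
  have eq: "g (r k) = unit_mon v + (u + g (r 0))"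
  proof (rule poly_mapping_eqI)
    fix w
    have "Poly_Mapping.lookup (g (r 0)) w \<le> Poly_Mapping.lookup (g (r k)) w"
      using le zero by (metis order_refl)
    then show "Poly_Mapping.lookup (g (r k)) w = Poly_Mapping.lookup (unit_mon v + (u + g (r 0))) w"
      using lt unfolding u_def by (auto simp: lookup_add lookup_minus lookup_single when_def)
  qed
  have "w \<in> V" if "w \<in> Poly_Mapping.keys u" for w
    using that zero[of w "r k"] unfolding u_def by (cases "w \<in> V") (auto simp: in_keys_iff lookup_minus)
  then have "u \<in> mons V" by blast
  then have "u + g (r 0) \<in> S" using up g(1) by blast
  then show False using g(3)[of "r k"] eq vV by blast
qed

lemma finite_mons_deg:
  assumes "finite V" shows "finite {m \<in> mons V. mdeg m = d}"
proof -
  let ?K = "nat (fst d + snd d)"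
  let ?F = "PiE V (\<lambda>_. {..?K})"
  have "{m \<in> mons V. mdeg m = d} \<subseteq> (\<lambda>h. \<Sum>v\<in>V. Poly_Mapping.single v (h v)) ` ?F"
  proof
    fix m assume "m \<in> {m \<in> mons V. mdeg m = d}"
    then have m: "Poly_Mapping.keys m \<subseteq> V" "mdeg m = d" by auto
    define h where "h = restrict (Poly_Mapping.lookup m) V"
    have bound: "Poly_Mapping.lookup m v \<le> ?K" for v
    proof -
      have nn: "0 \<le> deg_a m" "0 \<le> deg_x m" unfolding deg_a_def deg_x_def by (simp_all add: sum_nonneg)
      have "int (Poly_Mapping.lookup m v) \<le> deg_a m + deg_x m"
      proof (cases "v = VarA \<or> v \<notin> Poly_Mapping.keys m")
        case True
        then show ?thesis using nn unfolding deg_a_def by (auto simp: in_keys_iff)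
      next
        case False
        then have "int (Poly_Mapping.lookup m v)
            \<le> (\<Sum>v\<in>Poly_Mapping.keys m - {VarA}. int (Poly_Mapping.lookup m v))"
          by (intro member_le_sum) auto
        then show ?thesis using nn unfolding deg_x_def by linarith
      qed
      then show ?thesis using m(2) unfolding mdeg_def by auto
    qed
    have "m = (\<Sum>v\<in>V. Poly_Mapping.single v (h v))"
    proof (rule poly_mapping_eqI)
      fix w
      show "Poly_Mapping.lookup m w = Poly_Mapping.lookup (\<Sum>v\<in>V. Poly_Mapping.single v (h v)) w"
        using m(1) assms by (auto simp: lookup_sum lookup_single when_def h_def in_keys_iff)
    qed
    moreover have "h \<in> ?F" unfolding h_def using bound by auto
    ultimately show "m \<in> (\<lambda>h. \<Sum>v\<in>V. Poly_Mapping.single v (h v)) ` ?F" by blast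
  qed
  then show ?thesis using finite_PiE[OF assms, of "\<lambda>_. {..?K}"] finite_surj by blast
qed

subsection \<open>A monomial order\<close>

primrec var_code :: "var \<Rightarrow> nat" where
  "var_code VarA = 0"
| "var_code (VarX k) = Suc k"

lemma var_code_inj: "var_code u = var_code v \<Longrightarrow> u = v"
  by (cases u; cases v) auto

text \<open>Any order of the variables gives a lexicographic order of the monomials that is compatible with multiplication.\<close>

instantiation var :: linorder
begin
definition "u \<le> v \<longleftrightarrow> var_code u \<le> var_code v"
definition "u < v \<longleftrightarrow> var_code u < var_code v"
instance
  by standard (auto simp: less_eq_var_def less_var_def dest: var_code_inj)
end

subsection \<open>Graded submodules are generated in bounded degree\<close>

text \<open>\<open>Z e\<close> is the component of degree \<open>e\<close> of a graded submodule of the free module on \<open>G\<close>.\<close>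

locale graded_submodule =
  fixes G :: "gen set" and L :: "nat set" and gdeg :: "gen \<Rightarrow> int \<times> int"
    and Z :: "int \<times> int \<Rightarrow> (gen \<Rightarrow> qpoly) set"
  assumes finG: "finite G" and finL: "finite L"
    and supp: "z \<in> Z e \<Longrightarrow> b \<notin> G \<Longrightarrow> z b = 0"
    and ring: "z \<in> Z e \<Longrightarrow> z b \<in> poly_ring L"
    and homog: "z \<in> Z e \<Longrightarrow> homog (e - gdeg b) (z b)"
    and zero: "(\<lambda>_. 0) \<in> Z e"
    and diff: "z \<in> Z e \<Longrightarrow> z' \<in> Z e \<Longrightarrow> z - z' \<in> Z e"
    and mult: "p \<in> poly_ring L \<Longrightarrow> Defs.homog d p \<Longrightarrow> z \<in> Z e \<Longrightarrow> (\<lambda>b. p * z b) \<in> Z (d + e)"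
begin

definition V where "V = insert VarA (VarX ` L)"

lemma finV: "finite V" unfolding V_def using finL by simp

lemma keys_mons: "z \<in> Z e \<Longrightarrow> m \<in> Poly_Mapping.keys (z b) \<Longrightarrow> m \<in> mons V"
  using ring[of z e b] unfolding poly_ring_def V_def by blast

lemma keys_mdeg: "z \<in> Z e \<Longrightarrow> m \<in> Poly_Mapping.keys (z b) \<Longrightarrow> mdeg m = e - gdeg b"
  using homog[of z e b] unfolding homog_mdeg by blast

lemma add: "z \<in> Z e \<Longrightarrow> z' \<in> Z e \<Longrightarrow> z + z' \<in> Z e"
proof -
  assume z: "z \<in> Z e" "z' \<in> Z e"
  have "z - ((\<lambda>_. 0) - z') \<in> Z e" by (intro diff zero z)
  moreover have "z - ((\<lambda>_. 0) - z') = z + z'" by (rule ext) simp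
  ultimately show ?thesis by simp
qed

definition num :: "gen \<Rightarrow> nat" where "num = (SOME f. inj_on f G)"

lemma num_inj: "inj_on num G"
  unfolding num_def using finite_imp_inj_to_nat_seg[OF finG] by (metis someI)

text \<open>\<open>lead z b m\<close> says that \<open>m\<close>, in the coordinate \<open>b\<close>, is the leading monomial of \<open>z\<close>; ties between
  coordinates are broken by a numbering of \<open>G\<close>.\<close>

definition lead :: "(gen \<Rightarrow> qpoly) \<Rightarrow> gen \<Rightarrow> (var \<Rightarrow>\<^sub>0 nat) \<Rightarrow> bool"
  where "lead z b m \<longleftrightarrow> b \<in> G \<and> m \<in> Poly_Mapping.keys (z b) \<and>
    (\<forall>b'\<in>G. \<forall>m'\<in>Poly_Mapping.keys (z b'). (m', num b') \<le> (m, num b))"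

lemma lead_exists:
  assumes "z \<in> Z e" "z \<noteq> (\<lambda>_. 0)"
  shows "\<exists>b m. lead z b m"
proof -
  let ?P = "(\<lambda>(b, m). (m, num b)) ` (SIGMA b:G. Poly_Mapping.keys (z b))"
  have fin: "finite ?P" using finG by auto
  obtain b where b: "z b \<noteq> 0" using assms(2) by blast
  then have "b \<in> G" using supp[OF assms(1)] by blast
  moreover obtain m where "m \<in> Poly_Mapping.keys (z b)" using b by (metis all_not_in_conv keys_eq_empty)
  ultimately have "?P \<noteq> {}" by blast
  then have "Max ?P \<in> ?P" using fin by (rule Max_in[rotated])
  then obtain b m where bm: "b \<in> G" "m \<in> Poly_Mapping.keys (z b)" "Max ?P = (m, num b)" by auto
  have "(m', num b') \<le> (m, num b)" if "b' \<in> G" "m' \<in> Poly_Mapping.keys (z b')" for b' m'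
    unfolding bm(3)[symmetric] by (rule Max_ge[OF fin]) (use that in force)
  with bm show ?thesis unfolding lead_def by blast
qed

lemma lead_mult:
  assumes "lead z b m"
  shows "lead (\<lambda>b. Poly_Mapping.single u 1 * z b) b (u + m)"
proof -
  have keys: "k \<in> Poly_Mapping.keys (Poly_Mapping.single u 1 * p) \<longleftrightarrow> (\<exists>m\<in>Poly_Mapping.keys p. k = u + m)"
    for k and p :: qpoly
  proof
    assume "k \<in> Poly_Mapping.keys (Poly_Mapping.single u 1 * p)"
    then show "\<exists>m\<in>Poly_Mapping.keys p. k = u + m" by (rule keys_mult_elim) auto
  qed (auto simp: in_keys_iff lookup_single_times)
  have "(m', num b') \<le> (u + m, num b)"
    if "b' \<in> G" "m' \<in> Poly_Mapping.keys (Poly_Mapping.single u 1 * z b')" for b' m'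
  proof -
    obtain k where k: "k \<in> Poly_Mapping.keys (z b')" "m' = u + k" using \<open>m' \<in> _\<close> keys by blast
    then have "(k, num b') \<le> (m, num b)" using assms that(1) unfolding lead_def by blast
    then show ?thesis unfolding k(2) by (auto simp: less_eq_prod_def add_strict_left_mono)
  qed
  then show ?thesis using assms keys unfolding lead_def by blast
qed

definition leads where "leads b = {m. \<exists>e. \<exists>z\<in>Z e. lead z b m}"

lemma leads_up: "m \<in> leads b \<Longrightarrow> u \<in> mons V \<Longrightarrow> u + m \<in> leads b"
proof -
  assume "m \<in> leads b" and u: "u \<in> mons V"
  then obtain e z where z: "z \<in> Z e" "lead z b m" unfolding leads_def by blast
  have "Poly_Mapping.single u 1 \<in> poly_ring L" using u unfolding poly_ring_def V_def by simp
  moreover have "Defs.homog (mdeg u) (Poly_Mapping.single u 1)" unfolding homog_mdeg by simp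
  ultimately have "(\<lambda>b. Poly_Mapping.single u 1 * z b) \<in> Z (mdeg u + e)" using mult z(1) by blast
  then show ?thesis using lead_mult[OF z(2)] unfolding leads_def by blast
qed

text \<open>Being in the span of the products of a variable with elements of the submodule of lower degree.\<close>

definition decomposable where
  "decomposable e z \<longleftrightarrow> (\<exists>w. (\<forall>v\<in>V. w v \<in> Z (e - vdeg v)) \<and> z = (\<lambda>b. \<Sum>v\<in>V. Var v * w v b))"

lemma mult_Const: "z \<in> Z e \<Longrightarrow> (\<lambda>b. Const c * z b) \<in> Z e"
  using mult[of "Const c" "(0, 0)" z e] homog_Const[of c] by (cases e) simp

lemma decomposable_add_multiple:
  assumes "decomposable e z" "v \<in> V" "y \<in> Z (e - vdeg v)"
  shows "decomposable e (\<lambda>b. z b + Var v * y b)"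
proof -
  obtain w where w: "\<forall>v\<in>V. w v \<in> Z (e - vdeg v)" "z = (\<lambda>b. \<Sum>v\<in>V. Var v * w v b)"
    using assms(1) unfolding decomposable_def by blast
  let ?w = "\<lambda>u. if u = v then w v + y else w u"
  have "(\<Sum>u\<in>V. Var u * ?w u b) = (\<Sum>u\<in>V. Var u * w u b + (if u = v then Var v * y b else 0))" for b
    by (rule sum.cong) (auto simp: distrib_left)
  then have "(\<lambda>b. z b + Var v * y b) = (\<lambda>b. \<Sum>u\<in>V. Var u * ?w u b)"
    using assms(2) finV w(2) by (simp add: sum.distrib)
  moreover have "\<forall>u\<in>V. ?w u \<in> Z (e - vdeg u)" using w(1) assms(3) add by auto
  ultimately show ?thesis unfolding decomposable_def by (intro exI[of _ ?w] conjI)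
qed

text \<open>In high degree every leading monomial is divisible by a variable \<open>v\<close> with the quotient still a leading
  monomial, by Dickson's lemma. So the leading term can be cancelled by a multiple of \<open>v\<close>, and an indecomposable element with
  smallest leading monomial cannot exist. In a fixed degree only finitely many monomials occur.\<close>

theorem generated_in_bounded_degree:
  "\<exists>N. \<forall>e z. N \<le> fst e + snd e \<longrightarrow> z \<in> Z e \<longrightarrow> decomposable e z"
proof -
  have "\<exists>N. \<forall>m\<in>leads b. N \<le> tdeg m \<longrightarrow> (\<exists>v\<in>V. \<exists>m'\<in>leads b. m = unit_mon v + m')" for b
  proof (rule dickson[OF finV _ leads_up])
    show "leads b \<subseteq> mons V" unfolding leads_def lead_def using keys_mons by blast
  qed
  then obtain N0 where N0: "\<And>b m. m \<in> leads b \<Longrightarrow> N0 b \<le> tdeg m \<Longrightarrow>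
      \<exists>v\<in>V. \<exists>m'\<in>leads b. m = unit_mon v + m'" by metis
  define N where "N = Max (insert 0 ((\<lambda>b. N0 b + fst (gdeg b) + snd (gdeg b)) ` G))"
  have N: "N0 b + fst (gdeg b) + snd (gdeg b) \<le> N" if "b \<in> G" for b
    unfolding N_def using that finG by (intro Max_ge) auto
  have "decomposable e z" if e: "N \<le> fst e + snd e" and z: "z \<in> Z e" for e z
  proof (rule ccontr)
    assume "\<not> decomposable e z"
    define P where "P = {(m, num b) |m b. \<exists>z\<in>Z e. \<not> decomposable e z \<and> lead z b m}"
    have zero_dec: "decomposable e (\<lambda>_. 0)"
      unfolding decomposable_def using zero by (intro exI[of _ "\<lambda>_ _. 0"]) simp
    have "P \<subseteq> (\<lambda>(b, m). (m, num b)) ` (SIGMA b:G. {m \<in> mons V. mdeg m = e - gdeg b})"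
    proof
      fix x assume "x \<in> P"
      then obtain m b z where x: "x = (m, num b)" and z: "z \<in> Z e" and l: "lead z b m"
        unfolding P_def by blast
      from l have b: "b \<in> G" "m \<in> Poly_Mapping.keys (z b)" unfolding lead_def by blast+
      have "(b, m) \<in> (SIGMA b:G. {m \<in> mons V. mdeg m = e - gdeg b})"
        using b(1) keys_mons[OF z b(2)] keys_mdeg[OF z b(2)] by simp
      then show "x \<in> (\<lambda>(b, m). (m, num b)) ` (SIGMA b:G. {m \<in> mons V. mdeg m = e - gdeg b})"
        unfolding x by (rule rev_image_eqI) simp
    qed
    then have finP: "finite P"
      by (rule finite_subset) (use finG finite_mons_deg[OF finV] in auto)
    have "z \<noteq> (\<lambda>_. 0)" using \<open>\<not> decomposable e z\<close> zero_dec by blast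
    then have "P \<noteq> {}" using lead_exists[OF z] z \<open>\<not> decomposable e z\<close> unfolding P_def by blast
    then have "Min P \<in> P" using finP by (rule Min_in[rotated])
    then obtain m b y where mb: "Min P = (m, num b)" and y: "y \<in> Z e" "\<not> decomposable e y" "lead y b m"
      unfolding P_def by blast
    have bG: "b \<in> G" and mk: "m \<in> Poly_Mapping.keys (y b)" using y(3) unfolding lead_def by blast+
    have md: "mdeg m = e - gdeg b" using keys_mdeg[OF y(1) mk] .
    have "m \<in> leads b" using y unfolding leads_def by blast
    moreover have "N0 b \<le> tdeg m" using N[OF bG] e md by simp
    ultimately obtain v m' where v: "v \<in> V" and m': "m' \<in> leads b" "m = unit_mon v + m'"
      using N0 by blast
    obtain e' y' where y': "y' \<in> Z e'" "lead y' b m'" using m'(1) unfolding leads_def by blast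
    have mk': "m' \<in> Poly_Mapping.keys (y' b)" using y'(2) unfolding lead_def by blast
    have "mdeg m' = e' - gdeg b" using keys_mdeg[OF y'(1) mk'] .
    moreover have "mdeg m = vdeg v + mdeg m'" unfolding m'(2) mdeg_add by simp
    ultimately have e': "e' = e - vdeg v" using md by (simp add: algebra_simps)
    \<comment> \<open>chosen so that the leading terms of \<open>y\<close> and \<open>Var v * x\<close> cancel\<close>
    define c where "c = Poly_Mapping.lookup (y b) m / Poly_Mapping.lookup (y' b) m'"
    define x where "x = (\<lambda>b. Const c * y' b)"
    have xZ: "x \<in> Z (e - vdeg v)" unfolding x_def using mult_Const y'(1) e' by blast
    define r where "r = y - (\<lambda>b. Var v * x b)"
    have Vx: "(\<lambda>b. Var v * x b) \<in> Z e"
    proof -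
      have "Var v \<in> poly_ring L" using v unfolding V_def by auto
      then have "(\<lambda>b. Var v * x b) \<in> Z (vdeg v + (e - vdeg v))" using mult homog_Var xZ by blast
      then show ?thesis by simp
    qed
    have rZ: "r \<in> Z e" unfolding r_def by (rule diff[OF y(1) Vx])
    have nd: "\<not> decomposable e r"
    proof
      assume "decomposable e r"
      then have "decomposable e (\<lambda>b. r b + Var v * x b)" by (rule decomposable_add_multiple[OF _ v xZ])
      moreover have "(\<lambda>b. r b + Var v * x b) = y" unfolding r_def by (rule ext) simp
      ultimately show False using y(2) by simp
    qed
    then have "r \<noteq> (\<lambda>_. 0)" using zero_dec by blast
    then obtain b1 m1 where l1: "lead r b1 m1" using lead_exists[OF rZ] by blast
    then have "(m1, num b1) \<in> P" using rZ nd unfolding P_def by blast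
    \<comment> \<open>the remainder is again indecomposable, so by minimality its leading monomial is not smaller\<close>
    then have ge: "(m, num b) \<le> (m1, num b1)" using mb finP by (metis Min_le)
    have b1: "b1 \<in> G" "m1 \<in> Poly_Mapping.keys (r b1)" using l1 unfolding lead_def by blast+
    have lv: "lead (\<lambda>b. Var v * y' b) b m"
      using lead_mult[OF y'(2), of "unit_mon v"] m'(2) unfolding Var_def by simp
    have rl: "Poly_Mapping.lookup (r b1) m1
        = Poly_Mapping.lookup (y b1) m1 - c * Poly_Mapping.lookup (Var v * y' b1) m1"
      unfolding r_def x_def
      by (simp add: lookup_minus mult.left_commute[of _ "Const c"] lookup_Const_times)
    have "m1 \<in> Poly_Mapping.keys (y b1) \<or> m1 \<in> Poly_Mapping.keys (Var v * y' b1)"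
      using b1(2) rl by (auto simp: in_keys_iff)
    then have "(m1, num b1) \<le> (m, num b)"
      using y(3) lv b1(1) unfolding lead_def by blast
    with ge have "m1 = m" "num b1 = num b" by auto
    then have "m1 = m" "b1 = b" using num_inj b1(1) bG by (auto simp: inj_on_def)
    moreover have "Poly_Mapping.lookup (Var v * y' b) m = Poly_Mapping.lookup (y' b) m'"
      unfolding m'(2) by (rule lookup_Var_times_add)
    ultimately have "Poly_Mapping.lookup (r b1) m1 = 0"
      unfolding rl c_def using mk' by (simp add: in_keys_iff)
    then show False using b1(2) by (simp add: in_keys_iff)
  qed
  then show ?thesis by blast
qed

end

section \<open>Counting generators modulo 2\<close>

text \<open>For a function \<open>f\<close> on the integers, \<open>genct M f\<close> is its convolution with the generating function of
  the generators of \<open>M\<close> by the degree \<open>xdeg - adeg\<close>. In this form tensor products become composition, and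
  \<open>step\<close> is convolution with \<open>1 + t\<close>.\<close>

definition genct :: "cmf \<Rightarrow> (int \<Rightarrow> int) \<Rightarrow> int \<Rightarrow> int"
  where "genct M f c = (\<Sum>b\<in>gens M. f (c - (xdeg M b - adeg M b)))"

definition step :: "(int \<Rightarrow> int) \<Rightarrow> int \<Rightarrow> int"
  where "step f c = f c + f (c - 2)"

definition parity_eq :: "(int \<Rightarrow> int) \<Rightarrow> (int \<Rightarrow> int) \<Rightarrow> bool" (infix "\<approx>" 50)
  where "f \<approx> g \<longleftrightarrow> (\<forall>c. even (f c - g c))"

lemma parity_eq_trans: "f \<approx> g \<Longrightarrow> g \<approx> h \<Longrightarrow> f \<approx> h"
  unfolding parity_eq_def
proof
  fix c assume "\<forall>c. even (f c - g c)" "\<forall>c. even (g c - h c)"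
  then have "even ((f c - g c) + (g c - h c))" by (intro dvd_add) blast+
  then show "even (f c - h c)" by simp
qed

lemma parity_eq_refl: "f \<approx> f" unfolding parity_eq_def by simp

lemma genct_cong: assumes "f \<approx> g" shows "genct M f \<approx> genct M g"
  unfolding parity_eq_def
proof
  fix c
  have "even (\<Sum>b\<in>gens M. f (c - (xdeg M b - adeg M b)) - g (c - (xdeg M b - adeg M b)))"
    by (rule dvd_sum) (use assms in \<open>simp add: parity_eq_def\<close>)
  then show "even (genct M f c - genct M g c)" unfolding genct_def by (simp add: sum_subtractf)
qed

lemma step_cong: assumes "f \<approx> g" shows "step f \<approx> step g"
  unfolding parity_eq_def step_def
proof
  fix c
  have "even ((f c - g c) + (f (c - 2) - g (c - 2)))"
    using assms unfolding parity_eq_def by (intro dvd_add) blast+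
  then show "even (f c + f (c - 2) - (g c + g (c - 2)))" by (simp add: algebra_simps)
qed

lemma step_pow_cong: "f \<approx> g \<Longrightarrow> (step ^^ k) f \<approx> (step ^^ k) g"
  by (induction k) (auto intro: step_cong)

lemma genct_tensor: "genct (tensor M N) f c = genct M (genct N f) c"
  unfolding genct_def sum_gens_tensor by (simp add: algebra_simps)

lemma genct_shift: "genct (shift d M) f c = genct M f (c - (snd d - fst d))"
  unfolding genct_def shift_def by (simp add: algebra_simps)

lemma genct_flip: "genct (flip M) f c = genct M f c"
  unfolding genct_def flip_def by simp

lemma genct_base_change: "genct (base_change r M) f c = genct M f c"
  unfolding genct_def by simp

lemma genct_two_term:
  "finite (gens M) \<Longrightarrow> finite (gens N) \<Longrightarrow> genct (two_term r M g N) f c = genct M f c + genct N f c"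
  unfolding genct_def by (simp add: sum_gens_two_term)

lemma genct_row: "genct (koszul_row a0 a1 d) f c = f c + f (c - (fst d - snd d))"
  unfolding genct_def by simp

lemma genct_unit: "genct unit_cmf f = f"
  unfolding genct_def unit_cmf_def by (intro ext) simp

lemma genct_Gammas:
  "genct C0_Gamma0 f c = f c + 2 * f (c - 2) + f (c - 4)"
  "genct C0_Gamma1 f c = f (c + 1) + f (c - 1) + f (c - 3) + f (c - 5)"
  unfolding C0_Gamma0_def C0_Gamma1_def
  by (simp_all add: genct_shift genct_tensor genct_row)

text \<open>For a crossing the contributions of the two resolutions add up to \<open>(1 + t)\<^sup>2\<close> modulo 2:
  \<open>t\<^sup>-\<^sup>1 (1 + t) (1 + t\<^sup>2) + t\<^sup>-\<^sup>1 (1 + t)\<^sup>2\<close> for a positive and \<open>t (1 + t)\<^sup>2 + (1 + t) (1 + t\<^sup>2)\<close> for a negative one.\<close>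

lemma genct_piece: "genct (C0_piece chi0 chi1 P) f \<approx> (step ^^ length (tops P)) f"
proof -
  have fin: "finite (gens (shift d (flip C0_Gamma0)))" "finite (gens (shift d (flip C0_Gamma1)))" for d
    using mf_complexD(1)[OF mf_complex_shift[OF mf_complex_flip[OF mf_complex_Gamma0]]]
      mf_complexD(1)[OF mf_complex_shift[OF mf_complex_flip[OF mf_complex_Gamma1]]] by auto
  have two: "(step ^^ 2) f c = f c + 2 * f (c - 2) + f (c - 4)" for c
    by (simp add: numeral_2_eq_2 step_def)
  have pos: "genct (C0_pos chi1) f c
      = (f c + 2 * f (c - 2) + f (c - 4)) + 2 * (f (c + 2) + f c)" for c
    unfolding C0_pos_def genct_two_term[OF fin(2,1)] genct_shift genct_flip genct_Gammas
    by (simp add: algebra_simps)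
  have neg: "genct (C0_neg chi0) f c
      = (f c + 2 * f (c - 2) + f (c - 4)) + 2 * (f (c - 4) + f (c - 6))" for c
    unfolding C0_neg_def genct_two_term[OF fin] genct_shift genct_flip genct_Gammas
    by (simp add: algebra_simps)
  show ?thesis
  proof (cases P)
    case (Arc i s)
    then show ?thesis
      by (simp add: parity_eq_def genct_base_change C0_arc_def genct_row step_def)
  next
    case (Pos i j s t)
    then show ?thesis using two
      by (simp add: parity_eq_def genct_base_change pos numeral_2_eq_2)
  next
    case (Neg i j s t)
    then show ?thesis using two
      by (simp add: parity_eq_def genct_base_change neg numeral_2_eq_2)
  qed
qed

lemma genct_C0: "genct (C0 chi0 chi1 Ps) f \<approx> (step ^^ length (all_tops Ps)) f"
proof (induction Ps)
  case Nil
  show ?case by (simp add: C0_def genct_unit parity_eq_refl)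
next
  case (Cons P Ps)
  have "genct (C0 chi0 chi1 (P # Ps)) f = genct (C0_piece chi0 chi1 (snd P)) (genct (C0 chi0 chi1 Ps) f)"
    unfolding C0_Cons by (intro ext genct_tensor)
  then show ?case
    using parity_eq_trans[OF genct_cong[OF Cons] genct_piece] by (simp add: funpow_add)
qed

subsection \<open>Counting monomials\<close>

definition mon_count :: "var set \<Rightarrow> int \<times> int \<Rightarrow> int"
  where "mon_count V d = int (card {m \<in> mons V. mdeg m = d})"

text \<open>Multiplication by \<open>v\<close> is a bijection from all monomials to those that contain \<open>v\<close>.\<close>

lemma mon_count_step:
  assumes "finite V" "v \<in> V"
  shows "mon_count V d = mon_count (V - {v}) d + mon_count V (d - vdeg v)"
proof -
  let ?A = "{m \<in> mons (V - {v}). mdeg m = d}" and ?B = "{m \<in> mons V. mdeg m = d - vdeg v}"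
  have "{m \<in> mons V. mdeg m = d} = ?A \<union> (+) (unit_mon v) ` ?B"
  proof (intro equalityI subsetI)
    fix m assume m: "m \<in> {m \<in> mons V. mdeg m = d}"
    show "m \<in> ?A \<union> (+) (unit_mon v) ` ?B"
    proof (cases "Poly_Mapping.lookup m v = 0")
      case True
      then have "v \<notin> Poly_Mapping.keys m" by (simp add: in_keys_iff)
      then show ?thesis using m by blast
    next
      case False
      have eq: "unit_mon v + (m - unit_mon v) = m"
        by (rule poly_mapping_eqI) (use False in \<open>auto simp: lookup_add lookup_minus lookup_single when_def\<close>)
      have "Poly_Mapping.keys (m - unit_mon v) \<subseteq> V"
        using keys_le_add[of "m - unit_mon v" "unit_mon v"] m unfolding eq by blast
      moreover have "mdeg (m - unit_mon v) = d - vdeg v"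
        using m mdeg_add[of "unit_mon v" "m - unit_mon v"] mdeg_unit[of v] unfolding eq
        by (simp add: algebra_simps)
      ultimately show ?thesis using eq by (metis (mono_tags, lifting) UnI2 image_eqI mem_Collect_eq)
    qed
  next
    fix m assume "m \<in> ?A \<union> (+) (unit_mon v) ` ?B"
    then show "m \<in> {m \<in> mons V. mdeg m = d}"
    proof
      assume "m \<in> (+) (unit_mon v) ` ?B"
      then obtain l where l: "m = unit_mon v + l" "Poly_Mapping.keys l \<subseteq> V" "mdeg l = d - vdeg v" by blast
      have "Poly_Mapping.keys m \<subseteq> V" unfolding l(1)
        using Poly_Mapping.keys_add[of "unit_mon v" l] l(2) assms(2) by auto
      then show ?thesis using l by (simp add: mdeg_add)
    qed blast
  qed
  moreover have "?A \<inter> (+) (unit_mon v) ` ?B = {}"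
  proof -
    have "v \<in> Poly_Mapping.keys (unit_mon v + l)" for l
      by (simp add: in_keys_iff lookup_add)
    then show ?thesis by blast
  qed
  moreover have "card ((+) (unit_mon v) ` ?B) = card ?B"
    by (rule card_image) (auto simp: inj_on_def)
  moreover have "finite ?A" "finite ?B" using finite_mons_deg assms(1) by auto
  ultimately show ?thesis unfolding mon_count_def by (simp add: card_Un_disjoint)
qed

lemma mon_count_no_a:
  assumes "VarA \<notin> V" "p \<noteq> 0" shows "mon_count V (p, q) = 0"
proof -
  have "mdeg m \<noteq> (p, q)" if "Poly_Mapping.keys m \<subseteq> V" for m
  proof -
    have "VarA \<notin> Poly_Mapping.keys m" using that assms(1) by blast
    then show ?thesis using assms(2) unfolding mdeg_def deg_a_def by (simp add: in_keys_iff)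
  qed
  then have "{m \<in> mons V. mdeg m = (p, q)} = {}" by blast
  then show ?thesis unfolding mon_count_def by (simp only: card.empty of_nat_0)
qed

definition xcount :: "nat \<Rightarrow> int \<Rightarrow> int"
  where "xcount k q = mon_count (VarX ` {1..k}) (0, q)"

lemma xcount_0: "xcount 0 q = (if q = 0 then 1 else 0)"
proof -
  have "{m \<in> mons {}. mdeg m = (0, q)} = (if q = 0 then {0} else {})"
    by (auto simp: mdeg_0)
  then show ?thesis unfolding xcount_def mon_count_def by simp
qed

lemma xcount_Suc: "xcount (Suc k) q = xcount k q + xcount (Suc k) (q - 2)"
proof -
  have "VarX ` {1..Suc k} - {VarX (Suc k)} = VarX ` {1..k}" by auto
  then show ?thesis
    using mon_count_step[of "VarX ` {1..Suc k}" "VarX (Suc k)" "(0, q)"]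
    unfolding xcount_def vdeg_def by simp
qed

text \<open>The number of monomials of given degree in \<open>k\<close> variables has generating function \<open>(1 - t)\<^sup>-\<^sup>k\<close>.\<close>

lemma step_pow_xcount: "(step ^^ k) (xcount k) \<approx> xcount 0"
proof (induction k)
  case (Suc k)
  have "step (xcount (Suc k)) \<approx> xcount k"
    unfolding parity_eq_def step_def
  proof
    fix c
    have "xcount (Suc k) c + xcount (Suc k) (c - 2) - xcount k c = 2 * xcount (Suc k) (c - 2)"
      using xcount_Suc[of k c] by simp
    then show "even (xcount (Suc k) c + xcount (Suc k) (c - 2) - xcount k c)"
      by (simp only: dvd_triv_left)
  qed
  then have "(step ^^ k) (step (xcount (Suc k))) \<approx> (step ^^ k) (xcount k)" by (rule step_pow_cong)
  then show ?case using parity_eq_trans[OF _ Suc] by (simp only: funpow_Suc_right comp_apply)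
qed (simp add: parity_eq_refl)

theorem genct_parity:
  assumes "marked_closed_braid n F Ps"
  shows "odd (genct (C0 chi0 chi1 Ps) (xcount n) c) \<longleftrightarrow> c = 0"
proof -
  have "distinct (all_tops Ps)" "set (all_tops Ps) = {1..n}"
    using assms unfolding marked_closed_braid_def all_tops_def by auto
  then have "length (all_tops Ps) = n" using distinct_card by force
  then have "genct (C0 chi0 chi1 Ps) (xcount n) \<approx> xcount 0"
    using parity_eq_trans[OF genct_C0[of chi0 chi1 Ps] step_pow_xcount[of "length (all_tops Ps)"]] by simp
  then have "even (genct (C0 chi0 chi1 Ps) (xcount n) c - (if c = 0 then 1 else 0))"
    unfolding parity_eq_def xcount_0 by blast
  then show ?thesis by (simp split: if_splits)
qed

section \<open>Graded pieces of the complex\<close>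

abbreviation qscale :: "rat \<Rightarrow> (gen \<Rightarrow> qpoly) \<Rightarrow> gen \<Rightarrow> qpoly"
  where "qscale q v \<equiv> \<lambda>b. Const q * v b"

interpretation Q: rational_space qscale
  by unfold_locales (auto simp: fun_eq_iff algebra_simps Const_add Const_mult)

abbreviation pmult :: "qpoly \<Rightarrow> (gen \<Rightarrow> qpoly) \<Rightarrow> gen \<Rightarrow> qpoly"
  where "pmult p v \<equiv> \<lambda>b. p * v b"

lemma Q_linearI:
  assumes "\<And>u v. f (u + v) = f u + f v" "\<And>q v. f (qscale q v) = qscale q (f v)"
  shows "Vector_Spaces.linear qscale qscale f"
  by unfold_locales (use assms in auto)

lemma linear_pmult: "Vector_Spaces.linear qscale qscale (pmult p)"
  by (rule Q_linearI) (auto simp: algebra_simps)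

lemma apply_mat_add: "apply_mat M f (u + v) = apply_mat M f u + apply_mat M f v"
  unfolding apply_mat_def by (intro ext) (simp add: distrib_left sum.distrib)

lemma apply_mat_pmult: "apply_mat M f (pmult p v) = pmult p (apply_mat M f v)"
  unfolding apply_mat_def by (intro ext) (simp add: sum_distrib_left mult_ac)

lemma linear_apply_mat: "Vector_Spaces.linear qscale qscale (apply_mat M f)"
  by (rule Q_linearI) (simp_all add: apply_mat_add apply_mat_pmult)

lemma apply_mat_0 [simp]: "apply_mat M f (\<lambda>_. 0) = (\<lambda>_. 0)"
  unfolding apply_mat_def by auto

lemma apply_mat_0_fun [simp]: "apply_mat M f 0 = 0"
  unfolding apply_mat_def by (intro ext) simp

lemma apply_mat_uminus: "apply_mat M f (- v) = - apply_mat M f v"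
  unfolding apply_mat_def by (intro ext) (simp add: sum_negf)

lemma apply_mat_apply_mat: "apply_mat M f (apply_mat M g v) = apply_mat M (mprod (gens M) f g) v"
  unfolding apply_mat_def mprod_def
proof (intro ext)
  fix c
  have "(\<Sum>e\<in>gens M. f c e * (\<Sum>b\<in>gens M. g e b * v b))
      = (\<Sum>b\<in>gens M. (\<Sum>e\<in>gens M. f c e * g e b) * v b)"
    unfolding sum_distrib_left sum_distrib_right by (subst sum.swap) (simp add: mult_ac)
  moreover have "(\<Sum>e\<in>gens M. f c e * (if e \<in> gens M then \<Sum>b\<in>gens M. g e b * v b else 0))
      = (\<Sum>e\<in>gens M. f c e * (\<Sum>b\<in>gens M. g e b * v b))"
    by (rule sum.cong) auto
  ultimately show "(if c \<in> gens M then \<Sum>e\<in>gens M. f c e * (if e \<in> gens M then \<Sum>b\<in>gens M. g e b * v b else 0) else 0)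
    = (if c \<in> gens M then \<Sum>b\<in>gens M. (\<Sum>e\<in>gens M. f c e * g e b) * v b else 0)" by simp
qed

lemma apply_mat_cong:
  "(\<And>b c. b \<in> gens M \<Longrightarrow> c \<in> gens M \<Longrightarrow> f c b = g c b) \<Longrightarrow> apply_mat M f v = apply_mat M g v"
  unfolding apply_mat_def by (intro ext) simp

lemma apply_mat_sum_mat: "apply_mat M (f + g) v = apply_mat M f v + apply_mat M g v"
  unfolding apply_mat_def by (intro ext) (simp add: distrib_right sum.distrib)

lemma sum_fun_apply: "(\<Sum>i\<in>A. f i) x = (\<Sum>i\<in>A. f i x)" for f :: "'i \<Rightarrow> 'x \<Rightarrow> 'y::comm_monoid_add"
  by (induction A rule: infinite_finite_induct) simp_all

definition vecs :: "nat set \<Rightarrow> cmf \<Rightarrow> (gen \<Rightarrow> qpoly) set"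
  where "vecs L M = {v. (\<forall>b\<in>gens M. v b \<in> poly_ring L) \<and> (\<forall>b. b \<notin> gens M \<longrightarrow> v b = 0)}"

lemma carrier_total_space: "carrier (total_space L M) = vecs L M"
  unfolding total_space_def vecs_def by simp

lemma subspace_vecs: "Q.subspace (vecs L M)"
  unfolding Q.subspace_def vecs_def by (auto intro: poly_ring_add poly_ring_mult)

lemma apply_mat_vecs:
  assumes "\<And>b c. b \<in> gens M \<Longrightarrow> c \<in> gens M \<Longrightarrow> f c b \<in> poly_ring L" "v \<in> vecs L M"
  shows "apply_mat M f v \<in> vecs L M"
  using assms unfolding vecs_def apply_mat_def by (auto intro!: poly_ring_sum poly_ring_mult)

lemma pmult_vecs: "p \<in> poly_ring L \<Longrightarrow> v \<in> vecs L M \<Longrightarrow> pmult p v \<in> vecs L M"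
  unfolding vecs_def by (auto intro: poly_ring_mult)

lemma apply_mat_diag:
  assumes "finite (gens M)" "v \<in> vecs L M"
  shows "apply_mat M (diag (\<lambda>_. p)) v = pmult p v"
  using assms unfolding apply_mat_def diag_def vecs_def
  by (auto simp: if_distrib[of "\<lambda>x. x * _"] cong: if_cong)

subsection \<open>Homogeneous components\<close>

lemma component_iff: "v \<in> component L M i j k \<longleftrightarrow> v \<in> vecs L M \<and>
    (\<forall>b\<in>gens M. (hdeg M b \<noteq> i \<longrightarrow> v b = 0) \<and> homog (j - adeg M b, k - xdeg M b) (v b))"
  unfolding component_def carrier_total_space by simp

definition proj :: "cmf \<Rightarrow> int \<Rightarrow> int \<Rightarrow> int \<Rightarrow> (gen \<Rightarrow> qpoly) \<Rightarrow> gen \<Rightarrow> qpoly"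
  where "proj M i j k v = (\<lambda>b. if b \<in> gens M \<and> hdeg M b = i then hpart (j - adeg M b, k - xdeg M b) (v b) else 0)"

lemma proj_component: "v \<in> vecs L M \<Longrightarrow> proj M i j k v \<in> component L M i j k"
  unfolding component_iff vecs_def proj_def by (auto intro: poly_ring_hpart homog_hpart)

lemma proj_id: "v \<in> component L M i j k \<Longrightarrow> proj M i j k v = v"
  unfolding component_iff vecs_def proj_def by (intro ext) (auto intro: hpart_homog)

lemma proj_add: "proj M i j k (u + v) = proj M i j k u + proj M i j k v"
  unfolding proj_def by (intro ext) (simp add: hpart_add)

definition homog_mat :: "cmf \<Rightarrow> int \<Rightarrow> int \<Rightarrow> int \<Rightarrow> mat \<Rightarrow> bool" where
  "homog_mat M t da dx f \<longleftrightarrow> (\<forall>b\<in>gens M. \<forall>c\<in>gens M.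
    homog (adeg M b + da - adeg M c, xdeg M b + dx - xdeg M c) (f c b) \<and>
    (f c b \<noteq> 0 \<longrightarrow> hdeg M c = hdeg M b + t))"

text \<open>Since the homogeneous components of a vector can be taken before or after applying a homogeneous matrix, a
  homogeneous boundary bounds a homogeneous vector.\<close>

lemma proj_apply_mat:
  assumes f: "homog_mat M t da dx f"
  shows "proj M (i + t) (j + da) (k + dx) (apply_mat M f v) = apply_mat M f (proj M i j k v)"
proof (intro ext)
  fix c
  show "proj M (i + t) (j + da) (k + dx) (apply_mat M f v) c = apply_mat M f (proj M i j k v) c"
  proof (cases "c \<in> gens M")
    case False
    then show ?thesis unfolding proj_def apply_mat_def by simp
  next
    case c: True
    have fz: "f c b = 0" if "b \<in> gens M" "hdeg M c \<noteq> hdeg M b + t" for b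
      using f c that unfolding homog_mat_def by blast
    show ?thesis
    proof (cases "hdeg M c = i + t")
      case False
      have "f c b * proj M i j k v b = 0" if "b \<in> gens M" for b
        using fz[OF that] False unfolding proj_def by (cases "hdeg M b = i") auto
      then show ?thesis using False c unfolding apply_mat_def by (simp add: proj_def[of M "i + t"])
    next
      case hc: True
      have "hpart (j + da - adeg M c, k + dx - xdeg M c) (f c b * v b) = f c b * proj M i j k v b"
        if b: "b \<in> gens M" for b
      proof (cases "hdeg M b = i")
        case True
        let ?e = "(adeg M b + da - adeg M c, xdeg M b + dx - xdeg M c)"
        have eq: "(j + da - adeg M c, k + dx - xdeg M c) = ?e + (j - adeg M b, k - xdeg M b)" by simp
        have "homog ?e (f c b)" using f b c unfolding homog_mat_def by blast
        then have "hpart (?e + (j - adeg M b, k - xdeg M b)) (f c b * v b)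
            = f c b * hpart (j - adeg M b, k - xdeg M b) (v b)" by (rule hpart_mult)
        then show ?thesis unfolding eq proj_def using True b by simp
      next
        case False
        then show ?thesis using fz[OF b] hc unfolding proj_def by simp
      qed
      then have "(\<Sum>b\<in>gens M. hpart (j + da - adeg M c, k + dx - xdeg M c) (f c b * v b))
          = (\<Sum>b\<in>gens M. f c b * proj M i j k v b)" by (rule sum.cong[OF refl])
      then show ?thesis using c hc unfolding apply_mat_def
        by (simp add: proj_def[of M "i + t"] hpart_sum)
    qed
  qed
qed

lemma apply_mat_component:
  assumes "homog_mat M t da dx f" "\<And>b c. b \<in> gens M \<Longrightarrow> c \<in> gens M \<Longrightarrow> f c b \<in> poly_ring L"
    "v \<in> component L M i j k"
  shows "apply_mat M f v \<in> component L M (i + t) (j + da) (k + dx)"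
proof -
  have "apply_mat M f v \<in> vecs L M" using apply_mat_vecs assms(2,3) unfolding component_iff by blast
  then have "proj M (i + t) (j + da) (k + dx) (apply_mat M f v) \<in> component L M (i + t) (j + da) (k + dx)"
    by (rule proj_component)
  then show ?thesis unfolding proj_apply_mat[OF assms(1)] proj_id[OF assms(3)] .
qed

lemma pmult_component:
  assumes "p \<in> poly_ring L" "homog (da, dx) p" "v \<in> component L M i j k"
  shows "pmult p v \<in> component L M i (j + da) (k + dx)"
proof -
  have "homog (j + da - adeg M b, k + dx - xdeg M b) (p * v b)" if "b \<in> gens M" for b
    using homog_mult'[OF assms(2), of "j - adeg M b" "k - xdeg M b" "v b"
        "j + da - adeg M b" "k + dx - xdeg M b"] assms(3) that
    unfolding component_iff by simp
  then show ?thesis using assms(3) pmult_vecs[OF assms(1)] unfolding component_iff by auto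
qed

definition vars :: "nat set \<Rightarrow> var set" where "vars L = insert VarA (VarX ` L)"

definition positions_of :: "nat set \<Rightarrow> cmf \<Rightarrow> int \<Rightarrow> int \<Rightarrow> int \<Rightarrow> (gen \<times> (var \<Rightarrow>\<^sub>0 nat)) set"
  where "positions_of L M i j k = (SIGMA b:{b \<in> gens M. hdeg M b = i}.
    {m \<in> mons (vars L). mdeg m = (j - adeg M b, k - xdeg M b)})"

definition basis_vec :: "gen \<Rightarrow> (var \<Rightarrow>\<^sub>0 nat) \<Rightarrow> gen \<Rightarrow> qpoly"
  where "basis_vec b m = (\<lambda>b'. if b' = b then Poly_Mapping.single m 1 else 0)"

text \<open>The products of a monomial and a generator form a basis.\<close>

lemma component_basis:
  assumes fin: "finite (gens M)" "finite L"
  shows "Q.dim (component L M i j k)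
      = (\<Sum>b\<in>{b \<in> gens M. hdeg M b = i}. card {m \<in> mons (vars L). mdeg m = (j - adeg M b, k - xdeg M b)})"
    and "Q.finite_span (component L M i j k)"
    and "Q.subspace (component L M i j k)"
proof -
  let ?C = "component L M i j k" and ?P = "positions_of L M i j k"
  have finV: "finite (vars L)" using fin unfolding vars_def by simp
  have finP: "finite ?P" unfolding positions_of_def using fin(1) finite_mons_deg[OF finV] by auto
  let ?e = "\<lambda>(b, m). basis_vec b m"
  have lk: "Poly_Mapping.lookup (basis_vec b m b') m' = (if b' = b \<and> m' = m then 1 else 0)" for b m b' m'
    unfolding basis_vec_def by (simp add: lookup_single when_def)
  have inj: "inj_on ?e ?P"
  proof (rule inj_onI)
    fix x y assume "?e x = ?e y"
    then have "Poly_Mapping.lookup (basis_vec (fst x) (snd x) (fst x)) (snd x)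
        = Poly_Mapping.lookup (basis_vec (fst y) (snd y) (fst x)) (snd x)"
      by (simp add: case_prod_unfold)
    then show "x = y" unfolding lk by (auto simp: prod_eq_iff split: if_splits)
  qed
  show sub: "Q.subspace ?C"
    unfolding Q.subspace_def
    by (auto simp: component_iff vecs_def intro: poly_ring_add poly_ring_mult homog_add homog_Const_mult)
  have BC: "?e ` ?P \<subseteq> ?C"
    unfolding positions_of_def
    by (auto simp: component_iff vecs_def basis_vec_def poly_ring_def vars_def homog_mdeg split: if_splits)
  have span: "?C \<subseteq> Q.span (?e ` ?P)"
  proof
    fix v assume v: "v \<in> ?C"
    have key: "(b, m) \<in> ?P" if "Poly_Mapping.lookup (v b) m \<noteq> 0" for b m
    proof -
      have bm: "m \<in> Poly_Mapping.keys (v b)" using that by (simp add: in_keys_iff)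
      then have b: "b \<in> gens M" "hdeg M b = i" using v unfolding component_iff vecs_def by auto
      then have "v b \<in> poly_ring L" "homog (j - adeg M b, k - xdeg M b) (v b)"
        using v unfolding component_iff vecs_def by blast+
      then show ?thesis using bm b unfolding positions_of_def poly_ring_def vars_def homog_mdeg by blast
    qed
    have "v = (\<Sum>x\<in>?P. qscale (Poly_Mapping.lookup (v (fst x)) (snd x)) (?e x))"
    proof (rule ext, rule poly_mapping_eqI)
      fix b m
      have "Poly_Mapping.lookup ((\<Sum>x\<in>?P. qscale (Poly_Mapping.lookup (v (fst x)) (snd x)) (?e x)) b) m
          = (\<Sum>x\<in>?P. if x = (b, m) then Poly_Mapping.lookup (v b) m else 0)"
        by (simp add: sum_fun_apply lookup_sum lookup_Const_times case_prod_unfold lk)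
          (rule sum.cong, auto)
      also have "\<dots> = Poly_Mapping.lookup (v b) m" using finP key by auto
      finally show "Poly_Mapping.lookup (v b) m
          = Poly_Mapping.lookup ((\<Sum>x\<in>?P. qscale (Poly_Mapping.lookup (v (fst x)) (snd x)) (?e x)) b) m" ..
    qed
    also have "\<dots> \<in> Q.span (?e ` ?P)"
      by (intro Q.span_sum Q.span_scale Q.span_base) auto
    finally show "v \<in> Q.span (?e ` ?P)" .
  qed
  have ind: "Q.independent (?e ` ?P)"
  proof (rule Q.independent_if_scalars_zero)
    show "finite (?e ` ?P)" using finP by simp
    fix f x assume z: "(\<Sum>x\<in>?e ` ?P. qscale (f x) x) = 0" and "x \<in> ?e ` ?P"
    then obtain b m where bm: "(b, m) \<in> ?P" "x = basis_vec b m" by auto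
    have "0 = Poly_Mapping.lookup ((\<Sum>x\<in>?e ` ?P. qscale (f x) x) b) m" unfolding z by simp
    also have "\<dots> = (\<Sum>y\<in>?e ` ?P. f y * Poly_Mapping.lookup (y b) m)"
      by (simp add: sum_fun_apply lookup_sum lookup_Const_times)
    also have "\<dots> = (\<Sum>y\<in>?P. f (?e y) * Poly_Mapping.lookup (?e y b) m)"
      by (simp only: sum.reindex[OF inj] comp_def)
    also have "\<dots> = (\<Sum>y\<in>?P. if y = (b, m) then f x else 0)"
      by (rule sum.cong) (auto simp: case_prod_unfold lk bm(2))
    also have "\<dots> = f x" using finP bm(1) by simp
    finally show "f x = 0" by simp
  qed
  show "Q.finite_span ?C" unfolding Q.finite_span_def using finP span by blast
  have "Q.dim ?C = card (?e ` ?P)" by (rule Q.dim_unique[OF BC span ind refl])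
  also have "\<dots> = card ?P" by (rule card_image[OF inj])
  also have "\<dots> = (\<Sum>b\<in>{b \<in> gens M. hdeg M b = i}. card {m \<in> mons (vars L). mdeg m = (j - adeg M b, k - xdeg M b)})"
    unfolding positions_of_def by (rule card_SigmaI) (use fin(1) finite_mons_deg[OF finV] in auto)
  finally show "Q.dim ?C
      = (\<Sum>b\<in>{b \<in> gens M. hdeg M b = i}. card {m \<in> mons (vars L). mdeg m = (j - adeg M b, k - xdeg M b)})" .
qed

section \<open>The complex of a knot\<close>

text \<open>What is used about the complex of a knot; \<open>R\<close> is the relation that goes along the strands.\<close>

locale knot_complex =
  fixes n :: nat and M :: cmf and R :: "(nat \<times> nat) set"
  assumes mf: "mf_complex {1..n} 0 M" and n_pos: "1 \<le> n" and gens_ne: "gens M \<noteq> {}"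
    and a_null: "null_mf {1..n} M pA"
    and x_null: "(u, v) \<in> R \<Longrightarrow> \<exists>p q. pX v - pX u = p - q \<and> null_total {1..n} M p \<and>
      (null_total {1..n} M q \<or> q = 0)"
    and connected: "u \<in> {1..n} \<Longrightarrow> v \<in> {1..n} \<Longrightarrow> (u, v) \<in> R\<^sup>*"
    and count_gens: "odd (genct M (xcount n) c) \<longleftrightarrow> c = 0"
begin

abbreviation L where "L \<equiv> {1..n}"
abbreviation d where "d \<equiv> apply_mat M (dmf M)"
abbreviation s where "s \<equiv> apply_mat M (dchi M)"
abbreviation V where "V \<equiv> vecs L M"
abbreviation C where "C \<equiv> component L M"

lemma fin: "finite (gens M)" by (rule mf_complexD(1)[OF mf])

lemma d_V: "v \<in> V \<Longrightarrow> d v \<in> V" and s_V: "v \<in> V \<Longrightarrow> s v \<in> V"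
  by (rule apply_mat_vecs; use mf_complexD(2,3)[OF mf] in blast)+

lemma dd: "d (d v) = 0"
proof -
  have "d (d v) = apply_mat M (\<lambda>_ _. 0) v"
    unfolding apply_mat_apply_mat
    by (rule apply_mat_cong) (simp add: mf_complexD(10)[OF mf] diag_def)
  then show ?thesis by (simp add: apply_mat_def fun_eq_iff)
qed

lemma ss: "s (s v) = 0"
proof -
  have "s (s v) = apply_mat M (\<lambda>_ _. 0) v"
    unfolding apply_mat_apply_mat
    by (rule apply_mat_cong) (simp add: mf_complexD(11)[OF mf])
  then show ?thesis by (simp add: apply_mat_def fun_eq_iff)
qed

lemma ds: "d (s v) = s (d v)"
  unfolding apply_mat_apply_mat by (rule apply_mat_cong) (rule mf_complexD(12)[OF mf])

lemma homog_dmf: "homog_mat M 0 1 1 (dmf M)"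
  unfolding homog_mat_def using mf_complexD(4,6)[OF mf] by auto

lemma homog_dchi: "homog_mat M 1 0 0 (dchi M)"
  unfolding homog_mat_def using mf_complexD(5,8)[OF mf] by auto

lemma d_C: "z \<in> C i j k \<Longrightarrow> d z \<in> C i (j + 1) (k + 1)"
  using apply_mat_component[OF homog_dmf, of L z i j k] mf_complexD(2)[OF mf] by simp

lemma s_C: "z \<in> C i j k \<Longrightarrow> s z \<in> C (i + 1) j k"
  using apply_mat_component[OF homog_dchi, of L z i j k] mf_complexD(3)[OF mf] by simp

lemma proj_d: "proj M i (j + 1) (k + 1) (d v) = d (proj M i j k v)"
  using proj_apply_mat[OF homog_dmf, of i j k v] by simp

lemma proj_s: "proj M (i + 1) j k (s v) = s (proj M i j k v)"
  using proj_apply_mat[OF homog_dchi, of i j k v] by simp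

lemma C_V: "z \<in> C i j k \<Longrightarrow> z \<in> V" unfolding component_iff by blast

subsection \<open>Null-homotopic multiplications\<close>

lemma homotopy_action:
  assumes H: "homotopy L M p h k" and z: "z \<in> V" "d z = 0"
  shows "apply_mat M h z \<in> V" "apply_mat M k z \<in> V" "d (apply_mat M k z) = 0"
    "pmult p z = s (apply_mat M k z) + apply_mat M k (s z) - d (apply_mat M h z)"
proof -
  note D = homotopyD[OF H]
  show "apply_mat M h z \<in> V" "apply_mat M k z \<in> V"
    by (rule apply_mat_vecs[OF _ z(1)]; use D(1,2) in blast)+
  have "d (apply_mat M k z) = apply_mat M k (d z)"
    unfolding apply_mat_apply_mat by (rule apply_mat_cong) (rule D(6))
  then show "d (apply_mat M k z) = 0" using z(2) by simp
  have "s (apply_mat M k z) + apply_mat M k (s z)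
      = apply_mat M (mprod (gens M) (dchi M) k + mprod (gens M) k (dchi M)) z"
    unfolding apply_mat_apply_mat apply_mat_sum_mat ..
  also have "\<dots> = apply_mat M (diag (\<lambda>_. p) + mprod (gens M) (dmf M) h + mprod (gens M) h (dmf M)) z"
    by (rule apply_mat_cong) (simp add: D(7))
  also have "\<dots> = pmult p z + d (apply_mat M h z) + apply_mat M h (d z)"
    unfolding apply_mat_apply_mat apply_mat_sum_mat apply_mat_diag[OF fin z(1)] ..
  finally have "s (apply_mat M k z) + apply_mat M k (s z) = pmult p z + d (apply_mat M h z)"
    using z(2) by simp
  then show "pmult p z = s (apply_mat M k z) + apply_mat M k (s z) - d (apply_mat M h z)"
    by (simp add: algebra_simps)
qed

definition cycles where "cycles = {z \<in> V. d z = 0 \<and> (\<exists>u\<in>V. s z = d u)}"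
definition boundaries where "boundaries = {s w + d u |w u. w \<in> V \<and> d w = 0 \<and> u \<in> V}"

definition acts_trivially where "acts_trivially p \<longleftrightarrow> (\<forall>z\<in>cycles. pmult p z \<in> boundaries)"

lemma boundaries_diff: "x \<in> boundaries \<Longrightarrow> y \<in> boundaries \<Longrightarrow> x - y \<in> boundaries"
proof -
  assume "x \<in> boundaries" "y \<in> boundaries"
  then obtain w u w' u' where x: "x = s w + d u" "w \<in> V" "d w = 0" "u \<in> V"
    and y: "y = s w' + d u'" "w' \<in> V" "d w' = 0" "u' \<in> V" unfolding boundaries_def by blast
  have neg: "apply_mat M f (a - b) = apply_mat M f a - apply_mat M f b" for f a b
    using apply_mat_add[of M f a "- b"] by (simp add: apply_mat_uminus)
  have "x - y = s (w - w') + d (u - u')" unfolding x(1) y(1) neg by simp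
  moreover have "w - w' \<in> V" "u - u' \<in> V" using Q.subspace_diff[OF subspace_vecs] x y by blast+
  moreover have "d (w - w') = 0" unfolding neg using x(3) y(3) by simp
  ultimately show "x - y \<in> boundaries" unfolding boundaries_def by blast
qed

lemma boundaries_0: "0 \<in> boundaries"
  unfolding boundaries_def using Q.subspace_0[OF subspace_vecs]
  by (intro CollectI exI[of _ 0]) simp

lemma boundaries_add: "x \<in> boundaries \<Longrightarrow> y \<in> boundaries \<Longrightarrow> x + y \<in> boundaries"
  using boundaries_diff[of x "0 - y"] boundaries_diff[OF boundaries_0, of y] by simp

lemma null_total_trivial: "null_total L M p \<Longrightarrow> acts_trivially p"
proof -
  assume "null_total L M p"
  then obtain h k where H: "homotopy L M p h k" unfolding null_total_def by blast
  show "acts_trivially p" unfolding acts_trivially_def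
  proof
    fix z assume "z \<in> cycles"
    then obtain u where z: "z \<in> V" "d z = 0" and u: "u \<in> V" "s z = d u" unfolding cycles_def by blast
    note A = homotopy_action[OF H z]
    have "apply_mat M k (s z) = d (apply_mat M k u)"
      unfolding u(2) apply_mat_apply_mat by (rule apply_mat_cong) (rule homotopyD(6)[OF H, symmetric])
    then have "pmult p z = s (apply_mat M k z) + d (apply_mat M k u - apply_mat M h z)"
      using A(4) apply_mat_add[of M "dmf M" "apply_mat M k u" "- apply_mat M h z"]
      by (simp add: apply_mat_uminus)
    moreover have "apply_mat M k u \<in> V"
      by (rule apply_mat_vecs[OF _ u(1)]) (use homotopyD(2)[OF H] in blast)
    then have "apply_mat M k u - apply_mat M h z \<in> V"
      using Q.subspace_diff[OF subspace_vecs] A(1) by blast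
    ultimately show "pmult p z \<in> boundaries" unfolding boundaries_def using A(2,3) by blast
  qed
qed

lemma acts_trivially_diff: "acts_trivially p \<Longrightarrow> acts_trivially q \<Longrightarrow> acts_trivially (p - q)"
proof -
  assume "acts_trivially p" "acts_trivially q"
  moreover have "pmult (p - q) z = pmult p z - pmult q z" for z
    by (rule ext) (simp add: left_diff_distrib)
  ultimately show ?thesis unfolding acts_trivially_def using boundaries_diff by simp
qed

lemma acts_trivially_0: "acts_trivially 0"
  unfolding acts_trivially_def using boundaries_0 by (simp add: zero_fun_def)

lemma acts_trivially_add: "acts_trivially p \<Longrightarrow> acts_trivially q \<Longrightarrow> acts_trivially (p + q)"
  using acts_trivially_diff[of p "0 - q"] acts_trivially_diff[OF acts_trivially_0, of q] by simp

lemma variables_agree: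
  assumes "u \<in> L" "v \<in> L" shows "acts_trivially (pX v - pX u)"
  using connected[OF assms]
proof (induction rule: rtrancl_induct)
  case base
  show ?case using acts_trivially_0 by simp
next
  case (step v w)
  obtain p q where pq: "pX w - pX v = p - q" "null_total L M p" "null_total L M q \<or> q = 0"
    using x_null[OF step(2)] by blast
  have "acts_trivially (p - q)"
    using pq(2,3) null_total_trivial acts_trivially_0 by (auto intro!: acts_trivially_diff)
  then have "acts_trivially ((pX v - pX u) + (pX w - pX v))"
    unfolding pq(1) by (rule acts_trivially_add[OF step.IH])
  then show ?case by simp
qed

lemma a_trivial: "acts_trivially pA"
  using null_total_trivial null_mf_total a_null by blast

subsection \<open>The trigraded complex\<close>

definition imin where "imin = Min (hdeg M ` gens M)"
definition imax where "imax = Max (hdeg M ` gens M)"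
definition jmin where "jmin = Min (adeg M ` gens M)"
definition jmax where "jmax = Max (adeg M ` gens M)"
definition kmin where "kmin = Min (xdeg M ` gens M)"

lemma bounds:
  assumes "b \<in> gens M"
  shows "imin \<le> hdeg M b" "hdeg M b \<le> imax" "jmin \<le> adeg M b" "adeg M b \<le> jmax" "kmin \<le> xdeg M b"
  using assms fin unfolding imin_def imax_def jmin_def jmax_def kmin_def by simp_all

lemma mdeg_nonneg: "0 \<le> fst (mdeg m)" "0 \<le> snd (mdeg m)"
  unfolding mdeg_def deg_a_def deg_x_def by (simp_all add: sum_nonneg)

lemma component_zero:
  assumes "\<And>b. b \<in> gens M \<Longrightarrow> hdeg M b \<noteq> i \<or> j < adeg M b \<or> k < xdeg M b"
  shows "C i j k = {0}"
proof -
  have "z = 0" if z: "z \<in> C i j k" for z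
  proof (rule ext)
    fix b
    show "z b = 0 b"
    proof (cases "b \<in> gens M")
      case True
      show ?thesis
      proof (cases "hdeg M b = i")
        case hb: True
        have h: "homog (j - adeg M b, k - xdeg M b) (z b)" using z True unfolding component_iff by blast
        have "m \<notin> Poly_Mapping.keys (z b)" for m
        proof
          assume "m \<in> Poly_Mapping.keys (z b)"
          then have "mdeg m = (j - adeg M b, k - xdeg M b)" using h unfolding homog_mdeg by blast
          then show False using mdeg_nonneg[of m] assms[OF True] hb by auto
        qed
        then have "Poly_Mapping.keys (z b) = {}" by blast
        then show ?thesis by simp
      qed (use z True in \<open>simp add: component_iff\<close>)
    qed (use z in \<open>simp add: component_iff vecs_def\<close>)
  qed
  moreover have "0 \<in> C i j k" using Q.subspace_0 component_basis(3)[OF fin, of L] by blast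
  ultimately show ?thesis by blast
qed

lemma dim_C: "int (Q.dim (C i j k)) = (\<Sum>b\<in>{b \<in> gens M. hdeg M b = i}. mon_count (vars L) (j - adeg M b, k - xdeg M b))"
  using component_basis(1)[OF fin, of L i j k] unfolding mon_count_def by simp

lemma mon_count_x: "mon_count (vars L) (p, q) - mon_count (vars L) (p - 2, q) = (if p = 0 then xcount n q else 0)"
proof -
  have "vars L - {VarA} = VarX ` {1..n}" unfolding vars_def by auto
  moreover have "finite (vars L)" "VarA \<in> vars L" unfolding vars_def by auto
  ultimately have "mon_count (vars L) (p, q) - mon_count (vars L) (p - 2, q) = mon_count (VarX ` {1..n}) (p, q)"
    using mon_count_step[of "vars L" VarA "(p, q)"] unfolding vdeg_def by simp
  moreover have "mon_count (VarX ` {1..n}) (p, q) = 0" if "p \<noteq> 0"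
    by (rule mon_count_no_a) (use that in auto)
  ultimately show ?thesis unfolding xcount_def by auto
qed

text \<open>Modulo \<open>a\<close> only the monomials in the variables \<open>x\<close> are left, and a generator \<open>b\<close> contributes only in
  \<open>a\<close>-degree \<open>adeg M b\<close>.\<close>

lemma count_dims:
  "(\<Sum>i\<in>{imin..imax}. \<Sum>j\<in>{jmin..jmax}. int (Q.dim (C i j (j + c))) - int (Q.dim (C i (j - 2) (j + c))))
    = genct M (xcount n) c"
proof -
  have "int (Q.dim (C i j (j + c))) - int (Q.dim (C i (j - 2) (j + c)))
      = (\<Sum>b\<in>{b \<in> gens M. hdeg M b = i}. if j = adeg M b then xcount n (j + c - xdeg M b) else 0)" for i j
  proof -
    have "mon_count (vars L) (j - adeg M b, j + c - xdeg M b) - mon_count (vars L) (j - 2 - adeg M b, j + c - xdeg M b)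
        = (if j = adeg M b then xcount n (j + c - xdeg M b) else 0)" for b
      using mon_count_x[of "j - adeg M b" "j + c - xdeg M b"] by (simp add: algebra_simps)
    then show ?thesis unfolding dim_C sum_subtractf[symmetric] by simp
  qed
  then have "(\<Sum>i\<in>{imin..imax}. \<Sum>j\<in>{jmin..jmax}. int (Q.dim (C i j (j + c))) - int (Q.dim (C i (j - 2) (j + c))))
      = (\<Sum>i\<in>{imin..imax}. \<Sum>b\<in>{b \<in> gens M. hdeg M b = i}. \<Sum>j\<in>{jmin..jmax}.
          if j = adeg M b then xcount n (j + c - xdeg M b) else 0)"
    by (simp add: sum.swap[of _ "{b \<in> gens M. hdeg M b = _}"])
  also have "\<dots> = (\<Sum>i\<in>{imin..imax}. \<Sum>b\<in>{b \<in> gens M. hdeg M b = i}. xcount n (c - (xdeg M b - adeg M b)))"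
  proof (intro sum.cong refl)
    fix i b assume "b \<in> {b \<in> gens M. hdeg M b = i}"
    then have "adeg M b \<in> {jmin..jmax}" using bounds by auto
    then have "(\<Sum>j\<in>{jmin..jmax}. if j = adeg M b then xcount n (j + c - xdeg M b) else 0)
        = xcount n (adeg M b + c - xdeg M b)" by simp
    moreover have "adeg M b + c - xdeg M b = c - (xdeg M b - adeg M b)" by simp
    ultimately show "(\<Sum>j\<in>{jmin..jmax}. if j = adeg M b then xcount n (j + c - xdeg M b) else 0)
        = xcount n (c - (xdeg M b - adeg M b))" by (simp only:)
  qed
  also have "\<dots> = (\<Sum>b\<in>gens M. xcount n (c - (xdeg M b - adeg M b)))"
    by (rule sum.group) (use fin bounds in auto)
  finally show ?thesis unfolding genct_def .
qed

lemma a_surj_C: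
  assumes "jmax < j" "z \<in> C i j k"
  shows "\<exists>y\<in>C i (j - 2) k. z = pmult pA y"
proof -
  define y where "y = (\<lambda>b. drop_var VarA (z b))"
  have eq: "pA * y b = z b" if b: "b \<in> gens M" for b
    unfolding y_def
  proof (rule Var_times_drop_var)
    fix m assume "m \<in> Poly_Mapping.keys (z b)"
    then have "mdeg m = (j - adeg M b, k - xdeg M b)"
      using assms(2) b unfolding component_iff homog_mdeg by blast
    then show "Poly_Mapping.lookup m VarA \<noteq> 0"
      using bounds(4)[OF b] assms(1) unfolding mdeg_def deg_a_def by auto
  qed
  have d0: "drop_var v 0 = 0" for v by (rule poly_mapping_eqI) (simp add: drop_var.rep_eq)
  have yC: "y \<in> C i (j - 2) k"
    unfolding component_iff
  proof (intro conjI ballI impI)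
    show "y \<in> V" using assms(2) unfolding component_iff vecs_def y_def by (auto intro: poly_ring_drop_var simp: d0)
    fix b assume b: "b \<in> gens M"
    show "y b = 0" if "hdeg M b \<noteq> i" using assms(2) b that unfolding component_iff y_def by (simp add: d0)
    have "homog (vdeg VarA + (j - 2 - adeg M b, k - xdeg M b)) (z b)"
      using assms(2) b unfolding component_iff vdeg_def by (simp add: algebra_simps)
    then show "homog (j - 2 - adeg M b, k - xdeg M b) (y b)" unfolding y_def by (rule homog_drop_var)
  qed
  have "z = pmult pA y"
  proof (rule ext)
    fix b show "z b = pA * y b"
      using eq[of b] assms(2) unfolding component_iff vecs_def y_def by (cases "b \<in> gens M") (auto simp: d0)
  qed
  with yC show ?thesis by blast
qed

text \<open>The homotopy need not be homogeneous; its component of degree \<open>(1, -1)\<close> has the same property.\<close>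

lemma a_null_C:
  assumes "z \<in> C i j k" "d z = 0"
  shows "\<exists>u\<in>C i (j + 1) (k - 1). pmult pA z = d u"
proof -
  obtain h where H: "homotopy L M pA h 0" using a_null unfolding null_mf_def by blast
  note A = homotopy_action[OF H C_V[OF assms(1)] assms(2)]
  have z0: "apply_mat M 0 v = 0" for v unfolding apply_mat_def by (intro ext) simp
  have eq: "pmult pA z = d (- apply_mat M h z)"
    using A(4) unfolding z0 by (simp add: apply_mat_uminus)
  have "pmult pA z \<in> C i (j + 2) k" using pmult_component[OF poly_ring_pA homog_pA assms(1)] by simp
  then have "pmult pA z = proj M i (j + 2) k (d (- apply_mat M h z))" using proj_id eq by metis
  also have "\<dots> = d (proj M i (j + 1) (k - 1) (- apply_mat M h z))"
    using proj_d[of i "j + 1" "k - 1" "- apply_mat M h z"] by (simp add: algebra_simps)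
  finally have "pmult pA z = d (proj M i (j + 1) (k - 1) (- apply_mat M h z))" .
  moreover have "- apply_mat M h z \<in> V" using Q.subspace_neg[OF subspace_vecs] A(1) by blast
  ultimately show ?thesis using proj_component by blast
qed

sublocale T: trigraded_complex qscale C d s "pmult pA" imin imax jmin jmax kmin
proof (intro trigraded_complex.intro trigraded_complex_axioms.intro)
  show "rational_space qscale" by (rule Q.rational_space_axioms)
  show "Q.subspace (C i j k)" "Q.finite_span (C i j k)" for i j k
    using component_basis[OF fin, of L] by auto
  show "C i j k = {0}" if "i < imin" for i j k
    by (rule component_zero) (use that bounds in fastforce)
  show "C i j k = {0}" if "imax < i" for i j k
    by (rule component_zero) (use that bounds in fastforce)
  show "C i j k = {0}" if "j < jmin" for i j k
    by (rule component_zero) (use that bounds in fastforce)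
  show "C i j k = {0}" if "k < kmin" for i j k
    by (rule component_zero) (use that bounds in fastforce)
  obtain b where b: "b \<in> gens M" using gens_ne by blast
  show "imin \<le> imax" "jmin \<le> jmax" using bounds[OF b] by linarith+
  show "Vector_Spaces.linear qscale qscale d" "Vector_Spaces.linear qscale qscale s"
    "Vector_Spaces.linear qscale qscale (pmult pA)" by (rule linear_apply_mat linear_pmult)+
  show "d z \<in> C i (j + 1) (k + 1)" if "z \<in> C i j k" for z i j k using d_C that .
  show "s z \<in> C (i + 1) j k" if "z \<in> C i j k" for z i j k using s_C that .
  show "pmult pA z \<in> C i (j + 2) k" if "z \<in> C i j k" for z i j k
    using pmult_component[OF _ homog_pA that] by simp
  show "d (d z) = 0" "s (s z) = 0" "d (s z) = s (d z)" for z by (rule dd ss ds)+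
  show "pmult pA (d z) = d (pmult pA z)" for z by (rule apply_mat_pmult[symmetric])
  show "z = 0" if "pmult pA z = 0" for z :: "gen \<Rightarrow> qpoly"
  proof (rule ext)
    fix b
    have "pA * z b = 0" using fun_cong[OF that, of b] by (simp only: zero_fun_apply)
    then show "z b = 0 b" by (simp only: Var_times_eq_0 zero_fun_apply)
  qed
  show "\<exists>y\<in>C i (j - 2) k. z = pmult pA y" if "jmax < j" "z \<in> C i j k" for i j k z
    using a_surj_C that .
  show "\<exists>u\<in>C i (j + 1) (k - 1). pmult pA z = d u" if "z \<in> C i j k" "d z = 0" for i j k z
    using a_null_C that .
  show "odd (\<Sum>i\<in>{imin..imax}. \<Sum>j\<in>{jmin..jmax}.
      int (Q.dim (C i j (j + c))) - int (Q.dim (C i (j - 2) (j + c)))) \<longleftrightarrow> c = 0" if "even c" for c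
    unfolding count_dims by (rule count_gens)
qed

lemma Zh_cycles: "z \<in> T.Zh i j k \<longleftrightarrow> z \<in> C i j k \<and> z \<in> cycles"
proof
  assume "z \<in> T.Zh i j k"
  then have "z \<in> C i j k" "d z = 0" "s z \<in> d ` C (i + 1) (j - 1) (k - 1)"
    unfolding T.Zh_def T.Zd_def T.Bd_def by auto
  then show "z \<in> C i j k \<and> z \<in> cycles" unfolding cycles_def using C_V by blast
next
  assume z: "z \<in> C i j k \<and> z \<in> cycles"
  then obtain u where u: "d z = 0" "u \<in> V" "s z = d u" unfolding cycles_def by blast
  have "s z = proj M (i + 1) j k (s z)" using s_C z proj_id by metis
  also have "\<dots> = d (proj M (i + 1) (j - 1) (k - 1) u)"
    unfolding u(3) using proj_d[of "i + 1" "j - 1" "k - 1" u] by simp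
  finally have "s z \<in> d ` C (i + 1) (j - 1) (k - 1)" using proj_component[OF u(2)] by blast
  then show "z \<in> T.Zh i j k" using z u(1) unfolding T.Zh_def T.Zd_def T.Bd_def by blast
qed

lemma Bh_boundaries: "z \<in> T.Bh i j k \<longleftrightarrow> z \<in> C i j k \<and> z \<in> boundaries"
proof
  assume z: "z \<in> T.Bh i j k"
  then obtain w u where "z = s w + d u" "w \<in> C (i - 1) j k" "d w = 0" "u \<in> C i (j - 1) (k - 1)"
    unfolding T.Bh_def T.Zd_def T.Bd_def by blast
  moreover have "z \<in> C i j k" using z T.Bh_subset unfolding T.Zh_def T.Zd_def by blast
  ultimately show "z \<in> C i j k \<and> z \<in> boundaries" unfolding boundaries_def using C_V by blast
next
  assume z: "z \<in> C i j k \<and> z \<in> boundaries"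
  then obtain w u where wu: "z = s w + d u" "w \<in> V" "d w = 0" "u \<in> V" unfolding boundaries_def by blast
  let ?w = "proj M (i - 1) j k w" and ?u = "proj M i (j - 1) (k - 1) u"
  have "z = proj M i j k (s w) + proj M i j k (d u)" using z proj_id wu(1) proj_add by metis
  then have eq: "z = s ?w + d ?u"
    using proj_s[of "i - 1" j k w] proj_d[of i "j - 1" "k - 1" u] by simp
  have "d ?w = proj M (i - 1) (j + 1) (k + 1) (d w)" using proj_d by metis
  also have "\<dots> = 0" unfolding wu(3) proj_def by (intro ext) simp
  finally have "d ?w = 0" .
  then have "?w \<in> T.Zd (i - 1) j k" "d ?u \<in> T.Bd i j k"
    unfolding T.Zd_def T.Bd_def using proj_component wu by blast+
  then show "z \<in> T.Bh i j k" unfolding T.Bh_def using eq by blast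
qed

lemma cycles_pmult: "p \<in> poly_ring L \<Longrightarrow> z \<in> cycles \<Longrightarrow> pmult p z \<in> cycles"
proof -
  assume p: "p \<in> poly_ring L" and "z \<in> cycles"
  then obtain u where u: "z \<in> V" "d z = 0" "u \<in> V" "s z = d u" unfolding cycles_def by blast
  have "d (pmult p z) = 0" unfolding apply_mat_pmult u(2) by (rule ext) simp
  moreover have "s (pmult p z) = d (pmult p u)" unfolding apply_mat_pmult u(4) ..
  ultimately show ?thesis unfolding cycles_def using pmult_vecs[OF p] u by blast
qed

lemma boundaries_pmult: "p \<in> poly_ring L \<Longrightarrow> z \<in> boundaries \<Longrightarrow> pmult p z \<in> boundaries"
proof -
  assume p: "p \<in> poly_ring L" and "z \<in> boundaries"
  then obtain w u where u: "z = s w + d u" "w \<in> V" "d w = 0" "u \<in> V" unfolding boundaries_def by blast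
  have "pmult p z = s (pmult p w) + d (pmult p u)"
    unfolding apply_mat_pmult u(1) by (rule ext) (simp add: distrib_left)
  moreover have "d (pmult p w) = 0" unfolding apply_mat_pmult u(3) by (rule ext) simp
  ultimately show ?thesis unfolding boundaries_def using pmult_vecs[OF p] u by blast
qed

text \<open>In high degree a cycle is \<open>a w + \<Sum> x\<^sub>u w\<^sub>u\<close> for cycles \<open>w, w\<^sub>u\<close> of lower degree. Modulo boundaries
  the first term vanishes and all \<open>x\<^sub>u\<close> can be replaced by \<open>x\<^sub>1\<close>, so the cycle is a multiple of \<open>x\<^sub>1\<close>.\<close>

lemma hdim_eventually_noninc: "\<exists>K. \<forall>k\<ge>K. T.hdim i j (k + 2) \<le> T.hdim i j k"
proof -
  let ?Z = "\<lambda>e. T.Zh i (fst e) (snd e)"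
  interpret N: graded_submodule "gens M" L "\<lambda>b. (adeg M b, xdeg M b)" ?Z
  proof unfold_locales
    show "finite (gens M)" "finite L" using fin by auto
    fix z e b assume z: "z \<in> ?Z e"
    then have zC: "z \<in> C i (fst e) (snd e)" unfolding Zh_cycles by blast
    show "z b = 0" if "b \<notin> gens M" using zC that unfolding component_iff vecs_def by blast
    show "z b \<in> poly_ring L" using zC unfolding component_iff vecs_def by (cases "b \<in> gens M") auto
    show "homog (e - (adeg M b, xdeg M b)) (z b)"
    proof (cases "b \<in> gens M")
      case True
      then show ?thesis using zC unfolding component_iff by (cases e) simp
    next
      case False
      then show ?thesis using zC unfolding component_iff vecs_def by simp
    qed
  next
    show "(\<lambda>_. 0) \<in> ?Z e" for e
      using Q.subspace_0[OF T.subspace_Zh[of i "fst e" "snd e"]] by (simp add: zero_fun_def)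
    show "z - z' \<in> ?Z e" if "z \<in> ?Z e" "z' \<in> ?Z e" for z z' e
      using Q.subspace_diff[OF T.subspace_Zh] that by blast
    show "pmult p z \<in> ?Z (g + e)" if "p \<in> poly_ring L" "homog g p" "z \<in> ?Z e" for p g z e
      using that cycles_pmult pmult_component[of p L "fst g" "snd g" z M i "fst e" "snd e"]
      unfolding Zh_cycles by (simp add: add.commute)
  qed
  obtain N where N: "\<And>e z. N \<le> fst e + snd e \<Longrightarrow> z \<in> ?Z e \<Longrightarrow> N.decomposable e z"
    using N.generated_in_bounded_degree by blast
  have one: "1 \<in> L" using n_pos by simp
  have "T.hdim i j (k + 2) \<le> T.hdim i j k" if k: "N - j \<le> k" for k
  proof (rule T.hdim_noninc[OF linear_pmult[of "pX 1"]])
    show "pmult (pX 1) z \<in> T.Bh i j (k + 2)" if "z \<in> T.Bh i j k" for z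
    proof -
      have "homog (0, 2) (pX 1)" using homog_Var[of "VarX 1"] unfolding vdeg_def by simp
      then show ?thesis
        using that boundaries_pmult[of "pX 1" z] pmult_component[of "pX 1" L 0 2 z M i j k] one
        unfolding Bh_boundaries by simp
    qed
    fix z assume z: "z \<in> T.Zh i j (k + 2)"
    then have "N.decomposable (j, k + 2) z" using N[of "(j, k + 2)" z] k by simp
    then obtain w where w: "\<And>v. v \<in> N.V \<Longrightarrow> w v \<in> ?Z ((j, k + 2) - vdeg v)"
      and zw: "z = (\<lambda>b. \<Sum>v\<in>N.V. Var v * w v b)" unfolding N.decomposable_def by blast
    have wA: "w VarA \<in> T.Zh i (j - 2) (k + 2)" using w[of VarA] unfolding N.V_def vdeg_def by simp
    have wX: "w (VarX u) \<in> T.Zh i j k" if "u \<in> L" for u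
      using w[of "VarX u"] that unfolding N.V_def vdeg_def by simp
    define y where "y = (\<Sum>u\<in>L. w (VarX u))"
    have y: "y \<in> T.Zh i j k" unfolding y_def by (rule Q.subspace_sum[OF T.subspace_Zh wX])
    have split: "z b = pA * w VarA b + (\<Sum>u\<in>L. pX u * w (VarX u) b)" for b
    proof -
      have "(\<Sum>v\<in>N.V. Var v * w v b) = pA * w VarA b + (\<Sum>v\<in>VarX ` L. Var v * w v b)"
        unfolding N.V_def by (subst sum.insert) auto
      also have "(\<Sum>v\<in>VarX ` L. Var v * w v b) = (\<Sum>u\<in>L. pX u * w (VarX u) b)"
        by (subst sum.reindex) (auto simp: inj_on_def)
      finally show ?thesis unfolding zw .
    qed
    have eq: "z - pmult (pX 1) y = pmult pA (w VarA) + (\<Sum>u\<in>L. pmult (pX u - pX 1) (w (VarX u)))"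
    proof (rule ext)
      fix b
      have "(z - pmult (pX 1) y) b = pA * w VarA b + ((\<Sum>u\<in>L. pX u * w (VarX u) b) - pX 1 * (\<Sum>u\<in>L. w (VarX u) b))"
        using split[of b] by (simp add: y_def sum_fun_apply)
      also have "\<dots> = (pmult pA (w VarA) + (\<Sum>u\<in>L. pmult (pX u - pX 1) (w (VarX u)))) b"
        by (simp add: sum_fun_apply sum_distrib_left sum_subtractf left_diff_distrib)
      finally show "(z - pmult (pX 1) y) b = (pmult pA (w VarA) + (\<Sum>u\<in>L. pmult (pX u - pX 1) (w (VarX u)))) b" .
    qed
    have "pmult pA (w VarA) \<in> boundaries"
      using a_trivial wA unfolding acts_trivially_def Zh_cycles by blast
    moreover have "(\<Sum>u\<in>L. pmult (pX u - pX 1) (w (VarX u))) \<in> boundaries"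
    proof -
      have each: "pmult (pX u - pX 1) (w (VarX u)) \<in> boundaries" if "u \<in> L" for u
        using variables_agree[OF one that] wX[OF that] unfolding acts_trivially_def Zh_cycles by blast
      have "(\<Sum>u\<in>A. pmult (pX u - pX 1) (w (VarX u))) \<in> boundaries" if "A \<subseteq> L" "finite A" for A
        using that(2,1)
      proof (induction A rule: finite_induct)
        case (insert u A)
        have "pmult (pX u - pX 1) (w (VarX u)) + (\<Sum>u\<in>A. pmult (pX u - pX 1) (w (VarX u))) \<in> boundaries"
          by (rule boundaries_add[OF each]) (use insert in auto)
        then show ?case by (simp only: sum.insert[OF insert(1,2)])
      qed (simp add: boundaries_0)
      then show ?thesis by blast
    qed
    ultimately have "z - pmult (pX 1) y \<in> boundaries" unfolding eq by (rule boundaries_add)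
    moreover have "z - pmult (pX 1) y \<in> C i j (k + 2)"
    proof -
      have "homog (0, 2) (pX 1)" using homog_Var[of "VarX 1"] unfolding vdeg_def by simp
      then have "pmult (pX 1) y \<in> C i j (k + 2)"
        using pmult_component[of "pX 1" L 0 2 y M i j k] y one unfolding Zh_cycles by simp
      then show ?thesis using Q.subspace_diff[OF T.subspace_C] z unfolding Zh_cycles by blast
    qed
    ultimately show "\<exists>y\<in>T.Zh i j k. z - pmult (pX 1) y \<in> T.Bh i j (k + 2)"
      unfolding Bh_boundaries using y by blast
  qed
  then show ?thesis by blast
qed

lemmas stable_dimensions = T.stable_dimensions_odd[OF hdim_eventually_noninc]

end

section \<open>Homology as a space of cosets\<close>

text \<open>\<open>W\<close> is the quotient \<open>Z / N\<close>, with \<open>f\<close> as the projection. Forming homology preserves presentations,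
  so the iterated cosets have to be taken apart only once.\<close>

definition presented ::
    "(rat, 'w) module \<Rightarrow> (gen \<Rightarrow> qpoly) set \<Rightarrow> (gen \<Rightarrow> qpoly) set \<Rightarrow> ((gen \<Rightarrow> qpoly) \<Rightarrow> 'w) \<Rightarrow> bool" where
  "presented W Z N f \<longleftrightarrow> Q.subspace Z \<and> Q.subspace N \<and> N \<subseteq> Z \<and> carrier W = f ` Z \<and>
    (\<forall>z\<in>Z. \<forall>z'\<in>Z. f z \<oplus>\<^bsub>W\<^esub> f z' = f (z + z')) \<and>
    (\<forall>q. \<forall>z\<in>Z. q \<odot>\<^bsub>W\<^esub> f z = f (qscale q z)) \<and> \<zero>\<^bsub>W\<^esub> = f 0 \<and>
    (\<forall>z\<in>Z. \<forall>z'\<in>Z. f z = f z' \<longleftrightarrow> z - z' \<in> N)"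

lemma presentedD:
  assumes "presented W Z N f"
  shows "Q.subspace Z" "Q.subspace N" "N \<subseteq> Z" "carrier W = f ` Z"
    "z \<in> Z \<Longrightarrow> z' \<in> Z \<Longrightarrow> f z \<oplus>\<^bsub>W\<^esub> f z' = f (z + z')"
    "z \<in> Z \<Longrightarrow> q \<odot>\<^bsub>W\<^esub> f z = f (qscale q z)" "\<zero>\<^bsub>W\<^esub> = f 0"
    "z \<in> Z \<Longrightarrow> z' \<in> Z \<Longrightarrow> f z = f z' \<longleftrightarrow> z - z' \<in> N"
  using assms unfolding presented_def by auto

lemma presented_vectorspace:
  assumes "presented W Z N f" shows "vectorspace class_ring W"
proof -
  note D = presentedD[OF assms]
  note add = Q.subspace_add[OF D(1)] and scale = Q.subspace_scale[OF D(1)] and zero = Q.subspace_0[OF D(1)]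
  show ?thesis
  proof (rule vs_criteria[OF class_field], unfold D(4))
    show "\<zero>\<^bsub>W\<^esub> \<in> f ` Z" using D(7) zero by simp
    show "\<forall>v w. v \<in> f ` Z \<and> w \<in> f ` Z \<longrightarrow> v \<oplus>\<^bsub>W\<^esub> w \<in> f ` Z" using D(5) add by auto
    show "\<forall>v\<in>f ` Z. \<exists>w\<in>f ` Z. v \<oplus>\<^bsub>W\<^esub> w = \<zero>\<^bsub>W\<^esub>"
    proof
      fix v assume "v \<in> f ` Z"
      then obtain z where z: "z \<in> Z" "v = f z" by blast
      have "- z \<in> Z" by (rule Q.subspace_neg[OF D(1) z(1)])
      then have "v \<oplus>\<^bsub>W\<^esub> f (- z) = \<zero>\<^bsub>W\<^esub>" unfolding z(2) D(7) using D(5)[OF z(1)] by simp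
      then show "\<exists>w\<in>f ` Z. v \<oplus>\<^bsub>W\<^esub> w = \<zero>\<^bsub>W\<^esub>" using \<open>- z \<in> Z\<close> by blast
    qed
    show "\<forall>c v. c \<in> carrier class_ring \<and> v \<in> f ` Z \<longrightarrow> c \<odot>\<^bsub>W\<^esub> v \<in> f ` Z" using D(6) scale by auto
    show "\<forall>v w. v \<in> f ` Z \<and> w \<in> f ` Z \<longrightarrow> v \<oplus>\<^bsub>W\<^esub> w = w \<oplus>\<^bsub>W\<^esub> v" using D(5) by (auto simp: add.commute)
    show "\<forall>v w x. v \<in> f ` Z \<and> w \<in> f ` Z \<and> x \<in> f ` Z \<longrightarrow> v \<oplus>\<^bsub>W\<^esub> w \<oplus>\<^bsub>W\<^esub> x = v \<oplus>\<^bsub>W\<^esub> (w \<oplus>\<^bsub>W\<^esub> x)"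
      using D(5) add by (auto simp: add.assoc)
    show "\<forall>v\<in>f ` Z. v \<oplus>\<^bsub>W\<^esub> \<zero>\<^bsub>W\<^esub> = v"
    proof
      fix v assume "v \<in> f ` Z"
      then obtain z where z: "z \<in> Z" "v = f z" by blast
      have "v \<oplus>\<^bsub>W\<^esub> \<zero>\<^bsub>W\<^esub> = f (z + 0)" unfolding z(2) D(7) by (rule D(5)[OF z(1) zero])
      then show "v \<oplus>\<^bsub>W\<^esub> \<zero>\<^bsub>W\<^esub> = v" unfolding z(2) by (simp only: add_0_right)
    qed
    show "\<forall>a b v. a \<in> carrier class_ring \<and> b \<in> carrier class_ring \<and> v \<in> f ` Z \<longrightarrow>
        (a \<otimes>\<^bsub>class_ring\<^esub> b) \<odot>\<^bsub>W\<^esub> v = a \<odot>\<^bsub>W\<^esub> (b \<odot>\<^bsub>W\<^esub> v)"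
    proof (intro allI impI)
      fix a b :: rat and v assume "a \<in> carrier class_ring \<and> b \<in> carrier class_ring \<and> v \<in> f ` Z"
      then obtain z where z: "z \<in> Z" "v = f z" by blast
      have 1: "b \<odot>\<^bsub>W\<^esub> v = f (qscale b z)" unfolding z(2) by (rule D(6)[OF z(1)])
      have 2: "a \<odot>\<^bsub>W\<^esub> f (qscale b z) = f (qscale a (qscale b z))" by (rule D(6)[OF scale[OF z(1)]])
      have 3: "qscale a (qscale b z) = qscale (a * b) z" by (rule ext) (simp only: Const_mult mult.assoc)
      have 4: "(a * b) \<odot>\<^bsub>W\<^esub> v = f (qscale (a * b) z)" unfolding z(2) by (rule D(6)[OF z(1)])
      have 5: "a \<otimes>\<^bsub>class_ring\<^esub> b = a * b" by simp
      show "(a \<otimes>\<^bsub>class_ring\<^esub> b) \<odot>\<^bsub>W\<^esub> v = a \<odot>\<^bsub>W\<^esub> (b \<odot>\<^bsub>W\<^esub> v)"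
        unfolding 5 4 1 2 3 ..
    qed
    show "\<forall>v\<in>f ` Z. \<one>\<^bsub>class_ring\<^esub> \<odot>\<^bsub>W\<^esub> v = v"
    proof
      fix v assume "v \<in> f ` Z"
      then obtain z where z: "z \<in> Z" "v = f z" by blast
      have "qscale 1 z = z" by simp
      then show "\<one>\<^bsub>class_ring\<^esub> \<odot>\<^bsub>W\<^esub> v = v"
        by (simp only: z(2) D(6)[OF z(1), of 1] monoid.simps)
    qed
    show "\<forall>a b v. a \<in> carrier class_ring \<and> b \<in> carrier class_ring \<and> v \<in> f ` Z \<longrightarrow>
        (a \<oplus>\<^bsub>class_ring\<^esub> b) \<odot>\<^bsub>W\<^esub> v = a \<odot>\<^bsub>W\<^esub> v \<oplus>\<^bsub>W\<^esub> b \<odot>\<^bsub>W\<^esub> v"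
    proof (intro allI impI)
      fix a b :: rat and v assume "a \<in> carrier class_ring \<and> b \<in> carrier class_ring \<and> v \<in> f ` Z"
      then obtain z where z: "z \<in> Z" "v = f z" by blast
      have "qscale (a + b) z = qscale a z + qscale b z" by (rule Q.scale_left_distrib)
      then show "(a \<oplus>\<^bsub>class_ring\<^esub> b) \<odot>\<^bsub>W\<^esub> v = a \<odot>\<^bsub>W\<^esub> v \<oplus>\<^bsub>W\<^esub> b \<odot>\<^bsub>W\<^esub> v"
        unfolding z(2) using D(5)[OF scale[OF z(1), of a] scale[OF z(1), of b]] D(6)[OF z(1)] by simp
    qed
    show "\<forall>a v w. a \<in> carrier class_ring \<and> v \<in> f ` Z \<and> w \<in> f ` Z \<longrightarrow>
        a \<odot>\<^bsub>W\<^esub> (v \<oplus>\<^bsub>W\<^esub> w) = a \<odot>\<^bsub>W\<^esub> v \<oplus>\<^bsub>W\<^esub> a \<odot>\<^bsub>W\<^esub> w"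
    proof (intro allI impI)
      fix a :: rat and v w assume "a \<in> carrier class_ring \<and> v \<in> f ` Z \<and> w \<in> f ` Z"
      then obtain z y where z: "z \<in> Z" "v = f z" and y: "y \<in> Z" "w = f y" by blast
      have "qscale a (z + y) = qscale a z + qscale a y" by (rule Q.scale_right_distrib)
      then show "a \<odot>\<^bsub>W\<^esub> (v \<oplus>\<^bsub>W\<^esub> w) = a \<odot>\<^bsub>W\<^esub> v \<oplus>\<^bsub>W\<^esub> a \<odot>\<^bsub>W\<^esub> w"
        unfolding z(2) y(2)
        using D(5)[OF scale[OF z(1), of a] scale[OF y(1), of a]] D(5)[OF z(1) y(1)] D(6)[OF z(1)]
          D(6)[OF y(1)] D(6)[OF add[OF z(1) y(1)]] by simp
    qed
  qed
qed

text \<open>A basis of the image of \<open>Z\<close> under a linear map with kernel \<open>N\<close> lifts to \<open>Z\<close> and is then mapped by \<open>f\<close> to a basis of \<open>W\<close>.\<close>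

theorem presented_dim:
  assumes P: "presented W Z N f" and Z: "Q.finite_span Z"
  shows "vectorspace.fin_dim class_ring W"
    and "vectorspace.dim class_ring W = Q.dim Z - Q.dim N"
proof -
  note D = presentedD[OF P]
  interpret W: vectorspace "class_ring :: rat ring" W by (rule presented_vectorspace[OF P])
  obtain p where p: "Vector_Spaces.linear qscale qscale p" "\<And>x. p x = 0 \<longleftrightarrow> x \<in> N"
    using Q.linear_with_kernel[OF D(2)] by blast
  interpret p: Vector_Spaces.linear qscale qscale p by (rule p(1))
  obtain E where E: "finite E" "E \<subseteq> p ` Z" "Q.independent E" "p ` Z \<subseteq> Q.span E" "card E = Q.dim (p ` Z)"
    by (rule Q.finite_span_basis[OF Q.finite_span_image[OF p(1) Z]])
  have "\<forall>e\<in>E. \<exists>z\<in>Z. p z = e" using E(2) by blast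
  then obtain g where g: "\<And>e. e \<in> E \<Longrightarrow> g e \<in> Z" "\<And>e. e \<in> E \<Longrightarrow> p (g e) = e" by metis
  define A where "A = (\<lambda>e. f (g e)) ` E"
  have inj: "inj_on (\<lambda>e. f (g e)) E"
  proof (rule inj_onI)
    fix e e' assume e: "e \<in> E" "e' \<in> E" "f (g e) = f (g e')"
    then have "p (g e - g e') = 0" using D(8)[OF g(1) g(1)] p(2) by blast
    then show "e = e'" using g(2) e by (simp add: p.diff)
  qed
  have comb_Z: "(\<Sum>e\<in>F. qscale (r e) (g e)) \<in> Z" if "F \<subseteq> E" for F r
    by (rule Q.subspace_sum[OF D(1)]) (use that g(1) Q.subspace_scale[OF D(1)] in blast)
  have comb: "(\<Oplus>\<^bsub>W\<^esub>v\<in>(\<lambda>e. f (g e)) ` F. c v \<odot>\<^bsub>W\<^esub> v) = f (\<Sum>e\<in>F. qscale (c (f (g e))) (g e))"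
    if "finite F" "F \<subseteq> E" for F c
    using that
  proof (induction F rule: finite_induct)
    case empty
    then show ?case using D(7) by (simp add: zero_fun_def)
  next
    case (insert x F)
    have xE: "x \<in> E" using insert by blast
    have mem: "c v \<odot>\<^bsub>W\<^esub> v \<in> carrier W" if "v \<in> (\<lambda>e. f (g e)) ` E" for v
      using that D(6)[OF g(1)] Q.subspace_scale[OF D(1) g(1)] unfolding D(4) by auto
    have "f (g x) \<notin> (\<lambda>e. f (g e)) ` F"
      using inj insert unfolding inj_on_def by blast
    then have "(\<Oplus>\<^bsub>W\<^esub>v\<in>(\<lambda>e. f (g e)) ` insert x F. c v \<odot>\<^bsub>W\<^esub> v)
        = c (f (g x)) \<odot>\<^bsub>W\<^esub> f (g x) \<oplus>\<^bsub>W\<^esub> (\<Oplus>\<^bsub>W\<^esub>v\<in>(\<lambda>e. f (g e)) ` F. c v \<odot>\<^bsub>W\<^esub> v)"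
      unfolding image_insert using insert mem xE by (intro W.finsum_insert) (blast | simp)+
    also have "\<dots> = f (qscale (c (f (g x))) (g x)) \<oplus>\<^bsub>W\<^esub> f (\<Sum>e\<in>F. qscale (c (f (g e))) (g e))"
      using insert D(6)[OF g(1)[OF xE]] by simp
    also have "\<dots> = f (qscale (c (f (g x))) (g x) + (\<Sum>e\<in>F. qscale (c (f (g e))) (g e)))"
      by (rule D(5)[OF Q.subspace_scale[OF D(1) g(1)[OF xE]] comb_Z]) (use insert.prems in simp)
    finally show ?case unfolding sum.insert[OF insert(1,2)] .
  qed
  have AC: "A \<subseteq> carrier W" unfolding A_def D(4) using g(1) by blast
  have finA: "finite A" unfolding A_def using E(1) by simp
  have p_comb: "p (\<Sum>e\<in>E. qscale (r e) (g e)) = (\<Sum>e\<in>E. qscale (r e) e)" for r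
    unfolding p.sum by (rule sum.cong) (simp_all add: p.scale g(2))
  have li: "W.lin_indpt A"
  proof (rule W.finite_lin_indpt2[OF finA AC])
    fix c assume "W.lincomb c A = \<zero>\<^bsub>W\<^esub>"
    then have "f (\<Sum>e\<in>E. qscale (c (f (g e))) (g e)) = f 0"
      unfolding W.lincomb_def A_def comb[OF E(1) order_refl] D(7) .
    then have "(\<Sum>e\<in>E. qscale (c (f (g e))) (g e)) - 0 \<in> N"
      by (rule D(8)[OF comb_Z[OF order_refl] Q.subspace_0[OF D(1)], THEN iffD1])
    then have "p (\<Sum>e\<in>E. qscale (c (f (g e))) (g e)) = 0" unfolding p(2) diff_zero .
    then have "(\<Sum>e\<in>E. qscale (c (f (g e))) e) = 0" unfolding p_comb .
    then have "c (f (g e)) = 0" if "e \<in> E" for e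
      using Q.independentD[OF E(3) E(1) order_refl, of "\<lambda>e. c (f (g e))"] that by blast
    then show "\<forall>v\<in>A. c v = \<zero>\<^bsub>class_ring\<^esub>" unfolding A_def by simp
  qed
  have gen: "W.gen_set A"
  proof -
    have "carrier W \<subseteq> W.span A"
    proof
      fix v assume "v \<in> carrier W"
      then obtain z where z: "z \<in> Z" "v = f z" unfolding D(4) by blast
      have "p z \<in> Q.span E" using E(4) z(1) by blast
      then obtain r where r: "p z = (\<Sum>e\<in>E. qscale (r e) e)" unfolding Q.span_finite[OF E(1)] by blast
      define c where "c v = r (inv_into E (\<lambda>e. f (g e)) v)" for v
      have c: "c (f (g e)) = r e" if "e \<in> E" for e
        unfolding c_def using inv_into_f_f[OF inj that] by simp
      have "W.lincomb c A = f (\<Sum>e\<in>E. qscale (c (f (g e))) (g e))"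
        unfolding W.lincomb_def A_def comb[OF E(1) order_refl] ..
      also have "(\<Sum>e\<in>E. qscale (c (f (g e))) (g e)) = (\<Sum>e\<in>E. qscale (r e) (g e))"
        by (rule sum.cong) (simp_all add: c)
      also have "f (\<Sum>e\<in>E. qscale (r e) (g e)) = f z"
      proof -
        have "p ((\<Sum>e\<in>E. qscale (r e) (g e)) - z) = 0" unfolding p.diff p_comb r by simp
        then show ?thesis using D(8)[OF comb_Z[OF order_refl, of r] z(1)] p(2) by blast
      qed
      finally have "W.lincomb c A = v" using z(2) by simp
      then show "v \<in> W.span A" unfolding W.finite_span[OF finA AC] by auto
    qed
    then show ?thesis using W.span_is_subset2[OF AC] by blast
  qed
  show "W.fin_dim" unfolding W.fin_dim_def using finA AC gen by blast
  have "W.basis A" unfolding W.basis_def using li gen AC by blast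
  then have "W.dim = card A" by (rule W.dim_basis[OF finA])
  also have "\<dots> = Q.dim (p ` Z)" unfolding A_def card_image[OF inj] by (rule E(5))
  also have "\<dots> = Q.dim Z - Q.dim N"
  proof -
    have "{z \<in> Z. p z = 0} = N" using p(2) D(3) by blast
    then show ?thesis using Q.rank_nullity[OF p(1) D(1) Z] by simp
  qed
  finally show "W.dim = Q.dim Z - Q.dim N" .
qed

subsection \<open>Homology of a presented space\<close>

text \<open>The homology class, as a coset of the image of the differential, of the element presented by \<open>z\<close>.\<close>

definition class_map :: "(gen \<Rightarrow> qpoly) set \<Rightarrow> ((gen \<Rightarrow> qpoly) \<Rightarrow> gen \<Rightarrow> qpoly) \<Rightarrow> ((gen \<Rightarrow> qpoly) \<Rightarrow> 'w) \<Rightarrow>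
    (gen \<Rightarrow> qpoly) \<Rightarrow> 'w set"
  where "class_map Z \<delta> f z = (\<lambda>y. f (\<delta> y + z)) ` Z"

context
  fixes W :: "(rat, 'w) module" and Z N f and \<delta> :: "(gen \<Rightarrow> qpoly) \<Rightarrow> gen \<Rightarrow> qpoly" and D
  assumes P: "presented W Z N f" and lin: "Vector_Spaces.linear qscale qscale \<delta>"
    and Z: "\<And>z. z \<in> Z \<Longrightarrow> \<delta> z \<in> Z" and sq: "\<And>z. z \<in> Z \<Longrightarrow> \<delta> (\<delta> z) \<in> N"
    and D: "\<And>z. z \<in> Z \<Longrightarrow> D (f z) = f (\<delta> z)"
begin

interpretation \<delta>: Vector_Spaces.linear qscale qscale \<delta> by (rule lin)

lemma delta_N: "b \<in> N \<Longrightarrow> \<delta> b \<in> N"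
proof -
  note R = presentedD[OF P]
  assume b: "b \<in> N"
  have bZ: "b \<in> Z" and z0: "0 \<in> Z" using R(3) b Q.subspace_0[OF R(1)] by blast+
  have "f b = f 0" using R(8)[OF bZ z0] b by simp
  then have "f (\<delta> b) = f 0" using D[OF bZ] D[OF z0] \<delta>.zero by metis
  then show "\<delta> b \<in> N" using R(8)[OF Z[OF bZ] z0] by simp
qed

lemma coset_class_map: "z \<in> Z \<Longrightarrow> (D ` carrier W) +>\<^bsub>W\<^esub> f z = class_map Z \<delta> f z"
proof -
  note R = presentedD[OF P]
  assume z: "z \<in> Z"
  have "f (\<delta> y) \<oplus>\<^bsub>W\<^esub> f z = f (\<delta> y + z)" if "y \<in> Z" for y using R(5)[OF Z[OF that] z] .
  then show ?thesis
    unfolding a_r_coset_def' class_map_def R(4) using D by (force simp: image_iff)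
qed

lemma class_map_eq:
  assumes z: "z \<in> Z" and z': "z' \<in> Z"
  shows "class_map Z \<delta> f z = class_map Z \<delta> f z' \<longleftrightarrow> z - z' \<in> {\<delta> y + b |y b. y \<in> Z \<and> b \<in> N}"
proof
  note R = presentedD[OF P]
  note add = Q.subspace_add[OF R(1)] and z0 = Q.subspace_0[OF R(1)]
  assume "class_map Z \<delta> f z = class_map Z \<delta> f z'"
  moreover have "f (\<delta> 0 + z) \<in> class_map Z \<delta> f z" unfolding class_map_def using z0 by blast
  ultimately have "f (\<delta> 0 + z) \<in> class_map Z \<delta> f z'" by simp
  then obtain y where y: "y \<in> Z" "f z = f (\<delta> y + z')"
    unfolding class_map_def \<delta>.zero by (auto simp: image_iff)
  have "z - (\<delta> y + z') \<in> N" using R(8)[OF z add[OF Z[OF y(1)] z']] y(2) by blast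
  moreover have "z - z' = \<delta> y + (z - (\<delta> y + z'))" by simp
  ultimately show "z - z' \<in> {\<delta> y + b |y b. y \<in> Z \<and> b \<in> N}" using y(1) by blast
next
  note R = presentedD[OF P]
  note add = Q.subspace_add[OF R(1)] and z0 = Q.subspace_0[OF R(1)]
  assume "z - z' \<in> {\<delta> y + b |y b. y \<in> Z \<and> b \<in> N}"
  then obtain y b where yb: "y \<in> Z" "b \<in> N" "z - z' = \<delta> y + b" by blast
  have sub: "class_map Z \<delta> f u \<subseteq> class_map Z \<delta> f v"
    if u: "u \<in> Z" and v: "v \<in> Z" and y: "y \<in> Z" and b: "b \<in> N" and eq: "u - v = \<delta> y + b" for u v y b
  proof
    fix x assume "x \<in> class_map Z \<delta> f u"
    then obtain w where w: "w \<in> Z" "x = f (\<delta> w + u)" unfolding class_map_def by blast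
    have m: "\<delta> w + u \<in> Z" "\<delta> (w + y) + v \<in> Z" using add Z w(1) u v y by blast+
    have "u = \<delta> y + b + v" using eq by (simp add: algebra_simps)
    then have "(\<delta> w + u) - (\<delta> (w + y) + v) = b" by (simp add: \<delta>.add)
    then have "x = f (\<delta> (w + y) + v)" using R(8)[OF m] b w(2) by simp
    moreover have "w + y \<in> Z" using add w(1) y by blast
    ultimately show "x \<in> class_map Z \<delta> f v" unfolding class_map_def by blast
  qed
  have "z' - z = \<delta> (- y) + (- b)" using yb(3) by (simp add: \<delta>.neg algebra_simps)
  then show "class_map Z \<delta> f z = class_map Z \<delta> f z'"
    using sub[OF z z' yb] sub[OF z' z Q.subspace_neg[OF R(1) yb(1)] Q.subspace_neg[OF R(2) yb(2)]] by blast
qed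

lemma presented_homology:
  "presented (homology W D) {z \<in> Z. \<delta> z \<in> N} {\<delta> y + b |y b. y \<in> Z \<and> b \<in> N} (class_map Z \<delta> f)"
  (is "presented ?H ?Z ?N ?f")
proof -
  note R = presentedD[OF P]
  note add = Q.subspace_add[OF R(1)] and scale = Q.subspace_scale[OF R(1)] and z0 = Q.subspace_0[OF R(1)]
  have sZ: "Q.subspace ?Z"
    using R(1,2) unfolding Q.subspace_def by (auto simp: \<delta>.add \<delta>.scale \<delta>.zero)
  have sN: "Q.subspace ?N"
  proof -
    have "?N = {x + y |x y. x \<in> \<delta> ` Z \<and> y \<in> N}" by blast
    then show ?thesis using Q.subspace_sums[OF \<delta>.subspace_image[OF R(1)] R(2)] by simp
  qed
  have NZ: "?N \<subseteq> ?Z"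
  proof
    fix x assume "x \<in> ?N"
    then obtain y b where x: "x = \<delta> y + b" "y \<in> Z" "b \<in> N" by blast
    have "\<delta> x \<in> N" unfolding x(1) \<delta>.add
      using Q.subspace_add[OF R(2)] sq[OF x(2)] delta_N[OF x(3)] by blast
    moreover have "x \<in> Z" unfolding x(1) using add Z[OF x(2)] R(3) x(3) by blast
    ultimately show "x \<in> ?Z" by blast
  qed
  have ker: "D (f z) = \<zero>\<^bsub>W\<^esub> \<longleftrightarrow> \<delta> z \<in> N" if "z \<in> Z" for z
    using R(7) R(8)[OF Z[OF that] z0] D[OF that] by simp
  have carr: "carrier ?H = ?f ` ?Z"
  proof -
    have "carrier ?H = {(D ` carrier W) +>\<^bsub>W\<^esub> x |x. x \<in> carrier W \<and> D x = \<zero>\<^bsub>W\<^esub>}"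
      unfolding homology_def Let_def by simp
    also have "\<dots> = {(D ` carrier W) +>\<^bsub>W\<^esub> f z |z. z \<in> Z \<and> \<delta> z \<in> N}"
      using ker unfolding R(4) by blast
    also have "\<dots> = ?f ` ?Z" using coset_class_map by (auto simp: image_iff)
    finally show ?thesis .
  qed
  have H: "add ?H = set_add W" "smult ?H = (\<lambda>q X. \<Union>x\<in>X. (D ` carrier W) +>\<^bsub>W\<^esub> (q \<odot>\<^bsub>W\<^esub> x))"
    "\<zero>\<^bsub>?H\<^esub> = D ` carrier W" unfolding homology_def Let_def by simp_all
  have plus: "?f z \<oplus>\<^bsub>?H\<^esub> ?f z' = ?f (z + z')" if z: "z \<in> ?Z" "z' \<in> ?Z" for z z'
  proof -
    have zz: "z \<in> Z" "z' \<in> Z" using z by blast+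
    have el: "f (\<delta> y + z) \<oplus>\<^bsub>W\<^esub> f (\<delta> y' + z') = f (\<delta> (y + y') + (z + z'))" if "y \<in> Z" "y' \<in> Z" for y y'
      using R(5)[OF add[OF Z[OF that(1)] zz(1)] add[OF Z[OF that(2)] zz(2)]]
      by (simp add: \<delta>.add algebra_simps)
    show ?thesis unfolding H(1) set_add_def'
    proof (intro equalityI subsetI)
      fix x assume "x \<in> (\<Union>h\<in>?f z. \<Union>k\<in>?f z'. {h \<oplus>\<^bsub>W\<^esub> k})"
      then obtain y y' where y: "y \<in> Z" "y' \<in> Z" "x = f (\<delta> y + z) \<oplus>\<^bsub>W\<^esub> f (\<delta> y' + z')"
        unfolding class_map_def by blast
      then show "x \<in> ?f (z + z')" unfolding class_map_def using el add by blast
    next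
      fix x assume "x \<in> ?f (z + z')"
      then obtain y where y: "y \<in> Z" "x = f (\<delta> y + (z + z'))" unfolding class_map_def by blast
      then have "x = f (\<delta> y + z) \<oplus>\<^bsub>W\<^esub> f (\<delta> 0 + z')" using el[OF y(1) z0] by simp
      then show "x \<in> (\<Union>h\<in>?f z. \<Union>k\<in>?f z'. {h \<oplus>\<^bsub>W\<^esub> k})" unfolding class_map_def using y(1) z0 by blast
    qed
  qed
  have times: "q \<odot>\<^bsub>?H\<^esub> ?f z = ?f (qscale q z)" if z: "z \<in> ?Z" for q z
  proof -
    have zz: "z \<in> Z" using z by blast
    have "(D ` carrier W) +>\<^bsub>W\<^esub> (q \<odot>\<^bsub>W\<^esub> f (\<delta> y + z)) = ?f (qscale q z)" if y: "y \<in> Z" for y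
    proof -
      have m: "\<delta> y + z \<in> Z" by (rule add[OF Z[OF y] zz])
      have "(D ` carrier W) +>\<^bsub>W\<^esub> (q \<odot>\<^bsub>W\<^esub> f (\<delta> y + z)) = ?f (qscale q (\<delta> y + z))"
        unfolding R(6)[OF m] by (rule coset_class_map[OF scale[OF m]])
      also have "\<dots> = ?f (qscale q z)"
      proof -
        have "qscale q (\<delta> y + z) - qscale q z = \<delta> (qscale q y) + 0"
          unfolding \<delta>.scale by (rule ext) (simp add: algebra_simps)
        then show ?thesis
          using class_map_eq[OF scale[OF m] scale[OF zz]] scale[OF y] Q.subspace_0[OF R(2)] by blast
      qed
      finally show ?thesis .
    qed
    then show ?thesis unfolding H(2) using z0 unfolding class_map_def[of Z \<delta> f z] by auto
  qed
  have zero: "\<zero>\<^bsub>?H\<^esub> = ?f 0"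
    unfolding H(3) class_map_def R(4) image_image add_0_right by (rule image_cong[OF refl D])
  have eq: "?f z = ?f z' \<longleftrightarrow> z - z' \<in> ?N" if "z \<in> ?Z" "z' \<in> ?Z" for z z'
    by (rule class_map_eq) (use that in blast)+
  show ?thesis unfolding presented_def
    by (intro conjI ballI allI) (rule sZ sN NZ carr plus times zero eq; assumption?)+
qed

lemma induced_class_map:
  assumes lf: "Vector_Spaces.linear qscale qscale g'" and gZ: "\<And>z. z \<in> Z \<Longrightarrow> g' z \<in> Z"
    and g: "\<And>z. z \<in> Z \<Longrightarrow> g (f z) = f (g' z)"
    and comm: "\<And>z. z \<in> Z \<Longrightarrow> g' (\<delta> z) = \<delta> (g' z)" and z: "z \<in> Z"
  shows "induced W D g (class_map Z \<delta> f z) = class_map Z \<delta> f (g' z)"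
proof -
  interpret g: Vector_Spaces.linear qscale qscale g' by (rule lf)
  note R = presentedD[OF P]
  note add = Q.subspace_add[OF R(1)] and z0 = Q.subspace_0[OF R(1)]
  have "(D ` carrier W) +>\<^bsub>W\<^esub> g (f (\<delta> y + z)) = class_map Z \<delta> f (g' z)" if y: "y \<in> Z" for y
  proof -
    have m: "\<delta> y + z \<in> Z" by (rule add[OF Z[OF y] z])
    have "(D ` carrier W) +>\<^bsub>W\<^esub> g (f (\<delta> y + z)) = class_map Z \<delta> f (g' (\<delta> y + z))"
      unfolding g[OF m] by (rule coset_class_map[OF gZ[OF m]])
    also have "\<dots> = class_map Z \<delta> f (g' z)"
    proof -
      have "g' (\<delta> y + z) - g' z = \<delta> (g' y) + 0" by (simp add: g.add comm[OF y])
      then show ?thesis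
        using class_map_eq[OF gZ[OF m] gZ[OF z]] gZ[OF y] Q.subspace_0[OF R(2)] by blast
    qed
    finally show ?thesis .
  qed
  then show ?thesis unfolding induced_def using z0 unfolding class_map_def[of Z \<delta> f z] by auto
qed

end

context knot_complex
begin

lemma presented_total_space: "presented (total_space L M) V {0} (\<lambda>v. v)"
  unfolding presented_def
  using subspace_vecs[of L M] Q.subspace_0[OF subspace_vecs[of L M]]
  by (auto simp: carrier_total_space) (auto simp: total_space_def fun_eq_iff)

abbreviation V1 where "V1 \<equiv> {z \<in> V. d z \<in> {0}}"
abbreviation N1 where "N1 \<equiv> {d y + b |y b. y \<in> V \<and> b \<in> {0}}"
abbreviation f1 where "f1 \<equiv> class_map V d (\<lambda>v. v)"
abbreviation f2 where "f2 \<equiv> class_map V1 s f1"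

lemma presented_HH0_mf: "presented (HH0_mf n M) V1 N1 f1"
  unfolding HH0_mf_def
  by (rule presented_homology[OF presented_total_space linear_apply_mat]) (use d_V dd in auto)

lemma HH0_dchi_f1: "z \<in> V \<Longrightarrow> HH0_dchi n M (f1 z) = f1 (s z)"
  unfolding HH0_dchi_def
  by (rule induced_class_map[OF presented_total_space linear_apply_mat _ _ _ linear_apply_mat])
    (use d_V s_V dd ds in auto)

lemma presented_HH0: "presented (HH0 n M) cycles boundaries f2"
proof -
  have "presented (HH0 n M) {z \<in> V1. s z \<in> N1} {s y + b |y b. y \<in> V1 \<and> b \<in> N1} f2"
    unfolding HH0_def
  proof (rule presented_homology[OF presented_HH0_mf linear_apply_mat])
    show "s z \<in> V1" if "z \<in> V1" for z using that s_V ds[of z] by simp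
    show "s (s z) \<in> N1" if "z \<in> V1" for z
    proof -
      have "s (s z) = d 0 + 0" using ss[of z] by simp
      then show ?thesis using Q.subspace_0[OF subspace_vecs] by blast
    qed
    show "HH0_dchi n M (f1 z) = f1 (s z)" if "z \<in> V1" for z using HH0_dchi_f1 that by blast
  qed
  moreover have "{z \<in> V1. s z \<in> N1} = cycles" unfolding cycles_def by auto
  moreover have "{s y + b |y b. y \<in> V1 \<and> b \<in> N1} = boundaries"
  proof -
    have N1: "b \<in> N1 \<longleftrightarrow> (\<exists>u\<in>V. b = d u)" for b by auto
    have l: "x \<in> {s y + b |y b. y \<in> V1 \<and> b \<in> N1} \<longleftrightarrow> (\<exists>w\<in>V1. \<exists>u\<in>V. x = s w + d u)" for x
      unfolding mem_Collect_eq[of x] N1 by blast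
    have r: "x \<in> boundaries \<longleftrightarrow> (\<exists>w\<in>V1. \<exists>u\<in>V. x = s w + d u)" for x
      unfolding boundaries_def by blast
    show ?thesis by (rule Set.set_eqI) (rule trans[OF l r[symmetric]])
  qed
  ultimately show ?thesis by simp
qed

text \<open>A class counts as homogeneous if it contains a class with a homogeneous representative. Such a representative differs
  from the given cycle by a boundary, hence is itself a cycle with the same class.\<close>

lemma carrier_HH0_component: "carrier (HH0_component n M i j k) = f2 ` T.Zh i j k"
proof -
  note R1 = presentedD[OF presented_HH0_mf] and R2 = presentedD[OF presented_HH0]
  have z0: "0 \<in> V" "0 \<in> V1" using Q.subspace_0[OF subspace_vecs] Q.subspace_0[OF R1(1)] by blast+
  have "carrier (HH0_component n M i j k)
      = {X \<in> f2 ` cycles. X \<inter> {Y \<in> f1 ` V1. Y \<inter> C i j k \<noteq> {}} \<noteq> {}}"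
    using R1(4) R2(4) unfolding HH0_component_def homology_classes_def HH0_def[symmetric] HH0_mf_def[symmetric]
    by simp
  also have "\<dots> = f2 ` T.Zh i j k"
  proof (intro equalityI subsetI)
    fix X assume "X \<in> {X \<in> f2 ` cycles. X \<inter> {Y \<in> f1 ` V1. Y \<inter> C i j k \<noteq> {}} \<noteq> {}}"
    then obtain z Y v where z: "z \<in> cycles" "X = f2 z" and Y: "Y \<in> f2 z" and v: "v \<in> Y" "v \<in> C i j k" by blast
    obtain y where y: "y \<in> V1" "Y = f1 (s y + z)" using Y unfolding class_map_def[of V1] by blast
    obtain u where u: "u \<in> V" "v = d u + (s y + z)" using v(1) unfolding y(2) class_map_def by blast
    have bd: "v - z \<in> boundaries"
      unfolding boundaries_def using u y(1) by (intro CollectI exI[of _ y] exI[of _ u]) simp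
    have "v = z + (v - z)" by simp
    then have vc: "v \<in> cycles" using Q.subspace_add[OF R2(1) z(1)] R2(3) bd by (metis subsetD)
    then have "X = f2 v" unfolding z(2) using R2(8)[OF vc z(1)] bd by simp
    moreover have "v \<in> T.Zh i j k" unfolding Zh_cycles using v(2) vc by blast
    ultimately show "X \<in> f2 ` T.Zh i j k" by blast
  next
    fix X assume "X \<in> f2 ` T.Zh i j k"
    then obtain v where "v \<in> T.Zh i j k" and X: "X = f2 v" by (rule imageE)
    then have v: "v \<in> C i j k" "v \<in> cycles" "X = f2 v" unfolding Zh_cycles by blast+
    have vV: "v \<in> V1" using v(2) unfolding cycles_def by blast
    have "f1 (s 0 + v) \<in> f2 v" unfolding class_map_def[of V1] using z0 by blast
    then have "f1 v \<in> X" using v(3) by simp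
    moreover have "d 0 + v \<in> f1 v" unfolding class_map_def[of V] using z0 by blast
    then have "v \<in> f1 v" by simp
    ultimately show "X \<in> {X \<in> f2 ` cycles. X \<inter> {Y \<in> f1 ` V1. Y \<inter> C i j k \<noteq> {}} \<noteq> {}}"
      using v vV by blast
  qed
  finally show ?thesis .
qed

lemma presented_HH0_component: "presented (HH0_component n M i j k) (T.Zh i j k) (T.Bh i j k) f2"
proof -
  note R = presentedD[OF presented_HH0]
  have ops: "add (HH0_component n M i j k) = add (HH0 n M)" "smult (HH0_component n M i j k) = smult (HH0 n M)"
    "zero (HH0_component n M i j k) = zero (HH0 n M)" unfolding HH0_component_def by simp_all
  have cyc: "z \<in> cycles" if "z \<in> T.Zh i j k" for z using that unfolding Zh_cycles by blast
  have eq: "f2 z = f2 z' \<longleftrightarrow> z - z' \<in> T.Bh i j k" if "z \<in> T.Zh i j k" "z' \<in> T.Zh i j k" for z z'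
  proof -
    have "z - z' \<in> C i j k" using Q.subspace_diff[OF T.subspace_C] that unfolding Zh_cycles by blast
    then show ?thesis using R(8)[OF cyc[OF that(1)] cyc[OF that(2)]] unfolding Bh_boundaries by blast
  qed
  show ?thesis unfolding presented_def ops
    by (intro conjI ballI allI)
      (rule T.subspace_Zh T.subspace_Bh T.Bh_subset carrier_HH0_component R(5)[OF cyc cyc] R(6)[OF cyc]
        R(7) eq; assumption?)+
qed

theorem HH0_component_dim:
  "vectorspace.fin_dim class_ring (HH0_component n M i j k)"
  "vectorspace.dim class_ring (HH0_component n M i j k) = T.hdim i j k"
  unfolding T.hdim_def by (rule presented_dim[OF presented_HH0_component T.finite_span_Zh])+

end

text \<open>The closed braid supplies the data of a \<open>knot_complex\<close>: the potential vanishes because the stack of pieces closes up,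
  and the components of the strand relation being one orbit identifies all variables.\<close>

theorem corollary1p3:
  fixes n :: nat and F :: "nat list" and Ps :: "(nat \<times> piece) list"
    and chi0 chi1 :: "gen \<Rightarrow> gen \<Rightarrow> qpoly"
  assumes "chi_maps chi0 chi1"
    and "marked_closed_braid n F Ps"
    and "num_components n Ps = 1"
  shows "\<exists>D :: int \<Rightarrow> int \<Rightarrow> nat.
    finite {(i, j). D i j \<noteq> 0} \<and>
    (\<forall>i j. \<exists>T0 :: int. \<forall>T\<ge>T0.
       vectorspace.fin_dim class_ring (HH0_component n (C0 chi0 chi1 Ps) i j (2 * T - j)) \<and>
       vectorspace.dim class_ring (HH0_component n (C0 chi0 chi1 Ps) i j (2 * T - j)) = D i j) \<and>
    odd (\<Sum>(i, j) \<in> {(i, j). D i j \<noteq> 0}. D i j)"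
proof -
  let ?M = "C0 chi0 chi1 Ps" and ?R = "\<Union>P\<in>set Ps. strands (snd P)"
  have stacks: "stacks F Ps F" and F: "F \<noteq> []" and cov: "\<forall>p<length F. \<exists>P\<in>set Ps. p \<in> positions P"
    and tops: "set (all_tops Ps) = {1..n}"
    using assms(2) unfolding marked_closed_braid_def all_tops_def by auto
  obtain P where P: "P \<in> set Ps" using F cov by blast
  have labels: "set (bots (snd P)) \<union> set (tops (snd P)) \<subseteq> {1..n}" if "P \<in> set Ps" for P
    by (rule marked_closed_braid_labels[OF assms(2) that])
  note C = C0_properties[OF assms(1), of Ps "{1..n}", OF labels]
  interpret knot_complex n ?M ?R
  proof
    show "mf_complex {1..n} 0 ?M" using C(1) unfolding stacks_potential[OF stacks] by simp
    show "1 \<le> n"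
    proof -
      have "set (tops (snd P)) \<noteq> {}" by (cases "snd P") auto
      then show ?thesis using labels[OF P] by fastforce
    qed
    show "gens ?M \<noteq> {}" using genct_parity[OF assms(2), of chi0 chi1 0] unfolding genct_def by auto
    show "null_mf {1..n} ?M pA"
      by (rule C(2)[OF _ P null_mono(1)[OF labels[OF P] piece_properties(2)[OF assms(1)]]])
    show "\<exists>p q. pX v - pX u = p - q \<and> null_total {1..n} ?M p \<and> (null_total {1..n} ?M q \<or> q = 0)"
      if uv: "(u, v) \<in> ?R" for u v
    proof -
      obtain P' where P': "P' \<in> set Ps" "(u, v) \<in> strands (snd P')" using uv by blast
      note null = C(3)[OF _ P'(1) null_mono(2)[OF labels[OF P'(1)]]]
      show ?thesis using piece_properties(3)[OF assms(1) P'(2)] null by blast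
    qed
    show "(u, v) \<in> ?R\<^sup>*" if "u \<in> {1..n}" "v \<in> {1..n}" for u v
      by (rule knot_connected[OF assms(3) that])
    show "odd (genct ?M (xcount n) c) \<longleftrightarrow> c = 0" for c by (rule genct_parity[OF assms(2)])
  qed
  show ?thesis unfolding HH0_component_dim(2) using stable_dimensions HH0_component_dim(1) by simp
qed

end
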